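(* Every subcubic outerplanar graph is $(1,2^4,3)$-packing edge-colorable, that is, has a $(1,2,2,2,2,3)$-packing edge-coloring.
   Context: Graphs are finite and simple. A graph is subcubic if its maximum degree is at most $3$. The distance between two distinct edges of a graph $G$ is their distance in the line graph of $G$, so edges sharing an endpoint are at distance $1$ (edges in different components are at infinite distance). For a non-decreasing sequence $S=(s_1,\dots,s_k)$ of positive integers, an $S$-packing edge-coloring ($S$-coloring) of $G$ is a partition of $E(G)$ into (possibly empty) classes $E_1,\dots,E_k$ such that for each $i$ any two distinct edges in $E_i$ are at distance at least $s_i+1$. Exponents denote repetition: $(1,2^4,3)=(1,2,2,2,2,3)$. *)

theory Defs
  imports "HOL-Analysis.Analysis" "HOL-Library.Extended_Nat"
begin

text \<open>A graph is given by its vertex set and its set of edges, each edge being the set of its two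
  endpoints.\<close>

definition simple_graph :: "'a set \<Rightarrow> 'a set set \<Rightarrow> bool" where
  "simple_graph V E \<longleftrightarrow> finite V \<and> (\<forall>e\<in>E. e \<subseteq> V \<and> card e = 2)"

definition vdegree :: "'a set set \<Rightarrow> 'a \<Rightarrow> nat" where
  "vdegree E v = card {e \<in> E. v \<in> e}"

definition subcubic :: "'a set \<Rightarrow> 'a set set \<Rightarrow> bool" where
  "subcubic V E \<longleftrightarrow> (\<forall>v\<in>V. vdegree E v \<le> 3)"

text \<open>The distance is the least length of a walk; the infimum over the empty set is \<open>\<infinity>\<close>.\<close>

definition graph_dist :: "'a set set \<Rightarrow> 'a \<Rightarrow> 'a \<Rightarrow> enat" where
  "graph_dist E u v = (INF n\<in>{n. (u, v) \<in> {(x, y). {x, y} \<in> E} ^^ n}. enat n)"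

definition line_graph :: "'a set set \<Rightarrow> 'a set set set" where
  "line_graph E = {{e, f} | e f. e \<in> E \<and> f \<in> E \<and> e \<noteq> f \<and> e \<inter> f \<noteq> {}}"

definition edge_dist :: "'a set set \<Rightarrow> 'a set \<Rightarrow> 'a set \<Rightarrow> enat" where
  "edge_dist E e f = graph_dist (line_graph E) e f"

definition packing_sequence :: "nat list \<Rightarrow> bool" where
  "packing_sequence S \<longleftrightarrow> sorted S \<and> (\<forall>s\<in>set S. 0 < s)"

text \<open>The classes are indexed from \<open>0\<close>, so \<open>C i\<close> is the class belonging to \<open>S ! i\<close>.\<close>

definition packing_edge_coloring :: "'a set set \<Rightarrow> nat list \<Rightarrow> (nat \<Rightarrow> 'a set set) \<Rightarrow> bool" where
  "packing_edge_coloring E S C \<longleftrightarrow>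
     (\<Union>i<length S. C i) = E \<and>
     disjoint_family_on C {..<length S} \<and>
     (\<forall>i<length S. \<forall>e\<in>C i. \<forall>f\<in>C i. e \<noteq> f \<longrightarrow> edge_dist E e f \<ge> enat (S ! i + 1))"

definition packing_edge_colorable :: "'a set set \<Rightarrow> nat list \<Rightarrow> bool" where
  "packing_edge_colorable E S \<longleftrightarrow> packing_sequence S \<and> (\<exists>C. packing_edge_coloring E S C)"

text \<open>Drawings without crossings in the plane, taken to be the complex plane: \<open>p\<close> places the
  vertices, and \<open>\<gamma> e\<close> is a Jordan arc joining the endpoints of \<open>e\<close> (in either direction) which
  meets the vertices and the other arcs only in its own end points.\<close>

definition plane_drawing ::
  "'a set \<Rightarrow> 'a set set \<Rightarrow> ('a \<Rightarrow> complex) \<Rightarrow> ('a set \<Rightarrow> real \<Rightarrow> complex) \<Rightarrow> bool" where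
  "plane_drawing V E p \<gamma> \<longleftrightarrow>
     inj_on p V \<and>
     (\<forall>e\<in>E. arc (\<gamma> e) \<and> {pathstart (\<gamma> e), pathfinish (\<gamma> e)} = p ` e \<and>
             path_image (\<gamma> e) \<inter> p ` V = p ` e) \<and>
     (\<forall>e\<in>E. \<forall>f\<in>E. e \<noteq> f \<longrightarrow> path_image (\<gamma> e) \<inter> path_image (\<gamma> f) = p ` (e \<inter> f))"

definition drawing_image ::
  "'a set \<Rightarrow> 'a set set \<Rightarrow> ('a \<Rightarrow> complex) \<Rightarrow> ('a set \<Rightarrow> real \<Rightarrow> complex) \<Rightarrow> complex set" where
  "drawing_image V E p \<gamma> = p ` V \<union> (\<Union>e\<in>E. path_image (\<gamma> e))"

text \<open>For a finite graph the image of a drawing is compact, so \<^term>\<open>outside\<close> is its unique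
  unbounded face. The vertices belong to the image, hence they lie on the outer face in the sense
  of lying on its boundary.\<close>

definition outerplanar :: "'a set \<Rightarrow> 'a set set \<Rightarrow> bool" where
  "outerplanar V E \<longleftrightarrow>
     (\<exists>p \<gamma>. plane_drawing V E p \<gamma> \<and> p ` V \<subseteq> frontier (outside (drawing_image V E p \<gamma>)))"

end

theory Submission
  imports Defs
begin

text \<open>Outerplanarity is used only through two consequences of the Jordan curve theorem: no two
  vertices are joined by three internally disjoint paths with inner vertices, and no two chords of a
  cycle cross. Cutting the graph at bridges leaves stars and cycles with noncrossing chords and
  pendant edges. A cycle with chords is coloured so that the four cycle edges at the ends of a chord
  get the four colours of the induced matchings and the chord gets the colour of the matching; then
  each side of the chord can be filled in recursively. Only near the edge that attaches the block to
  the part coloured before may this fail, and there one chord gets the colour of the last class.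
  Since such a chord is never adjacent to a bridge, two of them in different blocks are far apart.
  In the colourings, \<open>0\<close> stands for the matching, \<open>1, \<dots>, 4\<close> for the induced matchings and \<open>5\<close> for
  the class of edges at distance at least four.\<close>

section \<open>Three arcs with common end points\<close>

text \<open>A nonzero colour cannot return within distance two, so the four cycle edges at the ends
  of a chord of colour \<open>0\<close> need four colours, and there are exactly four. What lies
  under a chord thus meets the same situation at every chord, which closes the recursion. The
  obstacle is the vertex at which a block hangs on a bridge. The bridge has some colour
  \<open>c\<close>, and the at most two further edges at its other end have colours \<open>a\<close>
  and \<open>b\<close>; the cycle edges at the root must respect these, and the interval that runs
  once around the cycle carries the same star at both ends, so that its end colours repeat. The
  induction therefore proves more than colourability: for all distinct \<open>c\<close>,
  \<open>a\<close>, \<open>b\<close> there is a colouring that tolerates such a bridge at a given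
  vertex of degree at most two. The whole graph enters this induction with an imaginary third edge
  at a vertex of degree at most two, and such a vertex exists in every nonempty graph
  considered.\<close>

lemma arc_interior_connected:
  assumes "arc g" shows "connected (path_image g - {pathstart g, pathfinish g})"
  using assms by (simp add: arc_imp_simple_path connected_simple_path_endless)

lemma arc_interior_nonempty:
  assumes "arc g" shows "path_image g - {pathstart g, pathfinish g} \<noteq> {}"
  using nonempty_simple_path_endless[OF arc_imp_simple_path[OF assms]] .

lemma joined_arcs_loop:
  fixes c1 c2 :: "real \<Rightarrow> complex"
  assumes "arc c1" "pathstart c1 = a" "pathfinish c1 = b"
    and "arc c2" "pathstart c2 = a" "pathfinish c2 = b"
    and "path_image c1 \<inter> path_image c2 = {a, b}"
  shows "simple_path (c1 +++ reversepath c2)"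
    and "pathfinish (c1 +++ reversepath c2) = pathstart (c1 +++ reversepath c2)"
    and "path_image (c1 +++ reversepath c2) = path_image c1 \<union> path_image c2"
  using assms by (auto simp: simple_path_join_loop_eq arc_reversepath path_image_join)

text \<open>The open arc is connected and misses the curve formed by the other two, so it cannot
  meet both of the disjoint open sets \<open>inside\<close> and \<open>outside\<close>.\<close>

lemma arc_inside_or_outside:
  fixes c1 c2 c3 :: "real \<Rightarrow> complex"
  assumes c1: "arc c1" "pathstart c1 = a" "pathfinish c1 = b"
    and c2: "arc c2" "pathstart c2 = a" "pathfinish c2 = b"
    and c3: "arc c3" "pathstart c3 = a" "pathfinish c3 = b"
    and "path_image c1 \<inter> path_image c3 = {a, b}"
    and "path_image c2 \<inter> path_image c3 = {a, b}"
  shows "path_image c3 - {a, b} \<subseteq> inside (path_image c1 \<union> path_image c2) \<or>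
         path_image c3 - {a, b} \<subseteq> outside (path_image c1 \<union> path_image c2)"
proof -
  let ?S = "path_image c1 \<union> path_image c2"
  let ?T = "path_image c3 - {a, b}"
  have con: "connected ?T"
    using arc_interior_connected[OF c3(1)] c3 by simp
  have sub: "?T \<subseteq> inside ?S \<union> outside ?S"
    using assms by (auto simp: inside_Un_outside)
  have cl: "closed ?S"
    using c1 c2 by (intro closed_Un closed_path_image arc_imp_path) auto
  have "open (inside ?S)" "open (outside ?S)"
    using cl by (auto intro: open_inside open_outside)
  moreover have "inside ?S \<inter> outside ?S = {}"
    by (rule inside_Int_outside)
  ultimately show ?thesis
    using connectedD[OF con, of "inside ?S" "outside ?S"] sub by blast
qed

text \<open>If no arc lay inside the other two, then a point inside \<open>c1 \<union> c2\<close> could be joined to infinity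
  both in the complement of \<open>c1 \<union> c3\<close> and in that of \<open>c2 \<union> c3\<close>, hence by Janiszewski's theorem in the
  complement of all three.\<close>

lemma theta_inside:
  fixes c1 c2 c3 :: "real \<Rightarrow> complex"
  assumes c1: "arc c1" "pathstart c1 = a" "pathfinish c1 = b"
    and c2: "arc c2" "pathstart c2 = a" "pathfinish c2 = b"
    and c3: "arc c3" "pathstart c3 = a" "pathfinish c3 = b"
    and i12: "path_image c1 \<inter> path_image c2 = {a, b}"
    and i13: "path_image c1 \<inter> path_image c3 = {a, b}"
    and i23: "path_image c2 \<inter> path_image c3 = {a, b}"
  shows "path_image c1 - {a, b} \<subseteq> inside (path_image c2 \<union> path_image c3) \<or>
         path_image c2 - {a, b} \<subseteq> inside (path_image c1 \<union> path_image c3) \<or>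
         path_image c3 - {a, b} \<subseteq> inside (path_image c1 \<union> path_image c2)"
proof (rule ccontr)
  let ?P1 = "path_image c1" and ?P2 = "path_image c2" and ?P3 = "path_image c3"
  assume neg: "\<not> ?thesis"
  have o1: "?P1 - {a, b} \<subseteq> outside (?P2 \<union> ?P3)"
    using arc_inside_or_outside[OF c2 c3 c1] neg i12 i13 by (simp add: Int_commute)
  have o2: "?P2 - {a, b} \<subseteq> outside (?P1 \<union> ?P3)"
    using arc_inside_or_outside[OF c1 c3 c2] neg i12 i23 by (simp add: Int_commute)
  have o3: "?P3 - {a, b} \<subseteq> outside (?P1 \<union> ?P2)"
    using arc_inside_or_outside[OF c1 c2 c3] neg i13 i23 by (simp add: Int_commute)
  note loop = joined_arcs_loop[OF c1 c2 i12]
  define I where "I = inside (?P1 \<union> ?P2)"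
  have J: "I \<noteq> {}" "open I" "connected I" "frontier I = ?P1 \<union> ?P2"
    using Jordan_inside_outside[OF loop(1,2)] unfolding loop(3) I_def by auto
  obtain p where p: "p \<in> I" using J by auto
  have cp: "compact ?P1" "compact ?P2" "compact ?P3"
    using c1 c2 c3 by (auto intro: compact_path_image arc_imp_path)
  have IP: "I \<inter> ?P1 = {}" "I \<inter> ?P2 = {}"
    using inside_no_overlap[of "?P1 \<union> ?P2", folded I_def] by blast+
  have IO: "I \<inter> outside (?P1 \<union> ?P2) = {}" unfolding I_def by (rule inside_Int_outside)
  have abP: "a \<in> ?P1" "b \<in> ?P1"
    using c1 pathstart_in_path_image[of c1] pathfinish_in_path_image[of c1] by auto
  have I3: "I \<inter> ?P3 = {}" using o3 IO IP abP by auto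
  \<comment> \<open>\<open>I\<close> is connected and misses \<open>S\<close>, so it lies on one
    side of \<open>S\<close>; a frontier point of \<open>I\<close> in the open set
    \<open>outside S\<close> decides which. Inner points of the arcs \<open>c2\<close> and
    \<open>c1\<close> will serve as \<open>z\<close>.\<close>
  have grow: "I \<subseteq> outside S" if "closed S" "I \<inter> S = {}" "z \<in> outside S" "z \<in> frontier I" for S z
  proof -
    have "outside S \<inter> I \<noteq> {}"
      using that open_outside[OF that(1)] open_Int_closure_eq_empty[of "outside S" I]
      by (auto simp: frontier_def)
    moreover have "I \<subseteq> inside S \<union> outside S" using that(2) by (auto simp: inside_Un_outside)
    moreover have "inside S \<inter> outside S \<inter> I = {}" using inside_Int_outside[of S] by auto
    moreover note open_inside[OF that(1)] open_outside[OF that(1)]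
    ultimately show ?thesis
      using connectedD[OF J(3), of "inside S" "outside S"] by blast
  qed
  obtain z1 where z1: "z1 \<in> ?P1 - {a, b}" using arc_interior_nonempty[OF c1(1)] c1 by auto
  obtain z2 where z2: "z2 \<in> ?P2 - {a, b}" using arc_interior_nonempty[OF c2(1)] c2 by auto
  have I13: "I \<subseteq> outside (?P1 \<union> ?P3)"
    using grow[of "?P1 \<union> ?P3" z2] z2 o2 IP I3 J(4) cp by (auto simp: closed_Un compact_imp_closed)
  have I23: "I \<subseteq> outside (?P2 \<union> ?P3)"
    using grow[of "?P2 \<union> ?P3" z1] z1 o1 IP I3 J(4) cp by (auto simp: closed_Un compact_imp_closed)
  let ?U = "?P1 \<union> ?P3 \<union> (?P2 \<union> ?P3)"
  have bU: "bounded ?U" using cp by (auto intro: compact_imp_bounded)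
  obtain z where z: "z \<in> outside ?U"
    using outside_bounded_nonempty[OF bU] by auto
  have zo: "z \<in> outside (?P1 \<union> ?P3)" "z \<in> outside (?P2 \<union> ?P3)"
    using z outside_mono[of "?P1 \<union> ?P3" ?U] outside_mono[of "?P2 \<union> ?P3" ?U] by auto
  have conn: "connected_component (- S) p z" if "p \<in> outside S" "z \<in> outside S" "bounded S" for S
  proof -
    have "connected (outside S)" using that by (simp add: connected_outside)
    then show ?thesis
      unfolding connected_component_def using that outside_no_overlap[of S] by blast
  qed
  have "connected_component (- ?U) p z"
  proof (rule Janiszewski)
    show "compact (?P1 \<union> ?P3)" "closed (?P2 \<union> ?P3)" using cp by (auto simp: compact_imp_closed)
    \<comment> \<open>The two curves meet exactly in the third arc, which is connected, as
      Janiszewski's theorem demands.\<close>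
    have "(?P1 \<union> ?P3) \<inter> (?P2 \<union> ?P3) = ?P3"
      using i12 i13 i23 by blast
    then show "connected ((?P1 \<union> ?P3) \<inter> (?P2 \<union> ?P3))"
      using c3 by (simp add: connected_arc_image)
    show "connected_component (- (?P1 \<union> ?P3)) p z"
      by (rule conn) (use p I13 zo cp in \<open>auto intro: compact_imp_bounded\<close>)
    show "connected_component (- (?P2 \<union> ?P3)) p z"
      by (rule conn) (use p I23 zo cp in \<open>auto intro: compact_imp_bounded\<close>)
  qed
  then have "p \<in> outside ?U"
    using z outside_same_component[of ?U z p] connected_component_sym by blast
  then have "p \<in> outside (?P1 \<union> ?P2)"
    using outside_mono[of "?P1 \<union> ?P2" ?U] by auto
  then show False using p IO by auto
qed

section \<open>Outerplanar drawings\<close>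

definition gpath :: "'a set set \<Rightarrow> 'a list \<Rightarrow> bool" where
  "gpath E xs \<longleftrightarrow> distinct xs \<and> successively (\<lambda>x y. {x, y} \<in> E) xs"

fun path_edges :: "'a list \<Rightarrow> 'a set set" where
  "path_edges (x # y # r) = insert {x, y} (path_edges (y # r))"
| "path_edges _ = {}"

lemma path_edges_subset: "successively (\<lambda>x y. {x, y} \<in> E) xs \<Longrightarrow> path_edges xs \<subseteq> E"
  by (induction xs rule: path_edges.induct) auto

lemma Union_path_edges: "2 \<le> length xs \<Longrightarrow> \<Union>(path_edges xs) = set xs"
proof (induction xs rule: path_edges.induct)
  case (1 x y r)
  then show ?case by (cases r) auto
qed auto

lemma path_edges_hd:
  assumes "e \<in> path_edges (x # xs)" "x \<in> e" "distinct (x # xs)"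
  shows "xs \<noteq> [] \<and> e = {x, hd xs}"
proof (cases xs)
  case (Cons y r)
  have "\<Union>(path_edges (y # r)) \<subseteq> set (y # r)"
    by (cases r) (use Union_path_edges[of "y # r"] in auto)
  then show ?thesis using assms Cons by auto
qed (use assms in auto)

lemma ends_notin_path_edges:
  assumes "distinct (x # A @ [y])" "A \<noteq> []"
  shows "{x, y} \<notin> path_edges (x # A @ [y])"
  using path_edges_hd[of "{x, y}" x "A @ [y]"] assms by (cases A) (auto simp: doubleton_eq_iff)

lemma successively_appendD:
  "successively P (xs @ ys) \<Longrightarrow> successively P xs" "successively P (xs @ ys) \<Longrightarrow> successively P ys"
  by (auto simp: successively_append_iff)

lemma successively_join:
  "successively P (xs @ [y]) \<Longrightarrow> successively P (y # ys) \<Longrightarrow> successively P (xs @ y # ys)"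
  by (cases xs rule: rev_cases) (auto simp: successively_append_iff successively_Cons)

lemma path_edges_append: "path_edges (xs @ y # ys) = path_edges (xs @ [y]) \<union> path_edges (y # ys)"
  by (induction xs rule: path_edges.induct) auto

lemma path_edges_rev: "path_edges (rev xs) = path_edges xs"
proof (induction xs rule: path_edges.induct)
  case (1 x y r)
  have "path_edges (rev (x # y # r)) = path_edges (rev (y # r)) \<union> {{x, y}}"
    using path_edges_append[of "rev r" y "[x]"] by (simp add: insert_commute)
  then show ?case using 1 by simp
qed auto

lemma gpath_rev: "gpath E (rev xs) \<longleftrightarrow> gpath E xs"
  by (simp add: gpath_def successively_rev insert_commute)

section \<open>Drawn paths as arcs\<close>

lemma plane_drawing_edge_arc:
  assumes "plane_drawing V E p \<gamma>" "{x, y} \<in> E"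
  obtains g where "arc g" "pathstart g = p x" "pathfinish g = p y"
    "path_image g = path_image (\<gamma> {x, y})"
proof -
  have a: "arc (\<gamma> {x, y})" "{pathstart (\<gamma> {x, y}), pathfinish (\<gamma> {x, y})} = {p x, p y}"
    using assms by (auto simp: plane_drawing_def)
  show thesis
  proof (cases "pathstart (\<gamma> {x, y}) = p x \<and> pathfinish (\<gamma> {x, y}) = p y")
    case True
    then show thesis using a that by blast
  next
    case False
    then show thesis
      using a that[of "reversepath (\<gamma> {x, y})"]
      by (auto simp: doubleton_eq_iff arc_reversepath)
  qed
qed

lemma drawing_edges_Int:
  assumes d: "plane_drawing V E p \<gamma>" and sub: "F \<subseteq> E" "G \<subseteq> E" "F \<inter> G = {}"
  shows "(\<Union>e\<in>F. path_image (\<gamma> e)) \<inter> (\<Union>e\<in>G. path_image (\<gamma> e)) = p ` (\<Union>F \<inter> \<Union>G)"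
proof -
  have "path_image (\<gamma> e) \<inter> path_image (\<gamma> f) = p ` (e \<inter> f)" if "e \<in> F" "f \<in> G" for e f
    using d sub that unfolding plane_drawing_def by (metis disjoint_iff subsetD)
  moreover have "(\<Union>e\<in>F. path_image (\<gamma> e)) \<inter> (\<Union>e\<in>G. path_image (\<gamma> e)) =
      (\<Union>e\<in>F. \<Union>f\<in>G. path_image (\<gamma> e) \<inter> path_image (\<gamma> f))" by blast
  ultimately have "(\<Union>e\<in>F. path_image (\<gamma> e)) \<inter> (\<Union>e\<in>G. path_image (\<gamma> e)) =
      (\<Union>e\<in>F. \<Union>f\<in>G. p ` (e \<inter> f))" by simp
  also have "\<dots> = p ` (\<Union>F \<inter> \<Union>G)" by blast
  finally show ?thesis .
qed

text \<open>The arc of the first edge meets the rest of the path only in \<open>p y\<close>, because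
  drawn edges share nothing but the images of common vertices and the path is simple. Hence the
  concatenation is again an arc.\<close>

lemma gpath_arc:
  assumes d: "plane_drawing V E p \<gamma>"
  shows "gpath E (x # y # r) \<Longrightarrow> \<exists>g. arc g \<and> pathstart g = p x \<and> pathfinish g = p (last (y # r)) \<and>
    path_image g = (\<Union>e\<in>path_edges (x # y # r). path_image (\<gamma> e))"
proof (induction r arbitrary: x y)
  case Nil
  then have E: "{x, y} \<in> E" by (auto simp: gpath_def)
  show ?case by (rule plane_drawing_edge_arc[OF d E]) auto
next
  case (Cons z r)
  have E: "{x, y} \<in> E" and gp: "gpath E (y # z # r)" using Cons.prems by (auto simp: gpath_def)
  obtain h where h: "arc h" "pathstart h = p x" "pathfinish h = p y"
    "path_image h = path_image (\<gamma> {x, y})"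
    using plane_drawing_edge_arc[OF d E] .
  obtain g where g: "arc g" "pathstart g = p y" "pathfinish g = p (last (z # r))"
    "path_image g = (\<Union>e\<in>path_edges (y # z # r). path_image (\<gamma> e))"
    using Cons.IH[OF gp] by auto
  have U: "\<Union>(path_edges (y # z # r)) = set (y # z # r)" by (rule Union_path_edges) simp
  have dx: "x \<notin> set (y # z # r)" using Cons.prems by (auto simp: gpath_def)
  have "path_edges (y # z # r) \<subseteq> E" using gp path_edges_subset by (auto simp: gpath_def)
  moreover have "{x, y} \<notin> path_edges (y # z # r)" using U dx by blast
  ultimately have "path_image h \<inter> path_image g = p ` ({x, y} \<inter> set (y # z # r))"
    using drawing_edges_Int[OF d, of "{{x, y}}" "path_edges (y # z # r)"] E U
    unfolding h(4) g(4) by auto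
  also have "\<dots> = {p y}" using dx by auto
  finally have "arc (h +++ g)" using arc_join[OF h(1) g(1)] h g by simp
  then show ?case
    using h g by (intro exI[of _ "h +++ g"]) (auto simp: path_image_join)
qed

lemma gpath_arc':
  assumes "plane_drawing V E p \<gamma>" "gpath E (x # A @ [y])"
  obtains g where "arc g" "pathstart g = p x" "pathfinish g = p y"
    "path_image g = (\<Union>e\<in>path_edges (x # A @ [y]). path_image (\<gamma> e))"
  using gpath_arc[OF assms(1), of x "hd (A @ [y])" "tl (A @ [y])"] assms(2) that
  by (cases A) auto

text \<open>A common edge would have both ends among the common vertices, hence be
  \<open>{x, y}\<close>; the first path has an inner vertex and so does not use this edge. Without
  common edges the drawings meet only in common vertices.\<close>

lemma internally_disjoint_Int:
  assumes d: "plane_drawing V E p \<gamma>"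
    and "gpath E (x # A @ [y])" "gpath E (x # B @ [y])" "set A \<inter> set B = {}" "A \<noteq> []"
  shows "(\<Union>e\<in>path_edges (x # A @ [y]). path_image (\<gamma> e)) \<inter>
         (\<Union>e\<in>path_edges (x # B @ [y]). path_image (\<gamma> e)) = {p x, p y}"
proof -
  let ?A = "path_edges (x # A @ [y])" and ?B = "path_edges (x # B @ [y])"
  have U: "\<Union>?A = set (x # A @ [y])" "\<Union>?B = set (x # B @ [y])" by (rule Union_path_edges, simp)+
  have sub: "?A \<subseteq> E" "?B \<subseteq> E"
    using assms(2,3) unfolding gpath_def by (auto dest!: path_edges_subset)
  have "{x, y} \<notin> ?A" using ends_notin_path_edges[of x A y] assms(2,5) by (simp add: gpath_def)
  \<comment> \<open>That an edge has two ends is read off the drawing: the end points of an arc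
    differ.\<close>
  moreover have two: "e \<noteq> {}" "\<not> e \<subseteq> {z}" if "e \<in> ?A" for e z
  proof -
    have "arc (\<gamma> e)" "{pathstart (\<gamma> e), pathfinish (\<gamma> e)} = p ` e"
      using d sub that unfolding plane_drawing_def by blast+
    then show "e \<noteq> {}" "\<not> e \<subseteq> {z}"
      using arc_distinct_ends[of "\<gamma> e"] by (auto simp: doubleton_eq_iff subset_singleton_iff)
  qed
  ultimately have "?A \<inter> ?B = {}"
  proof -
    have "e = {x, y}" if "e \<in> ?A" "e \<in> ?B" for e
    proof -
      have "e \<subseteq> set (x # A @ [y]) \<inter> set (x # B @ [y])" using that U by blast
      then have "e \<subseteq> {x, y}" using assms by (auto simp: gpath_def)
      then show ?thesis using two[OF that(1)] by blast
    qed
    then show ?thesis using \<open>{x, y} \<notin> ?A\<close> by blast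
  qed
  then have "(\<Union>e\<in>?A. path_image (\<gamma> e)) \<inter> (\<Union>e\<in>?B. path_image (\<gamma> e)) = p ` (\<Union>?A \<inter> \<Union>?B)"
    by (rule drawing_edges_Int[OF d sub])
  also have "\<Union>?A \<inter> \<Union>?B = {x, y}" unfolding U using assms by auto
  finally show ?thesis by simp
qed

text \<open>\<open>inside S\<close> is open, so as a neighbourhood of \<open>z\<close> it would meet
  \<open>outside D\<close>, which is contained in \<open>outside S\<close>.\<close>

lemma frontier_outside_notin_inside:
  fixes S D :: "complex set"
  assumes "z \<in> frontier (outside D)" "S \<subseteq> D" "closed S"
  shows "z \<notin> inside S"
proof
  assume "z \<in> inside S"
  then have "inside S \<inter> closure (outside D) \<noteq> {}" using assms by (auto simp: frontier_def)
  then have "inside S \<inter> outside D \<noteq> {}" using open_Int_closure_eq_empty[OF open_inside[OF assms(3)]] by blast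
  then show False using outside_mono[OF assms(2)] inside_Int_outside[of S] by blast
qed

text \<open>A connected set with more than one point has no isolated points, and deleting two points
  does not change limit points. This carries facts about an open arc over to its ends.\<close>

lemma arc_pathfinish_closure_interior:
  fixes g :: "real \<Rightarrow> complex"
  assumes "arc g"
  shows "{pathstart g, pathfinish g} \<subseteq> closure (path_image g - {pathstart g, pathfinish g})"
proof -
  have "z islimpt path_image g" if "z \<in> {pathstart g, pathfinish g}" for z
  proof (rule connected_imp_perfect)
    show "connected (path_image g)" using assms by (simp add: connected_arc_image)
    show "z \<in> path_image g" using that by auto
    show "\<not> path_image g = {x}" for x
      using arc_distinct_ends[OF assms] pathstart_in_path_image[of g] pathfinish_in_path_image[of g] by auto
  qed
  then have "z islimpt path_image g - {pathstart g, pathfinish g}" if "z \<in> {pathstart g, pathfinish g}" for z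
    using that islimpt_Un_finite[of "{pathstart g, pathfinish g}" z "path_image g - {pathstart g, pathfinish g}"]
    by (metis Un_Diff_cancel Un_upper1 finite.emptyI finite.insertI islimpt_subset sup_commute)
  then show ?thesis by (auto simp: closure_def)
qed

section \<open>Drawings with all vertices on the outer face\<close>

locale outerplanar_drawing =
  fixes V :: "'a set" and E :: "'a set set" and p :: "'a \<Rightarrow> complex" and \<gamma> :: "'a set \<Rightarrow> real \<Rightarrow> complex"
  assumes drawing: "plane_drawing V E p \<gamma>"
    and outer: "p ` V \<subseteq> frontier (outside (drawing_image V E p \<gamma>))"
    and Union_E: "\<Union>E \<subseteq> V"
begin

definition trace :: "'a list \<Rightarrow> complex set" where
  "trace xs = (\<Union>e\<in>path_edges xs. path_image (\<gamma> e))"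

lemma trace_subset: "gpath E xs \<Longrightarrow> trace xs \<subseteq> drawing_image V E p \<gamma>"
  using path_edges_subset[of E xs] unfolding gpath_def trace_def drawing_image_def by blast

lemma set_subset: "gpath E xs \<Longrightarrow> 2 \<le> length xs \<Longrightarrow> set xs \<subseteq> V"
  using Union_path_edges[of xs] path_edges_subset[of E xs] Union_E unfolding gpath_def by blast

lemma vertex_in_trace_iff:
  assumes "gpath E xs" "2 \<le> length xs" "v \<in> V"
  shows "p v \<in> trace xs \<longleftrightarrow> v \<in> set xs"
proof -
  have sub: "path_edges xs \<subseteq> E" using assms path_edges_subset unfolding gpath_def by blast
  have "p v \<in> path_image (\<gamma> e) \<longleftrightarrow> v \<in> e" if "e \<in> path_edges xs" for e
  proof -
    have eV: "e \<subseteq> V" using that sub Union_E by blast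
    have "path_image (\<gamma> e) \<inter> p ` V = p ` e"
      using drawing that sub unfolding plane_drawing_def by (meson subsetD)
    then have "p v \<in> path_image (\<gamma> e) \<longleftrightarrow> p v \<in> p ` e" using assms(3) by blast
    also have "\<dots> \<longleftrightarrow> v \<in> e"
      using drawing assms(3) eV by (intro inj_on_image_mem_iff) (auto simp: plane_drawing_def)
    finally show ?thesis .
  qed
  then show ?thesis using Union_path_edges[OF assms(2)] unfolding trace_def by auto
qed

lemma vertex_notin_inside:
  "v \<in> V \<Longrightarrow> S \<subseteq> drawing_image V E p \<gamma> \<Longrightarrow> closed S \<Longrightarrow> p v \<notin> inside S"
  using outer by (intro frontier_outside_notin_inside) auto

lemma trace_arc:
  assumes "gpath E (x # A @ [y])"
  obtains g where "arc g" "pathstart g = p x" "pathfinish g = p y" "path_image g = trace (x # A @ [y])"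
  using gpath_arc'[OF drawing assms] unfolding trace_def by blast

lemma closed_trace: "gpath E (x # A @ [y]) \<Longrightarrow> closed (trace (x # A @ [y]))"
  by (metis trace_arc arc_imp_path closed_path_image)

text \<open>An inner vertex of the path lies on the outer face, so it is not enclosed by any part of
  the drawing.\<close>

lemma trace_not_inside:
  assumes "gpath E (x # A @ [y])" "A \<noteq> []" "S \<subseteq> drawing_image V E p \<gamma>" "closed S"
  shows "\<not> trace (x # A @ [y]) - {p x, p y} \<subseteq> inside S"
proof -
  obtain z where z: "z \<in> set A" using assms by (cases A) auto
  have V: "x \<in> V" "y \<in> V" "z \<in> V" using set_subset[OF assms(1)] z by auto
  have "z \<noteq> x" "z \<noteq> y" using assms(1) z by (auto simp: gpath_def)
  then have "p z \<noteq> p x" "p z \<noteq> p y"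
    using V drawing unfolding plane_drawing_def by (auto dest: inj_onD)
  moreover have "p z \<in> trace (x # A @ [y])"
    using vertex_in_trace_iff[OF assms(1)] z V by auto
  ultimately show ?thesis using vertex_notin_inside[OF V(3) assms(3,4)] by blast
qed

text \<open>One of three such arcs lies inside the other two. A path with an inner vertex cannot be
  that one, so it is \<open>C\<close>, and \<open>C\<close> is a single edge. The first conclusion
  excludes thetas; the second places a chord inside its cycle.\<close>

lemma trace_inside:
  assumes gp: "gpath E (x # A @ [y])" "gpath E (x # B @ [y])" "gpath E (x # C @ [y])"
    and ne: "A \<noteq> []" "B \<noteq> []"
    and dis: "set A \<inter> set B = {}" "set A \<inter> set C = {}" "set B \<inter> set C = {}"
  shows "C = []"
    and "trace (x # C @ [y]) - {p x, p y} \<subseteq> inside (trace (x # A @ [y]) \<union> trace (x # B @ [y]))"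
proof -
  let ?A = "trace (x # A @ [y])" and ?B = "trace (x # B @ [y])" and ?C = "trace (x # C @ [y])"
  obtain a where a: "arc a" "pathstart a = p x" "pathfinish a = p y" "path_image a = ?A"
    using trace_arc[OF gp(1)] .
  obtain b where b: "arc b" "pathstart b = p x" "pathfinish b = p y" "path_image b = ?B"
    using trace_arc[OF gp(2)] .
  obtain c where c: "arc c" "pathstart c = p x" "pathfinish c = p y" "path_image c = ?C"
    using trace_arc[OF gp(3)] .
  have i: "?A \<inter> ?B = {p x, p y}" "?A \<inter> ?C = {p x, p y}" "?B \<inter> ?C = {p x, p y}"
    unfolding trace_def
    using internally_disjoint_Int[OF drawing gp(1,2) dis(1) ne(1)]
      internally_disjoint_Int[OF drawing gp(1,3) dis(2) ne(1)]
      internally_disjoint_Int[OF drawing gp(2,3) dis(3) ne(2)] by auto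
  have s: "?A \<union> ?B \<subseteq> drawing_image V E p \<gamma>" "?A \<union> ?C \<subseteq> drawing_image V E p \<gamma>"
    "?B \<union> ?C \<subseteq> drawing_image V E p \<gamma>"
    using trace_subset gp by blast+
  have cl: "closed (?A \<union> ?B)" "closed (?A \<union> ?C)" "closed (?B \<union> ?C)"
    using closed_trace gp by blast+
  show *: "?C - {p x, p y} \<subseteq> inside (?A \<union> ?B)"
    using theta_inside[OF a(1-3) b(1-3) c(1-3)] i
      trace_not_inside[OF gp(1) ne(1) s(3) cl(3)] trace_not_inside[OF gp(2) ne(2) s(2) cl(2)]
    unfolding a(4) b(4) c(4) by argo
  show "C = []"
    using trace_not_inside[OF gp(3) _ s(1) cl(1)] * by blast
qed

text \<open>Both chords lie inside the cycle. The chord from \<open>a\<close> to \<open>c\<close>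
  cuts the inside into two regions, and the open chord from \<open>b\<close> to \<open>d\<close> is
  connected, hence in one of them. Then \<open>p b\<close> and \<open>p d\<close> are in the closure
  of this region; but one of them is off its boundary and, being on the outer face, not inside it
  either.\<close>

lemma no_crossing_chords:
  assumes cyc: "distinct (a # A @ b # B @ c # C @ d # D)"
      "successively (\<lambda>x y. {x, y} \<in> E) (a # A @ b # B @ c # C @ d # D @ [a])"
    and ch: "{a, c} \<in> E" "{b, d} \<in> E"
  shows False
proof -
  let ?P = "\<lambda>x y. {x, y} \<in> E"
  have sc: "successively ?P (a # A @ b # B @ [c])" "successively ?P (b # B @ c # C @ [d])"
    "successively ?P (c # C @ d # D @ [a])"
    using successively_appendD(1)[of ?P "a # A @ b # B @ [c]" "C @ d # D @ [a]"]
      successively_appendD[of ?P "a # A" "b # B @ c # C @ d # D @ [a]"]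
      successively_appendD(1)[of ?P "b # B @ c # C @ [d]" "D @ [a]"]
      successively_appendD(2)[of ?P "a # A @ b # B" "c # C @ d # D @ [a]"] cyc(2) by simp_all
  have "successively ?P (a # A @ [b])" "successively ?P (d # D @ [a])"
    using successively_appendD(1)[of ?P "a # A @ [b]" "B @ [c]"]
      successively_appendD(2)[of ?P "c # C" "d # D @ [a]"] sc by simp_all
  then have "successively ?P (d # D @ a # A @ [b])"
    using successively_join[of ?P "d # D" a "A @ [b]"] by simp
  then have gp: "gpath E (a # (A @ b # B) @ [c])" "gpath E (c # (C @ d # D) @ [a])"
    "gpath E (b # (B @ c # C) @ [d])" "gpath E (d # (D @ a # A) @ [b])"
    "gpath E (a # [] @ [c])" "gpath E (b # [] @ [d])"
    using sc cyc(1) ch unfolding gpath_def by auto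
  define T1 where "T1 = trace (a # (A @ b # B) @ [c])"
  define T2 where "T2 = trace (a # (rev D @ d # rev C) @ [c])"
  define G where "G = trace (a # [] @ [c])"
  define G' where "G' = trace (b # [] @ [d]) - {p b, p d}"
  have gp': "gpath E (a # (rev D @ d # rev C) @ [c])" "gpath E (b # (rev A @ a # rev D) @ [d])"
    using gp(2,4) gpath_rev[of E "c # (C @ d # D) @ [a]"] gpath_rev[of E "d # (D @ a # A) @ [b]"] by simp_all
  have T2: "T2 = trace (c # (C @ d # D) @ [a])"
    using path_edges_rev[of "c # (C @ d # D) @ [a]"] unfolding T2_def trace_def by simp
  \<comment> \<open>The cycle cut at \<open>b\<close> and \<open>d\<close> consists of the same
    edges as the cycle cut at \<open>a\<close> and \<open>c\<close>, so both chords lie inside the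
    same curve.\<close>
  have "path_edges (b # (B @ c # C) @ [d]) \<union> path_edges (d # (D @ a # A) @ [b]) =
      path_edges (a # (A @ b # B) @ [c]) \<union> path_edges (c # (C @ d # D) @ [a])"
    using path_edges_append[of "b # B" c "C @ [d]"] path_edges_append[of "d # D" a "A @ [b]"]
      path_edges_append[of "a # A" b "B @ [c]"] path_edges_append[of "c # C" d "D @ [a]"] by auto
  then have T: "trace (b # (B @ c # C) @ [d]) \<union> trace (b # (rev A @ a # rev D) @ [d]) = T1 \<union> T2"
    using path_edges_rev[of "d # (D @ a # A) @ [b]"] unfolding T1_def T2 trace_def by (simp flip: UN_Un)
  have G: "G - {p a, p c} \<subseteq> inside (T1 \<union> T2)" unfolding G_def T1_def T2_def
    by (rule trace_inside(2)[OF gp(1) gp'(1) gp(5)]) (use cyc(1) in auto)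
  have G': "G' \<subseteq> inside (T1 \<union> T2)" unfolding G'_def T[symmetric]
    by (rule trace_inside(2)[OF gp(3) gp'(2) gp(6)]) (use cyc(1) in auto)
  obtain t1 where t1: "arc t1" "pathstart t1 = p a" "pathfinish t1 = p c" "path_image t1 = T1"
    using trace_arc[OF gp(1)] unfolding T1_def .
  obtain t2 where t2: "arc t2" "pathstart t2 = p a" "pathfinish t2 = p c" "path_image t2 = T2"
    using trace_arc[OF gp'(1)] unfolding T2_def .
  obtain g where g: "arc g" "pathstart g = p a" "pathfinish g = p c" "path_image g = G"
    using trace_arc[OF gp(5)] unfolding G_def .
  obtain g' where g': "arc g'" "pathstart g' = p b" "pathfinish g' = p d"
      "path_image g' = trace (b # [] @ [d])"
    using trace_arc[OF gp(6)] .
  have i: "T1 \<inter> T2 = {p a, p c}" "T1 \<inter> G = {p a, p c}" "T2 \<inter> G = {p a, p c}"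
    unfolding T1_def T2_def G_def trace_def
    by (rule internally_disjoint_Int[OF drawing gp(1) gp'(1)]
        internally_disjoint_Int[OF drawing gp(1,5)] internally_disjoint_Int[OF drawing gp'(1) gp(5)];
        use cyc(1) in auto)+
  have ac: "p a \<noteq> p c" using arc_distinct_ends[OF g(1)] g by simp
  have "G - {p a, p c} \<noteq> {}" using arc_interior_nonempty[OF g(1)] g by simp
  then have "G \<inter> inside (T1 \<union> T2) \<noteq> {}" using G by blast
  then have split: "inside (T1 \<union> G) \<inter> inside (T2 \<union> G) = {}"
    "inside (T1 \<union> G) \<union> inside (T2 \<union> G) \<union> (G - {p a, p c}) = inside (T1 \<union> T2)"
    using split_inside_simple_closed_curve[OF arc_imp_simple_path[OF t1(1)] t1(2,3)
        arc_imp_simple_path[OF t2(1)] t2(2,3) arc_imp_simple_path[OF g(1)] g(2,3) ac]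
      i unfolding t1(4) t2(4) g(4) by blast+
  have "G \<inter> trace (b # [] @ [d]) = p ` ({a, c} \<inter> {b, d})"
    using drawing_edges_Int[OF drawing, of "{{a, c}}" "{{b, d}}"] ch cyc(1)
    unfolding G_def trace_def by (auto simp: doubleton_eq_iff)
  then have "G' \<inter> G = {}" using cyc(1) unfolding G'_def by auto
  then have sub: "G' \<subseteq> inside (T1 \<union> G) \<union> inside (T2 \<union> G)" using G' split(2) by blast
  have cl: "closed (T1 \<union> G)" "closed (T2 \<union> G)"
    using closed_trace[OF gp(1)] closed_trace[OF gp'(1)] closed_trace[OF gp(5)]
    unfolding T1_def T2_def G_def by auto
  have "connected G'" using arc_interior_connected[OF g'(1)] unfolding g' G'_def .
  then consider "G' \<subseteq> inside (T1 \<union> G)" | "G' \<subseteq> inside (T2 \<union> G)"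
    using connectedD[of G' "inside (T1 \<union> G)" "inside (T2 \<union> G)"] sub split(1)
      open_inside[OF cl(1)] open_inside[OF cl(2)] by blast
  moreover have clo: "p b \<in> closure G'" "p d \<in> closure G'"
    using arc_pathfinish_closure_interior[OF g'(1)] unfolding g' G'_def by auto
  have V: "b \<in> V" "d \<in> V" using set_subset[OF gp(6)] by auto
  have sD: "T1 \<union> G \<subseteq> drawing_image V E p \<gamma>" "T2 \<union> G \<subseteq> drawing_image V E p \<gamma>"
    using trace_subset[OF gp(1)] trace_subset[OF gp'(1)] trace_subset[OF gp(5)]
    unfolding T1_def T2_def G_def by auto
  have "p d \<notin> T1 \<union> G" "p b \<notin> T2 \<union> G"
    using vertex_in_trace_iff[OF gp(1)] vertex_in_trace_iff[OF gp'(1)] vertex_in_trace_iff[OF gp(5)] V cyc(1)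
    unfolding T1_def T2_def G_def by auto
  then have "p d \<notin> closure (inside (T1 \<union> G))" "p b \<notin> closure (inside (T2 \<union> G))"
    using closure_inside_subset[OF cl(1)] closure_inside_subset[OF cl(2)]
      vertex_notin_inside[OF V(2) sD(1) cl(1)] vertex_notin_inside[OF V(1) sD(2) cl(2)] by blast+
  ultimately show False
  proof cases
    case 1
    then show False using closure_mono[OF 1] clo(2) \<open>p d \<notin> closure (inside (T1 \<union> G))\<close> by auto
  next
    case 2
    then show False using closure_mono[OF 2] clo(1) \<open>p b \<notin> closure (inside (T2 \<union> G))\<close> by auto
  qed
qed

end

section \<open>Colourings of intervals\<close>

text \<open>A star lists the colours of the three edges at a vertex of a cycle: the cycle edge towards the
  previous vertex, the edge leaving the cycle edges, and the cycle edge towards the next vertex.\<close>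

type_synonym star = "nat \<times> nat \<times> nat"

text \<open>Only the colour \<open>0\<close> may occur twice, since it stands for a matching that need not be induced.\<close>

fun compat :: "star \<Rightarrow> star \<Rightarrow> bool" where
  "compat (a, b, c) (c', d, e) \<longleftrightarrow> c = c' \<and> a \<noteq> b \<and> a \<noteq> c \<and> b \<noteq> c \<and> d \<noteq> e \<and> d \<noteq> c \<and> e \<noteq> c \<and>
    (a = d \<longrightarrow> a = 0) \<and> (a = e \<longrightarrow> a = 0) \<and> (b = d \<longrightarrow> b = 0) \<and> (b = e \<longrightarrow> b = 0)"

text \<open>Permuting the two stars moves the chord to the place of the shared cycle edge, so that
  \<open>compat\<close> can be reused.\<close>

fun chord_compat :: "star \<Rightarrow> star \<Rightarrow> bool" where
  "chord_compat (a, t, b) (c, t', d) \<longleftrightarrow> compat (a, b, t) (t', c, d)"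

fun allowed :: "nat set \<Rightarrow> nat \<Rightarrow> star \<Rightarrow> bool" where
  "allowed A i (a, t, b) \<longleftrightarrow> a \<le> 4 \<and> b \<le> 4 \<and> (t \<le> 4 \<or> t = 5 \<and> i \<in> A)"

text \<open>\<open>M i j\<close> means that there is a chord between the positions \<open>i < j\<close>, and \<open>A\<close> contains the positions
  whose chord may get the colour \<open>5\<close>.\<close>

definition fill :: "nat set \<Rightarrow> (nat \<Rightarrow> nat \<Rightarrow> bool) \<Rightarrow> nat \<Rightarrow> nat \<Rightarrow> star \<Rightarrow> star \<Rightarrow> bool" where
  "fill A M lo hi s s' \<longleftrightarrow> (\<exists>\<sigma>. \<sigma> lo = s \<and> \<sigma> hi = s' \<and>
     (\<forall>i. lo \<le> i \<and> i < hi \<longrightarrow> compat (\<sigma> i) (\<sigma> (Suc i))) \<and>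
     (\<forall>i j. M i j \<and> lo \<le> i \<and> j \<le> hi \<longrightarrow> chord_compat (\<sigma> i) (\<sigma> j)) \<and>
     (\<forall>i. lo < i \<and> i < hi \<longrightarrow> allowed A i (\<sigma> i)))"

text \<open>The order is that along the cycle around a chord: the edge before its left end, the
  first and the last edge under it, the edge after its right end.\<close>

definition distinct4 :: "nat \<Rightarrow> nat \<Rightarrow> nat \<Rightarrow> nat \<Rightarrow> bool" where
  "distinct4 p e f q \<longleftrightarrow> distinct [p, e, f, q] \<and> set [p, e, f, q] \<subseteq> {1..4}"

lemma distinct4D:
  assumes "distinct4 p e f q"
  shows "p \<noteq> e" "p \<noteq> f" "p \<noteq> q" "e \<noteq> f" "e \<noteq> q" "f \<noteq> q"
    "p \<noteq> 0" "e \<noteq> 0" "f \<noteq> 0" "q \<noteq> 0" "p \<noteq> 5" "e \<noteq> 5" "f \<noteq> 5" "q \<noteq> 5"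
    "p \<le> 4" "e \<le> 4" "f \<le> 4" "q \<le> 4"
  using assms by (auto simp: distinct4_def)

lemma allowed_mono: "allowed A i s \<Longrightarrow> A \<subseteq> B \<Longrightarrow> allowed B i s"
  by (cases s) auto

lemma fill_allowed_mono: "fill A M lo hi s s' \<Longrightarrow> A \<subseteq> B \<Longrightarrow> fill B M lo hi s s'"
  unfolding fill_def using allowed_mono by blast

section \<open>Intervals closed under a noncrossing matching\<close>

locale noncrossing_matching =
  fixes M :: "nat \<Rightarrow> nat \<Rightarrow> bool"
  assumes gap: "M i j \<Longrightarrow> Suc i < j"
    and unique: "M i j \<Longrightarrow> M k l \<Longrightarrow> {i, j} \<inter> {k, l} \<noteq> {} \<Longrightarrow> i = k \<and> j = l"
    and noncrossing: "M i j \<Longrightarrow> M k l \<Longrightarrow> i < k \<Longrightarrow> k < j \<Longrightarrow> l < j"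
begin

text \<open>The two ends are exempt: they may be joined to each other or to positions outside the
  interval, but not to positions inside.\<close>

definition closed_between :: "nat \<Rightarrow> nat \<Rightarrow> bool" where
  "closed_between lo hi \<longleftrightarrow> (\<forall>i j. M i j \<longrightarrow> (lo < i \<and> i < hi) \<or> (lo < j \<and> j < hi) \<longrightarrow> lo < i \<and> j < hi)"

lemma closed_betweenD:
  "closed_between lo hi \<Longrightarrow> M i j \<Longrightarrow> (lo < i \<and> i < hi) \<or> (lo < j \<and> j < hi) \<Longrightarrow> lo < i \<and> j < hi"
  unfolding closed_between_def by blast

text \<open>Packs uniqueness and both instances of noncrossing into inequalities, so that later case
  distinctions on chords are linear arithmetic.\<close>

lemma two_chords:
  assumes "M i j" "M k l"
  shows "i = k \<and> j = l \<or> j < k \<or> l < i \<or> (i < k \<and> l < j) \<or> (k < i \<and> j < l)"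
proof (cases "{i, j} \<inter> {k, l} = {}")
  case True
  then have "i \<noteq> k" "i \<noteq> l" "j \<noteq> k" "j \<noteq> l" by auto
  moreover have "i < k \<and> k < j \<longrightarrow> l < j" "k < i \<and> i < l \<longrightarrow> j < l"
    using noncrossing[OF assms] noncrossing[OF assms(2,1)] by blast+
  ultimately show ?thesis using gap[OF assms(1)] gap[OF assms(2)] by linarith
qed (use unique[OF assms] in blast)

lemma closed_chord:
  assumes "M i j" shows "closed_between i j"
proof -
  have "i < k \<and> l < j" if "M k l" "(i < k \<and> k < j) \<or> (i < l \<and> l < j)" for k l
    using two_chords[OF that(1) assms] gap[OF that(1)] that(2) by linarith
  then show ?thesis unfolding closed_between_def by blast
qed

definition unmatched :: "nat \<Rightarrow> bool" where
  "unmatched i \<longleftrightarrow> (\<forall>j. \<not> M i j \<and> \<not> M j i)"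

text \<open>The exception for \<open>i = lo\<close> and \<open>j = hi\<close> allows cutting below a
  chord that spans the whole interval.\<close>

definition splits_at :: "nat \<Rightarrow> nat \<Rightarrow> nat \<Rightarrow> bool" where
  "splits_at lo m hi \<longleftrightarrow> lo < m \<and> m < hi \<and>
     (\<forall>i j. M i j \<longrightarrow> lo \<le> i \<longrightarrow> j \<le> hi \<longrightarrow> j \<le> m \<or> m \<le> i \<or> (i = lo \<and> j = hi))"

text \<open>Only a chord from \<open>lo\<close> to \<open>hi\<close> can bridge the cut at
  \<open>m\<close>, and its condition depends on the end stars alone.\<close>

lemma fill_trans:
  assumes 1: "fill A M lo m s0 s" and 2: "fill A M m hi s s1" and al: "allowed A m s"
    and sp: "splits_at lo m hi" and ch: "M lo hi \<Longrightarrow> chord_compat s0 s1"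
  shows "fill A M lo hi s0 s1"
proof -
  obtain \<sigma> where \<sigma>: "\<sigma> lo = s0" "\<sigma> m = s" "\<And>i. lo \<le> i \<Longrightarrow> i < m \<Longrightarrow> compat (\<sigma> i) (\<sigma> (Suc i))"
    "\<And>i j. M i j \<Longrightarrow> lo \<le> i \<Longrightarrow> j \<le> m \<Longrightarrow> chord_compat (\<sigma> i) (\<sigma> j)"
    "\<And>i. lo < i \<Longrightarrow> i < m \<Longrightarrow> allowed A i (\<sigma> i)"
    using 1 unfolding fill_def by blast
  obtain \<tau> where \<tau>: "\<tau> m = s" "\<tau> hi = s1" "\<And>i. m \<le> i \<Longrightarrow> i < hi \<Longrightarrow> compat (\<tau> i) (\<tau> (Suc i))"
    "\<And>i j. M i j \<Longrightarrow> m \<le> i \<Longrightarrow> j \<le> hi \<Longrightarrow> chord_compat (\<tau> i) (\<tau> j)"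
    "\<And>i. m < i \<Longrightarrow> i < hi \<Longrightarrow> allowed A i (\<tau> i)"
    using 2 unfolding fill_def by blast
  define \<rho> where "\<rho> i = (if i \<le> m then \<sigma> i else \<tau> i)" for i
  have m: "lo < m" "m < hi" using sp by (auto simp: splits_at_def)
  have \<rho>\<tau>: "\<rho> i = \<tau> i" if "m \<le> i" for i using that \<sigma>(2) \<tau>(1) by (cases "i = m") (auto simp: \<rho>_def)
  have "compat (\<rho> i) (\<rho> (Suc i))" if "lo \<le> i" "i < hi" for i
    using that \<sigma>(3)[of i] \<tau>(3)[of i] \<rho>\<tau>[of i] \<rho>\<tau>[of "Suc i"]
    by (cases "i < m") (auto simp: \<rho>_def)
  moreover have "chord_compat (\<rho> i) (\<rho> j)" if M: "M i j" "lo \<le> i" "j \<le> hi" for i j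
  proof -
    consider "j \<le> m" | "m \<le> i" | "i = lo" "j = hi" using sp M unfolding splits_at_def by blast
    then show ?thesis
    proof cases
      case 1
      then show ?thesis using \<sigma>(4)[OF M(1,2)] gap[OF M(1)] by (auto simp: \<rho>_def)
    next
      case 2
      then show ?thesis using \<tau>(4)[OF M(1) _ M(3)] gap[OF M(1)] \<rho>\<tau> by auto
    next
      case 3
      then show ?thesis using ch M m \<sigma>(1) \<tau>(2) by (auto simp: \<rho>_def)
    qed
  qed
  moreover have "allowed A i (\<rho> i)" if "lo < i" "i < hi" for i
    using that \<sigma>(5)[of i] \<tau>(5)[of i] \<rho>\<tau>[of i] al \<sigma>(2)
    by (cases i m rule: linorder_cases) (auto simp: \<rho>_def)
  moreover have "\<rho> lo = s0" "\<rho> hi = s1" using m \<sigma>(1) \<tau>(2) by (auto simp: \<rho>_def)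
  ultimately show ?thesis unfolding fill_def by blast
qed

lemma fill_single: "compat s s' \<Longrightarrow> fill A M i (Suc i) s s'"
proof -
  assume s: "compat s s'"
  have no: "\<not> (M k l \<and> i \<le> k \<and> l \<le> Suc i)" for k l using gap[of k l] by auto
  show ?thesis
    unfolding fill_def
  proof (intro exI[of _ "\<lambda>j. if j = i then s else s'"] conjI)
    show "\<forall>k l. M k l \<and> i \<le> k \<and> l \<le> Suc i \<longrightarrow>
        chord_compat (if k = i then s else s') (if l = i then s else s')"
      using no by blast
  qed (use s in \<open>auto simp: less_Suc_eq\<close>)
qed

text \<open>The neighbour of \<open>lo\<close> already avoids \<open>p\<close>, may repeat
  \<open>0\<close>, and never sees \<open>5\<close> because the given filling has no exceptional
  positions. So any two different colours among \<open>p\<close>, \<open>0\<close>, \<open>5\<close>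
  may be put on the two edges at \<open>lo\<close> other than the one of colour \<open>e\<close>,
  and likewise at \<open>hi\<close>. This produces every end star that is not of the form needed in
  the recursion.\<close>

lemma fill_relax:
  assumes "fill {} M lo hi (p, 0, e) (f, 0, q)" "lo + 2 \<le> hi" "closed_between lo hi"
    and "e \<noteq> 0" "f \<noteq> 0" "e \<le> 4" "f \<le> 4"
    and "{a, b} \<subseteq> {p, 0, 5}" "a \<noteq> b" "{c, d} \<subseteq> {q, 0, 5}" "c \<noteq> d"
    and ch: "M lo hi \<Longrightarrow> chord_compat (a, b, e) (f, c, d)"
  shows "fill A M lo hi (a, b, e) (f, c, d)"
proof -
  obtain \<sigma> where \<sigma>: "\<sigma> lo = (p, 0, e)" "\<sigma> hi = (f, 0, q)"
    "\<And>i. lo \<le> i \<Longrightarrow> i < hi \<Longrightarrow> compat (\<sigma> i) (\<sigma> (Suc i))"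
    "\<And>i j. M i j \<Longrightarrow> lo \<le> i \<Longrightarrow> j \<le> hi \<Longrightarrow> chord_compat (\<sigma> i) (\<sigma> j)"
    "\<And>i. lo < i \<Longrightarrow> i < hi \<Longrightarrow> allowed {} i (\<sigma> i)"
    using assms(1) unfolding fill_def by blast
  define \<rho> where "\<rho> = \<sigma>(lo := (a, b, e), hi := (f, c, d))"
  have ends: "\<rho> lo = (a, b, e)" "\<rho> hi = (f, c, d)" using assms(2) by (auto simp: \<rho>_def)
  have L: "compat (\<rho> lo) (\<rho> (Suc lo))"
  proof -
    have "allowed {} (Suc lo) (\<sigma> (Suc lo))" "compat (p, 0, e) (\<sigma> (Suc lo))" "\<rho> (Suc lo) = \<sigma> (Suc lo)"
      using \<sigma>(1) \<sigma>(3)[of lo] \<sigma>(5)[of "Suc lo"] assms(2) by (auto simp: \<rho>_def)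
    moreover have "compat (a, b, e) t" if "allowed {} k t" "compat (p, 0, e) t" for k t
      using that assms(4,6,8,9) by (cases t) auto
    ultimately show ?thesis unfolding ends by metis
  qed
  obtain h where h: "hi = Suc h" "lo < h" using assms(2) by (cases hi) auto
  have R: "compat (\<rho> h) (\<rho> hi)"
  proof -
    have "allowed {} h (\<sigma> h)" "compat (\<sigma> h) (f, 0, q)" "\<rho> h = \<sigma> h"
      using \<sigma>(2) \<sigma>(3)[of h] \<sigma>(5)[of h] h by (auto simp: \<rho>_def)
    moreover have "compat t (f, c, d)" if "allowed {} k t" "compat t (f, 0, q)" for k t
      using that assms(5,7,10,11) by (cases t) auto
    ultimately show ?thesis unfolding ends by metis
  qed
  have "compat (\<rho> i) (\<rho> (Suc i))" if "lo \<le> i" "i < hi" for i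
  proof (cases "i = lo \<or> i = h")
    case False
    then have "\<rho> i = \<sigma> i" "\<rho> (Suc i) = \<sigma> (Suc i)" using that h by (auto simp: \<rho>_def)
    then show ?thesis using \<sigma>(3) that by simp
  qed (use L R h in auto)
  moreover have "chord_compat (\<rho> i) (\<rho> j)" if M: "M i j" "lo \<le> i" "j \<le> hi" for i j
  proof (cases "i = lo \<and> j = hi")
    case True
    then show ?thesis using ch ends M by simp
  next
    case False
    then have "lo < i \<and> j < hi" using assms(3) M gap[OF M(1)] unfolding closed_between_def
      by (metis Suc_lessD le_neq_implies_less less_trans)
    moreover have "i \<noteq> hi" "j \<noteq> lo" using gap[OF M(1)] calculation by auto
    ultimately have "\<rho> i = \<sigma> i" "\<rho> j = \<sigma> j" by (auto simp: \<rho>_def)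
    then show ?thesis using \<sigma>(4) M by simp
  qed
  moreover have "allowed A i (\<rho> i)" if "lo < i" "i < hi" for i
    using \<sigma>(5)[of i] that by (cases "\<sigma> i") (auto simp: \<rho>_def)
  ultimately show ?thesis unfolding fill_def using ends by blast
qed

text \<open>A token is a vertex without chord, or a chord with all that lies under it.
  \<open>Suc lo\<close> cannot be the right end of a chord, since the partner would have to lie
  strictly above \<open>lo\<close>. Each case hands on closedness of the rest and the cuts for
  \<open>fill_trans\<close>.\<close>

lemma left_token:
  assumes "closed_between lo hi" "lo + 2 \<le> hi"
  obtains (vertex) "closed_between (Suc lo) hi" "splits_at lo (Suc lo) hi" "unmatched (Suc lo)"
  | (chord) m where "M (Suc lo) m" "closed_between m hi" "splits_at lo m hi" "splits_at lo (Suc lo) m"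
proof (cases "unmatched (Suc lo)")
  case True
  then have un: "i \<noteq> Suc lo" "j \<noteq> Suc lo" if "M i j" for i j
    using that unfolding unmatched_def by blast+
  have "closed_between (Suc lo) hi"
    unfolding closed_between_def using closed_betweenD[OF assms(1)] un by (metis Suc_lessD Suc_lessI)
  moreover have "j \<le> Suc lo \<or> Suc lo \<le> i \<or> (i = lo \<and> j = hi)" if "M i j" "lo \<le> i" "j \<le> hi" for i j
    using closed_betweenD[OF assms(1) that(1)] gap[OF that(1)] that by linarith
  ultimately show thesis using vertex True assms(2) unfolding splits_at_def by simp
next
  case False
  then obtain k where k: "M (Suc lo) k \<or> M k (Suc lo)" unfolding unmatched_def by blast
  have "\<not> M k (Suc lo)" using closed_betweenD[OF assms(1), of k "Suc lo"] gap[of k "Suc lo"] assms(2) by auto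
  then have m: "M (Suc lo) k" using k by blast
  have kh: "k < hi" using closed_betweenD[OF assms(1) m] assms(2) by auto
  have "j \<le> k \<or> k \<le> i \<or> (i = lo \<and> j = hi)" if "M i j" "lo \<le> i" "j \<le> hi" for i j
    using closed_betweenD[OF assms(1) that(1)] two_chords[OF that(1) m] gap[OF that(1)] that by linarith
  then have s: "splits_at lo k hi" using kh gap[OF m] unfolding splits_at_def by simp
  have "k < i \<and> j < hi" if "M i j" "(k < i \<and> i < hi) \<or> (k < j \<and> j < hi)" for i j
    using closed_betweenD[OF assms(1) that(1)] two_chords[OF that(1) m] gap[OF that(1)] gap[OF m] that(2)
    by linarith
  then have "closed_between k hi" unfolding closed_between_def by blast
  moreover have "j \<le> Suc lo \<or> Suc lo \<le> i" if "M i j" "lo \<le> i" "j \<le> k" for i j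
    using closed_betweenD[OF assms(1) that(1)] two_chords[OF that(1) m] gap[OF that(1)] kh that by linarith
  then have "splits_at lo (Suc lo) k" using gap[OF m] unfolding splits_at_def by auto
  ultimately show thesis using chord m s by blast
qed

text \<open>Mirror image of \<open>left_token\<close>; the upper end is written \<open>Suc h\<close>
  so that the last inner position has a name.\<close>

lemma right_token:
  assumes "closed_between lo (Suc h)" "lo < h"
  obtains (vertex) "closed_between lo h" "splits_at lo h (Suc h)" "unmatched h"
  | (chord) m where "M m h" "closed_between lo m" "splits_at lo m (Suc h)" "splits_at m h (Suc h)"
proof (cases "unmatched h")
  case True
  then have un: "i \<noteq> h" "j \<noteq> h" if "M i j" for i j
    using that unfolding unmatched_def by blast+
  have "lo < i \<and> j < h" if "M i j" "(lo < i \<and> i < h) \<or> (lo < j \<and> j < h)" for i j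
    using closed_betweenD[OF assms(1) that(1)] un[OF that(1)] that by linarith
  then have "closed_between lo h" unfolding closed_between_def by blast
  moreover have "j \<le> h \<or> h \<le> i \<or> (i = lo \<and> j = Suc h)" if "M i j" "lo \<le> i" "j \<le> Suc h" for i j
    using closed_betweenD[OF assms(1) that(1)] gap[OF that(1)] that by linarith
  ultimately show thesis using vertex True assms(2) unfolding splits_at_def by simp
next
  case False
  then obtain k where k: "M h k \<or> M k h" unfolding unmatched_def by blast
  have "\<not> M h k" using closed_betweenD[OF assms(1), of h k] gap[of h k] assms(2) by auto
  then have m: "M k h" using k by blast
  have kh: "lo < k" using closed_betweenD[OF assms(1) m] assms(2) by auto
  have "j \<le> k \<or> k \<le> i \<or> (i = lo \<and> j = Suc h)" if "M i j" "lo \<le> i" "j \<le> Suc h" for i j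
    using closed_betweenD[OF assms(1) that(1)] two_chords[OF that(1) m] gap[OF that(1)] that by linarith
  then have s: "splits_at lo k (Suc h)" using kh gap[OF m] unfolding splits_at_def by simp
  have "lo < i \<and> j < k" if "M i j" "(lo < i \<and> i < k) \<or> (lo < j \<and> j < k)" for i j
    using closed_betweenD[OF assms(1) that(1)] two_chords[OF that(1) m] gap[OF that(1)] gap[OF m] that(2)
    by linarith
  then have "closed_between lo k" unfolding closed_between_def by blast
  moreover have "j \<le> h \<or> h \<le> i" if "M i j" "k \<le> i" "j \<le> Suc h" for i j
    using closed_betweenD[OF assms(1) that(1)] two_chords[OF that(1) m] gap[OF that(1)] kh that by linarith
  then have "splits_at k h (Suc h)" using gap[OF m] unfolding splits_at_def by auto
  ultimately show thesis using chord m s by blast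
qed

lemma fill_left_chord:
  assumes m: "M (Suc lo) m" and sp: "splits_at lo (Suc lo) m" and nl: "\<not> M lo m"
    and inner: "fill A M (Suc lo) m s1 s2" and s: "compat s s1" "allowed A (Suc lo) s1"
  shows "fill A M lo m s s2"
  by (rule fill_trans[OF fill_single[OF s(1)] inner s(2) sp]) (use nl in blast)

lemma fill_right_chord:
  assumes m: "M m h" and sp: "splits_at m h (Suc h)"
    and inner: "fill A M m h s1 s2" and s: "compat s2 s" "allowed A h s2"
  shows "fill A M m (Suc h) s1 s"
  by (rule fill_trans[OF inner fill_single[OF s(1)] s(2) sp]) (use unique[OF m, of m "Suc h"] in auto)

text \<open>Removing the first and the last vertex or chord leaves an interval at whose ends there are again
  four different colours. If only two vertices without chords remain, then the edge between them is
  treated like a chord, that is, gets the colour \<open>0\<close>.\<close>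

theorem fill_distinct4:
  assumes "closed_between lo hi" "lo + 2 \<le> hi" "distinct4 p e f q"
  shows "fill {} M lo hi (p, 0, e) (f, 0, q)"
  using assms
proof (induction "hi - lo" arbitrary: lo hi p e f q rule: less_induct)
  case less
  note cl = less.prems(1) and le = less.prems(2) and d = distinct4D[OF less.prems(3)]
  have IH: "fill {} M l h (p', 0, e') (f', 0, q')"
    if "closed_between l h" "l + 2 \<le> h" "h - l < hi - lo" "distinct4 p' e' f' q'" for l h p' e' f' q'
    using less.hyps[OF that(3,1,2,4)] .
  \<comment> \<open>These quadruples are the colours around the chords that are removed and around
    the intervals that remain in the cases below.\<close>
  have perm: "distinct4 e q p f" "distinct4 q p e f" "distinct4 e f p q" "distinct4 p q e f"
    "distinct4 e q p f" "distinct4 e f q p" "distinct4 p f e q"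
    using less.prems(3) by (auto simp: distinct4_def)
  have ch: "M lo hi \<Longrightarrow> chord_compat (p, 0, e) (f, 0, q)" using d by simp
  obtain h where h: "hi = Suc h" "lo < h" using le by (cases hi) auto
  have inner: "fill {} M l m (p', 0, e') (f', 0, q')" if "M l m" "lo < l" "m < hi" "distinct4 p' e' f' q'"
    for l m p' e' f' q'
    using IH[OF closed_chord[OF that(1)] _ _ that(4)] gap[OF that(1)] that by simp
  have right_vertex: "fill {} M l hi s (f, 0, q)"
    if "fill {} M l h s (f', t, f)" "splits_at l h hi" "\<not> M l hi" "allowed {} h (f', t, f)" "compat (f', t, f) (f, 0, q)"
    for l s f' t
    using fill_trans[OF that(1) fill_single[OF that(5)] that(4)] that(2,3) h by simp
  \<comment> \<open>The last edge under the chord has colour \<open>s'\<close> and is at distance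
    two from the edge of colour \<open>q\<close> beyond \<open>hi\<close>; hence
    \<open>s' \<noteq> q\<close>.\<close>
  have right_chord: "fill {} M l hi s (f, 0, q)"
    if r: "fill {} M l m s (f', 0, q')" "splits_at l m hi" "\<not> M l hi" "M m h" "splits_at m h hi" "lo < m"
      "distinct4 f' q' s' f" "s' \<noteq> q" for l m s f' q' s'
  proof -
    have "fill {} M m (Suc h) (f', 0, q') (f, 0, q)"
      by (rule fill_right_chord[OF r(4) _ inner[OF r(4,6) _ r(7)]])
        (use r h d distinct4D[OF r(7)] in auto)
    then show ?thesis using fill_trans[OF r(1) _ _ r(2)] r(3) h distinct4D[OF r(7)] by simp
  qed
  show ?case
  proof (cases rule: left_token[OF cl le])
    case 1
    note L = 1
    have left: "?thesis" if "fill {} M (Suc lo) hi (e, t, c) (f, 0, q)" "allowed {} (Suc lo) (e, t, c)"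
      "compat (p, 0, e) (e, t, c)" for t c
      by (rule fill_trans[OF fill_single[OF that(3)] that(1,2) L(2) ch])
    have nM: "\<not> M (Suc lo) hi" using L(3) by (auto simp: unmatched_def)
    show ?thesis
    proof (cases "Suc lo = h")
      case True
      then have "fill {} M (Suc lo) hi (e, 0, f) (f, 0, q)"
        unfolding h(1) True[symmetric] using d by (intro fill_single) auto
      then show ?thesis using left[of 0 f] d by simp
    next
      case False
      then have lh: "Suc lo < h" using h by simp
      show ?thesis
      proof (cases rule: right_token[OF L(1)[unfolded h(1)] lh])
        case 1
        note R = 1[folded h(1)]
        show ?thesis
        proof (cases "Suc (Suc lo) = h")
          case True
          have "fill {} M (Suc lo) h (e, q, 0) (0, p, f)"
            unfolding True[symmetric] using d by (intro fill_single) auto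
          then have "fill {} M (Suc lo) hi (e, q, 0) (f, 0, q)"
            using right_vertex[OF _ R(2) nM] d by simp
          then show ?thesis using left[of q 0] d by simp
        next
          case False
          \<comment> \<open>The outer colours change sides: \<open>p\<close> is excluded near
            \<open>lo\<close> and \<open>q\<close> near \<open>hi\<close>, so \<open>q\<close>
            follows on the left and \<open>p\<close> precedes on the right. Together with
            \<open>e\<close> and \<open>f\<close>, now outer colours, these are again four.\<close>
          then have "fill {} M (Suc lo) h (e, 0, q) (p, 0, f)"
            using IH[OF R(1) _ _ perm(1)] lh h by simp
          then have "fill {} M (Suc lo) hi (e, 0, q) (f, 0, q)"
            using right_vertex[OF _ R(2) nM] d by simp
          then show ?thesis using left[of 0 q] d by simp
        qed
      next
        case (2 m)
        note R = 2[folded h(1)]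
        have lm: "Suc lo < m" "m < hi" using R(3) by (auto simp: splits_at_def)
        show ?thesis
        proof (cases "Suc (Suc lo) = m")
          case True
          have "fill {} M (Suc lo) m (e, 0, q) (q, 0, p)"
            unfolding True[symmetric] using d by (intro fill_single) auto
          then have "fill {} M (Suc lo) hi (e, 0, q) (f, 0, q)"
            using right_chord[OF _ R(3) nM R(1,4) _ perm(2)] d lm by simp
          then show ?thesis using left[of 0 q] d by simp
        next
          case False
          then have "fill {} M (Suc lo) m (e, 0, f) (p, 0, q)"
            using IH[OF R(2) _ _ perm(3)] lm by simp
          then have "fill {} M (Suc lo) hi (e, 0, f) (f, 0, q)"
            using right_chord[OF _ R(3) nM R(1,4) _ perm(4)] d lm by simp
          then show ?thesis using left[of 0 f] d by simp
        qed
      qed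
    qed
  next
    case (2 m)
    note L = 2
    have lm: "Suc lo < m" "m < hi" using gap[OF L(1)] L(3) by (auto simp: splits_at_def)
    have nlm: "\<not> M lo m" using unique[OF L(1), of lo m] by auto
    have nM: "\<not> M m hi" using unique[OF L(1), of m hi] lm by auto
    \<comment> \<open>\<open>s\<close> and \<open>s'\<close> colour the first and the last edge
      under the chord, \<open>c\<close> the edge after it. The edge of colour \<open>s\<close> is at
      distance two from that of colour \<open>p\<close> before \<open>lo\<close>.\<close>
    have left: "?thesis" if "fill {} M m hi (s', 0, c) (f, 0, q)" "distinct4 e s s' c" "s \<noteq> p" for s s' c
    proof -
      have "fill {} M lo m (p, 0, e) (s', 0, c)"
        by (rule fill_left_chord[OF L(1,4) nlm inner[OF L(1) _ _ that(2)]])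
          (use that d distinct4D[OF that(2)] lm in auto)
      then show ?thesis
        by (rule fill_trans[OF _ that(1) _ L(3) ch]) (use distinct4D[OF that(2)] in auto)
    qed
    show ?thesis
    proof (cases "m = h")
      case True
      then have "fill {} M m hi (p, 0, f) (f, 0, q)"
        unfolding h(1) True using d by (intro fill_single) auto
      then show ?thesis using left[OF _ perm(1)] d by simp
    next
      case False
      then have mh: "m < h" using lm h by simp
      show ?thesis
      proof (cases rule: right_token[OF L(2)[unfolded h(1)] mh])
        case 1
        note R = 1[folded h(1)]
        show ?thesis
        proof (cases "Suc m = h")
          case True
          have "fill {} M m h (q, 0, p) (p, 0, f)"
            unfolding True[symmetric] using d by (intro fill_single) auto
          then have "fill {} M m hi (q, 0, p) (f, 0, q)"
            using right_vertex[OF _ R(2) nM] d by simp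
          then show ?thesis using left[OF _ perm(6)] d by simp
        next
          case False
          then have "fill {} M m h (p, 0, q) (e, 0, f)"
            using IH[OF R(1) _ _ perm(4)] mh h lm by simp
          then have "fill {} M m hi (p, 0, q) (f, 0, q)"
            using right_vertex[OF _ R(2) nM] d by simp
          then show ?thesis using left[OF _ perm(3)] d by simp
        qed
      next
        case (2 m')
        note R = 2[folded h(1)]
        have mm: "m < m'" "m' < hi" "lo < m'" using R(3) lm by (auto simp: splits_at_def)
        show ?thesis
        proof (cases "Suc m = m'")
          case True
          have "fill {} M m m' (f, 0, p) (p, 0, q)"
            unfolding True[symmetric] using d by (intro fill_single) auto
          then have "fill {} M m hi (f, 0, p) (f, 0, q)"
            using right_chord[OF _ R(3) nM R(1,4) mm(3) perm(4)] d by simp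
          moreover have "distinct4 e q f p" using perm by (auto simp: distinct4_def)
          ultimately show ?thesis using left[of f p q] d by simp
        next
          case False
          then have "fill {} M m m' (p, 0, f) (e, 0, q)"
            using IH[OF R(2) _ _ perm(7)] mm lm by simp
          then have "fill {} M m hi (p, 0, f) (f, 0, q)"
            using right_chord[OF _ R(3) nM R(1,4) mm(3) perm(1)] d by simp
          then show ?thesis using left[OF _ perm(1)] d by simp
        qed
      qed
    qed
  qed
qed

end

section \<open>Colourings around a cycle\<close>

context noncrossing_matching begin

lemma fill_right_distinct4:
  assumes "M m h" "splits_at m h (Suc h)" "distinct4 f q s g" "compat (s, 0, g) t"
  shows "fill {} M m (Suc h) (f, 0, q) t"
proof (rule fill_right_chord[OF assms(1,2) fill_distinct4[OF _ _ assms(3)]])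
  show "closed_between m h" "m + 2 \<le> h" using closed_chord[OF assms(1)] gap[OF assms(1)] by auto
qed (use assms distinct4D[OF assms(3)] in auto)

lemma fill_left_distinct4:
  assumes "M (Suc l) m" "splits_at l (Suc l) m" "distinct4 e s t c" "compat u (e, 0, s)"
  shows "fill {} M l m u (t, 0, c)"
proof (rule fill_left_chord[OF assms(1,2) _ fill_distinct4[OF _ _ assms(3)]])
  show "closed_between (Suc l) m" "Suc l + 2 \<le> m" using closed_chord[OF assms(1)] gap[OF assms(1)] by auto
  show "\<not> M l m" using unique[OF assms(1), of l m] by auto
qed (use assms distinct4D[OF assms(3)] in auto)

text \<open>The way a chord gets the colour \<open>5\<close>: the recursion is run as if it had
  \<open>0\<close>, then the third edges are recoloured, which also frees \<open>0\<close> for a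
  cycle edge next to the chord.\<close>

lemma fill_chord_relaxed:
  assumes "M l m" "distinct4 p e f q" "{a, b} \<subseteq> {p, 0, 5}" "a \<noteq> b" "{c, d} \<subseteq> {q, 0, 5}" "c \<noteq> d"
    and "chord_compat (a, b, e) (f, c, d)"
  shows "fill A M l m (a, b, e) (f, c, d)"
proof (rule fill_relax[OF fill_distinct4[OF _ _ assms(2)]])
  show "closed_between l m" "closed_between l m" "l + 2 \<le> m" "l + 2 \<le> m"
    using closed_chord[OF assms(1)] gap[OF assms(1)] by auto
qed (use assms distinct4D[OF assms(2)] in auto)

lemma last_chord:
  assumes "closed_between m (Suc k)" "m < k" "\<not> unmatched k"
  obtains m' where "M m' k" "closed_between m m'" "splits_at m m' (Suc k)" "splits_at m' k (Suc k)"
proof (cases rule: right_token[OF assms(1,2)])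
  case 1
  then show thesis using assms(3) by blast
next
  case (2 m')
  then show thesis by (rule that)
qed

text \<open>\<open>y\<close> occurs at both ends, as happens when an interval runs around the cycle
  to the root, so \<open>fill_distinct4\<close> does not apply directly. Removing the chord at the
  end leaves pieces with four different end colours, or a single edge.\<close>

lemma fill_last_chord:
  assumes cl: "closed_between m (Suc k)" "m < k" "\<not> unmatched k" and nM: "\<not> M m (Suc k)"
    and d: "distinct4 x y a b"
  shows "fill {} M m (Suc k) (y, 0, a) (y, 0, x)"
proof -
  note D = distinct4D[OF d]
  obtain m' where m: "M m' k" "closed_between m m'" "splits_at m m' (Suc k)" "splits_at m' k (Suc k)"
    using last_chord[OF cl] .
  have p: "distinct4 a x b y" "distinct4 y a b x" "distinct4 b x a y"
    using d by (auto simp: distinct4_def)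
  show ?thesis
  proof (cases "Suc m = m'")
    case True
    show ?thesis
    proof (rule fill_trans[OF _ fill_right_distinct4[OF m(1,4) p(1)] _ m(3)])
      show "fill {} M m m' (y, 0, a) (a, 0, x)"
        unfolding True[symmetric] using D by (intro fill_single) simp
    qed (use D nM in auto)
  next
    case False
    show ?thesis
    proof (rule fill_trans[OF fill_distinct4[OF m(2) _ p(2)] fill_right_distinct4[OF m(1,4) p(3)] _ m(3)])
      show "m + 2 \<le> m'" using False m(3) by (auto simp: splits_at_def)
    qed (use D nM in auto)
  qed
qed

text \<open>The positions \<open>0\<close> and \<open>N\<close> are the same vertex, the root; its third edge has the colour \<open>c\<close>.\<close>

definition cyclic_fill :: "nat \<Rightarrow> nat \<Rightarrow> nat \<Rightarrow> nat \<Rightarrow> bool" where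
  "cyclic_fill N c a b \<longleftrightarrow> (\<exists>A x y. fill A M 0 N (y, c, x) (y, c, x) \<and> x \<le> 4 \<and> y \<le> 4 \<and>
     (x \<noteq> 0 \<longrightarrow> x \<noteq> a \<and> x \<noteq> b) \<and> (y \<noteq> 0 \<longrightarrow> y \<noteq> a \<and> y \<noteq> b) \<and>
     (A = {} \<or> (\<exists>\<alpha> \<beta>. M \<alpha> \<beta> \<and> A = {\<alpha>, \<beta>})))"

text \<open>The colour \<open>5\<close> is needed if the first vertex after the root has no chord and is followed by a
  chord: the edge in between then gets the colour \<open>0\<close>.\<close>

lemma cyclic_fill_matching_root:
  assumes cl: "closed_between 0 N" "\<not> M 0 N" "3 \<le> N" and d: "distinct4 x y a b"
    and dir: "unmatched (Suc 0) \<or> \<not> unmatched (N - 1)"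
  shows "cyclic_fill N 0 a b"
proof -
  note D = distinct4D[OF d]
  obtain k where k: "N = Suc k" "2 \<le> k" using cl(3) by (cases N) auto
  \<comment> \<open>As the third edge at the root has colour \<open>0\<close>, its cycle edges must
    get the two nonzero colours other than \<open>a\<close> and \<open>b\<close>: the star is forced
    up to direction.\<close>
  have *: ?thesis if "fill A M 0 (Suc k) (y, 0, x) (y, 0, x)" "A = {} \<or> (\<exists>\<alpha> \<beta>. M \<alpha> \<beta> \<and> A = {\<alpha>, \<beta>})" for A
    unfolding cyclic_fill_def k using that D by blast
  have ch: "\<And>s t. M 0 (Suc k) \<Longrightarrow> chord_compat s t" using cl k by simp
  have N2: "0 + 2 \<le> N" using cl(3) by simp
  have perm: "distinct4 x a b y" "distinct4 x b y a" "distinct4 x b a y" "distinct4 y b a x"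
    "distinct4 b x a y" "distinct4 a y b x" "distinct4 x y b a"
    using d by (auto simp: distinct4_def)
  show ?thesis
  proof (cases rule: left_token[OF cl(1) N2])
    case 1
    note L = 1[unfolded k]
    have first: "?thesis" if "fill A M (Suc 0) (Suc k) (x, t, c) (y, 0, x)" "allowed A (Suc 0) (x, t, c)"
      "compat (y, 0, x) (x, t, c)" "A = {} \<or> (\<exists>\<alpha> \<beta>. M \<alpha> \<beta> \<and> A = {\<alpha>, \<beta>})" for A t c
      by (rule *[OF fill_trans[OF fill_single[OF that(3)] that(1,2) L(2) ch] that(4)])
    have nM1: "\<not> M (Suc 0) j" for j using L(3) by (auto simp: unmatched_def)
    have k1: "Suc 0 < k" using k by simp
    show ?thesis
    proof (cases "unmatched k")
      case True
      have R: "closed_between (Suc 0) k" "splits_at (Suc 0) k (Suc k)"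
        using right_token[OF L(1) k1] True unfolding unmatched_def by metis+
      \<comment> \<open>For \<open>k = 2\<close> the cycle is a triangle and the edge opposite the
        root gets \<open>a\<close>; otherwise the edges next to those of colours \<open>x\<close>
        and \<open>y\<close> get \<open>a\<close> and \<open>b\<close>.\<close>
      have "fill {} M (Suc 0) k (x, 0, a) ((if k = 2 then a else b), 0, y)"
      proof (cases "k = 2")
        case True
        then show ?thesis using D fill_single[of "(x, 0, a)" "(a, 0, y)" "{}" "Suc 0"] by (simp add: numeral_2_eq_2)
      next
        case False
        then show ?thesis using fill_distinct4[OF R(1) _ perm(1)] k by simp
      qed
      then have "fill {} M (Suc 0) (Suc k) (x, 0, a) (y, 0, x)"
        by (rule fill_trans[OF _ fill_single _ R(2)]) (use D nM1 in auto)
      then show ?thesis using first[of "{}" 0 a] D by simp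
    next
      case False
      have le: "Suc 0 + 2 \<le> Suc k" using k by simp
      show ?thesis
      proof (cases rule: left_token[OF L(1) le])
        case 1
        note L2 = 1
        have nM2: "\<not> M (Suc (Suc 0)) j" for j using L2(3) by (auto simp: unmatched_def)
        have k2: "Suc (Suc 0) < k" using k False L2(3) by (cases "k = 2") (auto simp: numeral_2_eq_2)
        \<comment> \<open>The second cycle edge gets \<open>0\<close>, and \<open>y\<close> moves to
          the third edge at position two, an exchange of the kind that \<open>fill_relax\<close>
          permits.\<close>
        have "fill {} M (Suc (Suc 0)) (Suc k) (0, y, a) (y, 0, x)"
          by (rule fill_relax[OF fill_last_chord[OF L2(1) k2 False nM2 d]]) (use D k2 L2(1) nM2 in auto)
        then have "fill {} M (Suc 0) (Suc k) (x, b, 0) (y, 0, x)"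
          using D nM1 by (intro fill_trans[OF fill_single _ _ L2(2)]) auto
        then show ?thesis using first[of "{}" b 0] D by simp
      next
        case (2 \<beta>)
        note L2 = 2
        let ?A = "{Suc (Suc 0), \<beta>}"
        have A: "?A = {} \<or> (\<exists>\<alpha> \<beta>. M \<alpha> \<beta> \<and> ?A = {\<alpha>, \<beta>})" using L2(1) by blast
        have \<beta>: "\<beta> < Suc k" "Suc (Suc 0) < \<beta>" "\<not> M \<beta> (Suc k)"
          using L2(3) gap[OF L2(1)] unique[OF L2(1), of \<beta> "Suc k"] by (auto simp: splits_at_def)
        \<comment> \<open>The chord gets \<open>5\<close> and the cycle edge before it
          \<open>0\<close>; \<open>t\<close> is for the third edge at position one,
          \<open>u\<close>, \<open>v\<close>, \<open>w\<close> for the other cycle edges at the ends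
          of the chord.\<close>
        have second: "?thesis"
          if "fill ?A M (Suc (Suc 0)) \<beta> (0, 5, u) (v, 5, w)" "allowed ?A \<beta> (v, 5, w)"
            "fill ?A M \<beta> (Suc k) (v, 5, w) (y, 0, x)" "compat (x, t, 0) (0, 5, u)" "compat (y, 0, x) (x, t, 0)"
            "t \<le> 4" "u \<le> 4" for t u v w
        proof -
          have "fill ?A M (Suc 0) \<beta> (x, t, 0) (v, 5, w)"
            by (rule fill_trans[OF fill_single[OF that(4)] that(1) _ L2(4)]) (use that nM1 in auto)
          then have "fill ?A M (Suc 0) (Suc k) (x, t, 0) (y, 0, x)"
            by (rule fill_trans[OF _ that(3,2) L2(3)]) (use nM1 in auto)
          then show ?thesis using first[OF _ _ that(5) A] that D by simp
        qed
        show ?thesis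
        proof (cases "\<beta> = k")
          case True
          show ?thesis
          proof (rule second)
            show "fill ?A M (Suc (Suc 0)) \<beta> (0, 5, a) (b, 5, y)"
              by (rule fill_chord_relaxed[OF L2(1) perm(1)]) (use D in auto)
            show "fill ?A M \<beta> (Suc k) (b, 5, y) (y, 0, x)"
              unfolding True by (rule fill_single) (use D in auto)
            show "compat (x, b, 0) (0, 5, a)" "compat (y, 0, x) (x, b, 0)" using D by auto
          qed (use D in auto)
        next
          case False
          then have \<beta>k: "\<beta> < k" using \<beta> by simp
          obtain m' where m: "M m' k" "closed_between \<beta> m'" "splits_at \<beta> m' (Suc k)" "splits_at m' k (Suc k)"
            using last_chord[OF L2(2) \<beta>k \<open>\<not> unmatched k\<close>] .
          have nm: "\<not> M \<beta> m'" using unique[OF m(1), of \<beta> m'] gap[OF m(1)] by auto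
          have last: "fill ?A M m' (Suc k) (f, 0, x) (y, 0, x)" if "f = a \<or> f = b" for f
          proof (rule fill_allowed_mono[OF fill_right_distinct4[OF m(1,4)]])
            show "distinct4 f x (if f = a then b else a) y" using that d by (auto simp: distinct4_def)
          qed (use that D in auto)
          show ?thesis
          proof (cases "Suc \<beta> = m'")
            case True
            show ?thesis
            proof (rule second)
              show "fill ?A M (Suc (Suc 0)) \<beta> (0, 5, b) (a, 5, x)"
                by (rule fill_chord_relaxed[OF L2(1) perm(4)]) (use D in auto)
              show "fill ?A M \<beta> (Suc k) (a, 5, x) (y, 0, x)"
              proof (rule fill_trans[OF _ fill_allowed_mono[OF fill_right_distinct4[OF m(1,4) perm(3)]] _ m(3)])
                show "fill ?A M \<beta> m' (a, 5, x) (x, 0, b)"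
                  unfolding True[symmetric] using D by (intro fill_single) simp
              qed (use D \<beta> in auto)
              show "compat (x, a, 0) (0, 5, b)" "compat (y, 0, x) (x, a, 0)" using D by auto
            qed (use D in auto)
          next
            case False
            show ?thesis
            proof (rule second)
              show "fill ?A M (Suc (Suc 0)) \<beta> (0, 5, b) (a, 5, y)"
                by (rule fill_chord_relaxed[OF L2(1) perm(3)]) (use D in auto)
              have "fill {} M \<beta> m' (a, 0, y) (b, 0, x)"
                using fill_distinct4[OF m(2) _ perm(6)] False m(3) by (simp add: splits_at_def)
              then have "fill ?A M \<beta> m' (a, 5, y) (b, 0, x)"
                by (rule fill_relax) (use D False m nm in \<open>auto simp: splits_at_def\<close>)
              then show "fill ?A M \<beta> (Suc k) (a, 5, y) (y, 0, x)"
                by (rule fill_trans[OF _ last _ m(3)]) (use D \<beta> in auto)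
              show "compat (x, a, 0) (0, 5, b)" "compat (y, 0, x) (x, a, 0)" using D by auto
            qed (use D in auto)
          qed
        qed
      qed
    qed
  next
    case (2 m)
    note L = 2[unfolded k]
    have lm: "Suc 0 < m" "m < Suc k" using gap[OF L(1)] L(3) by (auto simp: splits_at_def)
    have nM: "\<not> M m (Suc k)" using unique[OF L(1), of m "Suc k"] lm by auto
    \<comment> \<open>By \<open>dir\<close> a chord as first token forces a chord as last token;
      then the colour \<open>5\<close> does not occur.\<close>
    have "\<not> unmatched (Suc 0)" using L(1) by (auto simp: unmatched_def)
    then have kk: "\<not> unmatched k" using dir k by simp
    show ?thesis
    proof (cases "m = k")
      case True
      have last: "fill {} M m (Suc k) (a, 0, y) (y, 0, x)"
        unfolding True using D by (intro fill_single) simp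
      show ?thesis
        by (rule *[OF fill_trans[OF fill_left_distinct4[OF L(1,4) perm(3)] last _ L(3) ch]]) (use D in auto)
    next
      case False
      then have last: "fill {} M m (Suc k) (y, 0, a) (y, 0, x)"
        using fill_last_chord[OF L(2) _ kk nM d] lm by simp
      show ?thesis
        by (rule *[OF fill_trans[OF fill_left_distinct4[OF L(1,4) perm(2)] last _ L(3) ch]]) (use D in auto)
    qed
  qed
qed

text \<open>Since \<open>c\<close> is not \<open>0\<close>, the first cycle edge can get
  \<open>0\<close>, and only the colour \<open>y\<close> has to avoid \<open>c\<close>,
  \<open>a\<close>, \<open>b\<close>. If the first vertex has no chord,
  \<open>fill_distinct4\<close> is used after exchanging \<open>0\<close> with \<open>m\<close>
  there and with \<open>c\<close> at the root. Otherwise its chord meets the edge of colour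
  \<open>0\<close> and gets \<open>5\<close>.\<close>

lemma cyclic_fill_nonzero_root:
  assumes cl: "closed_between 0 N" "\<not> M 0 N" "3 \<le> N" and d: "distinct4 c y m n"
    and ab: "y \<noteq> a" "y \<noteq> b"
    and dir: "unmatched (Suc 0) \<or> \<not> unmatched (N - 1)"
  shows "cyclic_fill N c a b"
proof -
  note D = distinct4D[OF d]
  obtain k where k: "N = Suc k" "2 \<le> k" using cl(3) by (cases N) auto
  have *: ?thesis if "fill A M 0 (Suc k) (y, c, 0) (y, c, 0)" "A = {} \<or> (\<exists>\<alpha> \<beta>. M \<alpha> \<beta> \<and> A = {\<alpha>, \<beta>})" for A
    unfolding cyclic_fill_def k using that D ab by blast
  have ch: "\<And>s t. M 0 (Suc k) \<Longrightarrow> chord_compat s t" using cl k by simp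
  have N2: "0 + 2 \<le> N" using cl(3) by simp
  have perm: "distinct4 m n y c" "distinct4 c m n y" "distinct4 y m n c" "distinct4 n y m c" "distinct4 m c n y"
    using d by (auto simp: distinct4_def)
  show ?thesis
  proof (cases rule: left_token[OF cl(1) N2])
    case 1
    note L = 1[unfolded k]
    have nM1: "\<not> M (Suc 0) j" for j using L(3) by (auto simp: unmatched_def)
    have "fill {} M (Suc 0) (Suc k) (m, 0, n) (y, 0, c)"
      using fill_distinct4[OF L(1) _ perm(1)] k by simp
    then have last: "fill {} M (Suc 0) (Suc k) (0, m, n) (y, c, 0)"
      by (rule fill_relax) (use k D L(1) nM1 in auto)
    have "fill {} M 0 (Suc k) (y, c, 0) (y, c, 0)"
      by (rule fill_trans[OF fill_single last _ L(2) ch]) (use D in auto)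
    then show ?thesis by (rule *) simp
  next
    case (2 \<beta>)
    note L = 2[unfolded k]
    let ?A = "{Suc 0, \<beta>}"
    have A: "?A = {} \<or> (\<exists>\<alpha> \<beta>. M \<alpha> \<beta> \<and> ?A = {\<alpha>, \<beta>})" using L(1) by blast
    have \<beta>: "\<beta> < Suc k" "Suc 0 < \<beta>" "\<not> M \<beta> (Suc k)" "\<not> M 0 \<beta>"
      using L(3) gap[OF L(1)] unique[OF L(1), of \<beta> "Suc k"] unique[OF L(1), of 0 \<beta>] by (auto simp: splits_at_def)
    have "\<not> unmatched (Suc 0)" using L(1) by (auto simp: unmatched_def)
    then have kk: "\<not> unmatched k" using dir k by simp
    have first: "?thesis"
      if "fill ?A M (Suc 0) \<beta> (0, 5, m) (n, 5, w)" "fill ?A M \<beta> (Suc k) (n, 5, w) (y, c, 0)" "w \<le> 4" for w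
    proof (rule *[OF fill_trans[OF fill_left_chord[OF L(1,4) \<beta>(4) that(1)] that(2) _ L(3) ch] A])
      show "compat (y, c, 0) (0, 5, m)" "allowed ?A (Suc 0) (0, 5, m)" "allowed ?A \<beta> (n, 5, w)"
        using D that by auto
    qed
    show ?thesis
    proof (cases "\<beta> = k")
      case True
      show ?thesis
      proof (rule first)
        show "fill ?A M (Suc 0) \<beta> (0, 5, m) (n, 5, y)"
          by (rule fill_chord_relaxed[OF L(1) perm(2)]) (use D in auto)
        show "fill ?A M \<beta> (Suc k) (n, 5, y) (y, c, 0)"
          unfolding True by (rule fill_single) (use D in auto)
      qed (use D in auto)
    next
      case False
      then have \<beta>k: "\<beta> < k" using \<beta> by simp
      obtain m' where m': "M m' k" "closed_between \<beta> m'" "splits_at \<beta> m' (Suc k)" "splits_at m' k (Suc k)"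
        using last_chord[OF L(2) \<beta>k kk] .
      have nm: "\<not> M \<beta> m'" using unique[OF m'(1), of \<beta> m'] gap[OF m'(1)] by auto
      show ?thesis
      proof (cases "Suc \<beta> = m'")
        case True
        show ?thesis
        proof (rule first)
          show "fill ?A M (Suc 0) \<beta> (0, 5, m) (n, 5, c)"
            by (rule fill_chord_relaxed[OF L(1) perm(3)]) (use D in auto)
          show "fill ?A M \<beta> (Suc k) (n, 5, c) (y, c, 0)"
          proof (rule fill_trans[OF _ fill_allowed_mono[OF fill_right_distinct4[OF m'(1,4) perm(2)]] _ m'(3)])
            show "fill ?A M \<beta> m' (n, 5, c) (c, 0, m)"
              unfolding True[symmetric] using D by (intro fill_single) simp
          qed (use D \<beta> in auto)
        qed (use D in auto)
      next
        case False
        show ?thesis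
        proof (rule first)
          show "fill ?A M (Suc 0) \<beta> (0, 5, m) (n, 5, y)"
            by (rule fill_chord_relaxed[OF L(1) perm(2)]) (use D in auto)
          have "fill {} M \<beta> m' (n, 0, y) (m, 0, c)"
            using fill_distinct4[OF m'(2) _ perm(4)] False m'(3) by (simp add: splits_at_def)
          then have 1: "fill ?A M \<beta> m' (n, 5, y) (m, 0, c)"
            by (rule fill_relax) (use D False m' nm in \<open>auto simp: splits_at_def\<close>)
          show "fill ?A M \<beta> (Suc k) (n, 5, y) (y, c, 0)"
            by (rule fill_trans[OF 1 fill_allowed_mono[OF fill_right_distinct4[OF m'(1,4) perm(5)]] _ m'(3)])
              (use D \<beta> in auto)
        qed (use D in auto)
      qed
    qed
  qed
qed

end

lemma distinct4_exists:
  assumes "a \<in> {1..4}" "b \<in> {1..4}" "a \<noteq> b"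
  obtains x y where "distinct4 x y a b"
proof -
  have "card ({1..4} - {a, b}) = 2" using assms by (simp add: card_Diff_subset)
  then obtain x y where xy: "{1..4} - {a, b} = {x, y}" "x \<noteq> y" by (auto simp: card_2_iff)
  then have "x \<in> {1..4} - {a, b}" "y \<in> {1..4} - {a, b}" by simp_all
  then have "distinct4 x y a b" using assms xy(2) unfolding distinct4_def by auto
  then show thesis by (rule that)
qed

section \<open>Reversing the direction of the cycle\<close>

fun mirror :: "star \<Rightarrow> star" where
  "mirror (a, t, b) = (b, t, a)"

lemma compat_mirror: "compat s t \<Longrightarrow> compat (mirror t) (mirror s)"
  by (cases s; cases t) auto

lemma chord_compat_mirror: "chord_compat s t \<Longrightarrow> chord_compat (mirror t) (mirror s)"
  by (cases s; cases t) auto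

text \<open>The bounds prevent truncated subtraction from sending positions beyond \<open>N\<close>
  to \<open>0\<close>.\<close>

definition reflect :: "nat \<Rightarrow> (nat \<Rightarrow> nat \<Rightarrow> bool) \<Rightarrow> nat \<Rightarrow> nat \<Rightarrow> bool" where
  "reflect N M i j \<longleftrightarrow> i \<le> N \<and> j \<le> N \<and> M (N - j) (N - i)"

context noncrossing_matching begin

lemma noncrossing_matching_reflect: "noncrossing_matching (reflect N M)"
proof
  show "Suc i < j" if "reflect N M i j" for i j
    using gap[of "N - j" "N - i"] that unfolding reflect_def by auto
  show "i = k \<and> j = l" if "reflect N M i j" "reflect N M k l" "{i, j} \<inter> {k, l} \<noteq> {}" for i j k l
    using two_chords[of "N - j" "N - i" "N - l" "N - k"] that gap[of "N - j" "N - i"] gap[of "N - l" "N - k"]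
    unfolding reflect_def by auto
  show "l < j" if "reflect N M i j" "reflect N M k l" "i < k" "k < j" for i j k l
    using two_chords[of "N - j" "N - i" "N - l" "N - k"] that gap[of "N - j" "N - i"] gap[of "N - l" "N - k"]
    unfolding reflect_def by auto
qed

lemma fill_reflect:
  assumes "fill A (reflect N M) 0 N s t" "\<And>i j. M i j \<Longrightarrow> j \<le> N"
  shows "fill {i. N - i \<in> A} M 0 N (mirror t) (mirror s)"
proof -
  obtain \<sigma> where \<sigma>: "\<sigma> 0 = s" "\<sigma> N = t" "\<And>i. i < N \<Longrightarrow> compat (\<sigma> i) (\<sigma> (Suc i))"
    "\<And>i j. reflect N M i j \<Longrightarrow> chord_compat (\<sigma> i) (\<sigma> j)"
    "\<And>i. 0 < i \<Longrightarrow> i < N \<Longrightarrow> allowed A i (\<sigma> i)"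
    using assms(1) unfolding fill_def reflect_def by auto
  define \<tau> where "\<tau> i = mirror (\<sigma> (N - i))" for i
  have "compat (\<tau> i) (\<tau> (Suc i))" if "i < N" for i
    using compat_mirror[OF \<sigma>(3)[of "N - Suc i"]] that unfolding \<tau>_def by (simp add: Suc_diff_Suc)
  moreover have "chord_compat (\<tau> i) (\<tau> j)" if "M i j" for i j
    using chord_compat_mirror[OF \<sigma>(4)[of "N - j" "N - i"]] assms(2)[OF that] gap[OF that] that
    unfolding \<tau>_def reflect_def by auto
  moreover have "allowed {i. N - i \<in> A} i (\<tau> i)" if "0 < i" "i < N" for i
    using \<sigma>(5)[of "N - i"] that unfolding \<tau>_def by (cases "\<sigma> (N - i)") auto
  moreover have "\<tau> 0 = mirror t" "\<tau> N = mirror s" using \<sigma>(1,2) by (auto simp: \<tau>_def)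
  ultimately show ?thesis unfolding fill_def by blast
qed

lemma cyclic_fill_reflect:
  assumes "noncrossing_matching.cyclic_fill (reflect N M) N c a b" "\<And>i j. M i j \<Longrightarrow> 0 < i \<and> j < N"
  shows "cyclic_fill N c a b"
proof -
  obtain A x y where A: "fill A (reflect N M) 0 N (y, c, x) (y, c, x)" "x \<le> 4" "y \<le> 4"
    "x \<noteq> 0 \<longrightarrow> x \<noteq> a \<and> x \<noteq> b" "y \<noteq> 0 \<longrightarrow> y \<noteq> a \<and> y \<noteq> b"
    "A = {} \<or> (\<exists>\<alpha> \<beta>. reflect N M \<alpha> \<beta> \<and> A = {\<alpha>, \<beta>})"
    using assms(1) unfolding noncrossing_matching.cyclic_fill_def[OF noncrossing_matching_reflect] by blast
  have jN: "\<And>i j. M i j \<Longrightarrow> j \<le> N" using assms(2) by (simp add: less_imp_le)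
  have f: "fill {i. N - i \<in> A} M 0 N (x, c, y) (x, c, y)"
    using fill_reflect[OF A(1) jN] by simp
  have "\<exists>A. fill A M 0 N (x, c, y) (x, c, y) \<and> (A = {} \<or> (\<exists>\<alpha> \<beta>. M \<alpha> \<beta> \<and> A = {\<alpha>, \<beta>}))"
    using A(6)
  proof
    assume "A = {}"
    then show ?thesis using f by auto
  next
    assume "\<exists>\<alpha> \<beta>. reflect N M \<alpha> \<beta> \<and> A = {\<alpha>, \<beta>}"
    then obtain \<alpha> \<beta> where ab: "M (N - \<beta>) (N - \<alpha>)" "A = {\<alpha>, \<beta>}" "\<alpha> \<le> N" "\<beta> \<le> N"
      unfolding reflect_def by blast
    \<comment> \<open>Truncated subtraction sends every \<open>i\<close> from \<open>N\<close> on to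
      \<open>0\<close>, but \<open>0\<close> is not in \<open>A\<close> because no chord ends at the
      root.\<close>
    have "{i. N - i \<in> A} \<subseteq> {N - \<beta>, N - \<alpha>}"
      using ab assms(2)[OF ab(1)] gap[OF ab(1)] by auto
    then show ?thesis using fill_allowed_mono[OF f] ab(1) by blast
  qed
  then show ?thesis unfolding cyclic_fill_def using A by blast
qed

text \<open>The direction around the cycle is free. The two preceding cases, \<open>c = 0\<close>
  and \<open>c\<close> nonzero, leave out only a chord as first and a vertex as last token, and the
  mirror image of this has a vertex first.\<close>

theorem cyclic_fill:
  assumes M: "\<And>i j. M i j \<Longrightarrow> 0 < i \<and> j < N" and N: "3 \<le> N"
    and c: "c \<le> 4" "a \<le> 4" "b \<le> 4" "distinct [c, a, b]"
  shows "cyclic_fill N c a b"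
proof -
  have root: "noncrossing_matching.cyclic_fill M' N c a b"
    if M': "noncrossing_matching M'" "\<And>i j. M' i j \<Longrightarrow> 0 < i \<and> j < N"
      and dir: "noncrossing_matching.unmatched M' (Suc 0) \<or> \<not> noncrossing_matching.unmatched M' (N - 1)" for M'
  proof -
    interpret M': noncrossing_matching M' by fact
    have cl: "M'.closed_between 0 N" "\<not> M' 0 N"
      unfolding M'.closed_between_def using M'(2) by blast+
    show ?thesis
    proof (cases "c = 0")
      case True
      then have "a \<in> {1..4}" "b \<in> {1..4}" "a \<noteq> b" using c by auto
      then obtain x y where "distinct4 x y a b" by (rule distinct4_exists)
      then show ?thesis using M'.cyclic_fill_matching_root[OF cl N _ dir] True by simp
    next
      case False
      have "\<not> {1, 2, 3, 4} \<subseteq> {c, a, b}"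
        using card_mono[of "{c, a, b}" "{1, 2, 3, 4 :: nat}"] card_length[of "[c, a, b]"] by auto
      then obtain y where y: "y \<in> {1, 2, 3, 4}" "y \<noteq> c" "y \<noteq> a" "y \<noteq> b" by blast
      then have "c \<in> {1..4}" "y \<in> {1..4}" "c \<noteq> y" using False c by auto
      then obtain m n where "distinct4 m n c y" by (rule distinct4_exists)
      then have "distinct4 c y m n" by (auto simp: distinct4_def)
      then show ?thesis using M'.cyclic_fill_nonzero_root[OF cl N _ y(3,4) dir] by simp
    qed
  qed
  show ?thesis
  proof (cases "unmatched (Suc 0) \<or> \<not> unmatched (N - 1)")
    case True
    then show ?thesis using root[OF noncrossing_matching_axioms M] by blast
  next
    case False
    interpret R: noncrossing_matching "reflect N M" by (rule noncrossing_matching_reflect)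
    have R: "0 < i \<and> j < N" if "reflect N M i j" for i j
      using that M[of "N - j" "N - i"] unfolding reflect_def by auto
    have "R.unmatched (Suc 0)"
      using False N unfolding unmatched_def R.unmatched_def reflect_def
      by auto
    then show ?thesis using cyclic_fill_reflect[OF root[OF noncrossing_matching_reflect R] M] by blast
  qed
qed

end

section \<open>Gluing colourings\<close>

definition pendant :: "'a set set \<Rightarrow> 'a set \<Rightarrow> bool" where
  "pendant E f \<longleftrightarrow> (\<exists>v\<in>f. \<forall>g\<in>E. v \<in> g \<longrightarrow> g = f)"

text \<open>The edges in between may coincide with the ends, so the third and fourth clauses cover
  all distances up to two and three. The last clause goes beyond the packing condition: it prepares
  the gluing, because a bridge is pendant in the part that contains it.\<close>

definition good_coloring :: "'a set set \<Rightarrow> ('a set \<Rightarrow> nat) \<Rightarrow> bool" where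
  "good_coloring E k \<longleftrightarrow>
     (\<forall>e\<in>E. k e \<le> 5) \<and>
     (\<forall>e\<in>E. \<forall>f\<in>E. e \<noteq> f \<longrightarrow> e \<inter> f \<noteq> {} \<longrightarrow> k e \<noteq> k f) \<and>
     (\<forall>e\<in>E. \<forall>f\<in>E. \<forall>g\<in>E. f \<noteq> g \<longrightarrow> f \<inter> e \<noteq> {} \<longrightarrow> g \<inter> e \<noteq> {} \<longrightarrow> k f = k g \<longrightarrow> k f = 0) \<and>
     (\<forall>f\<in>E. \<forall>g\<in>E. \<forall>e\<in>E. \<forall>h\<in>E. f \<noteq> g \<longrightarrow> f \<inter> e \<noteq> {} \<longrightarrow> e \<inter> h \<noteq> {} \<longrightarrow> h \<inter> g \<noteq> {} \<longrightarrow>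
        k f = 5 \<longrightarrow> k g \<noteq> 5) \<and>
     (\<forall>e\<in>E. \<forall>f\<in>E. pendant E f \<longrightarrow> e \<inter> f \<noteq> {} \<longrightarrow> k e \<noteq> 5)"

lemma good_coloringD:
  assumes "good_coloring E k"
  shows good_coloring_le: "e \<in> E \<Longrightarrow> k e \<le> 5"
    and good_coloring_proper: "e \<in> E \<Longrightarrow> f \<in> E \<Longrightarrow> e \<noteq> f \<Longrightarrow> e \<inter> f \<noteq> {} \<Longrightarrow> k e \<noteq> k f"
    and good_coloring_strong: "e \<in> E \<Longrightarrow> f \<in> E \<Longrightarrow> g \<in> E \<Longrightarrow> f \<noteq> g \<Longrightarrow> f \<inter> e \<noteq> {} \<Longrightarrow> g \<inter> e \<noteq> {} \<Longrightarrow>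
      k f = k g \<Longrightarrow> k f = 0"
    and good_coloring_five: "f \<in> E \<Longrightarrow> g \<in> E \<Longrightarrow> e \<in> E \<Longrightarrow> h \<in> E \<Longrightarrow> f \<noteq> g \<Longrightarrow> f \<inter> e \<noteq> {} \<Longrightarrow>
      e \<inter> h \<noteq> {} \<Longrightarrow> h \<inter> g \<noteq> {} \<Longrightarrow> k f = 5 \<Longrightarrow> k g \<noteq> 5"
    and good_coloring_pendant: "e \<in> E \<Longrightarrow> f \<in> E \<Longrightarrow> pendant E f \<Longrightarrow> e \<inter> f \<noteq> {} \<Longrightarrow> k e \<noteq> 5"
proof -
  note c = assms[unfolded good_coloring_def]
  note c2 = c[THEN conjunct2] and c3 = c[THEN conjunct2, THEN conjunct2]
  note c4 = c3[THEN conjunct2]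
  show "e \<in> E \<Longrightarrow> k e \<le> 5" by (rule c[THEN conjunct1, rule_format])
  show "e \<in> E \<Longrightarrow> f \<in> E \<Longrightarrow> e \<noteq> f \<Longrightarrow> e \<inter> f \<noteq> {} \<Longrightarrow> k e \<noteq> k f"
    by (rule c2[THEN conjunct1, rule_format])
  show "e \<in> E \<Longrightarrow> f \<in> E \<Longrightarrow> g \<in> E \<Longrightarrow> f \<noteq> g \<Longrightarrow> f \<inter> e \<noteq> {} \<Longrightarrow> g \<inter> e \<noteq> {} \<Longrightarrow>
      k f = k g \<Longrightarrow> k f = 0" by (rule c3[THEN conjunct1, rule_format])
  show "f \<in> E \<Longrightarrow> g \<in> E \<Longrightarrow> e \<in> E \<Longrightarrow> h \<in> E \<Longrightarrow> f \<noteq> g \<Longrightarrow> f \<inter> e \<noteq> {} \<Longrightarrow>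
      e \<inter> h \<noteq> {} \<Longrightarrow> h \<inter> g \<noteq> {} \<Longrightarrow> k f = 5 \<Longrightarrow> k g \<noteq> 5" by (rule c4[THEN conjunct1, rule_format])
  show "e \<in> E \<Longrightarrow> f \<in> E \<Longrightarrow> pendant E f \<Longrightarrow> e \<inter> f \<noteq> {} \<Longrightarrow> k e \<noteq> 5"
    by (rule c4[THEN conjunct2, rule_format])
qed

text \<open>The colours that remain admissible if \<open>r\<close> has a further edge of colour \<open>c\<close> whose other end
  meets edges of the colours \<open>a\<close> and \<open>b\<close>.\<close>

definition rooted_coloring :: "'a set set \<Rightarrow> ('a set \<Rightarrow> nat) \<Rightarrow> 'a \<Rightarrow> nat \<Rightarrow> nat \<Rightarrow> nat \<Rightarrow> bool" where
  "rooted_coloring E k r c a b \<longleftrightarrow>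
     (\<forall>e\<in>E. r \<in> e \<longrightarrow> k e \<noteq> c \<and> k e \<noteq> 5 \<and> (k e \<noteq> 0 \<longrightarrow> k e \<noteq> a \<and> k e \<noteq> b)) \<and>
     (c \<noteq> 0 \<longrightarrow> (\<forall>e\<in>E. \<forall>g\<in>E. r \<in> e \<longrightarrow> e \<inter> g \<noteq> {} \<longrightarrow> k g \<noteq> c))"

locale pendant_gluing =
  fixes E1 E2 :: "'a set set" and u v :: 'a
  assumes card2: "e \<in> E1 \<union> E2 \<Longrightarrow> card e = 2"
    and uv: "{u, v} \<in> E1"
    and leaf: "e \<in> E1 \<Longrightarrow> v \<in> e \<Longrightarrow> e = {u, v}"
    and shared: "\<Union>E1 \<inter> \<Union>E2 \<subseteq> {v}"
begin

lemma disjoint: "E1 \<inter> E2 = {}"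
proof -
  have False if "e \<in> E1" "e \<in> E2" for e
  proof -
    have "e \<subseteq> {v}" using that shared by blast
    then have "card e \<le> card {v}" by (intro card_mono) auto
    then show False using card2[of e] that by simp
  qed
  then show ?thesis by blast
qed

lemma crossing: "e \<in> E1 \<Longrightarrow> f \<in> E2 \<Longrightarrow> e \<inter> f \<noteq> {} \<Longrightarrow> e = {u, v} \<and> v \<in> f"
proof -
  assume a: "e \<in> E1" "f \<in> E2" "e \<inter> f \<noteq> {}"
  then obtain x where "x \<in> e" "x \<in> f" by blast
  then have "x = v" using a shared by blast
  then show ?thesis using a leaf \<open>x \<in> e\<close> \<open>x \<in> f\<close> by blast
qed

text \<open>The sides meet only through \<open>{u, v}\<close> at \<open>v\<close>. Of the edges that
  meet \<open>{u, v}\<close>, those in \<open>E1\<close> avoid \<open>5\<close> because this edge is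
  pendant there, those in \<open>E2\<close> because of the root condition. So edges of colour
  \<open>5\<close> on different sides are separated by \<open>{u, v}\<close> and at least one more
  edge on each side.\<close>

lemma good_coloring_glue:
  assumes g1: "good_coloring E1 k1" and g2: "good_coloring E2 k2"
    and root: "rooted_coloring E2 k2 v (k1 {u, v}) a b"
    and nbr: "\<And>e. e \<in> E1 \<Longrightarrow> u \<in> e \<Longrightarrow> e \<noteq> {u, v} \<Longrightarrow> k1 e = a \<or> k1 e = b"
  shows "good_coloring (E1 \<union> E2) (\<lambda>e. if e \<in> E1 then k1 e else k2 e)"
proof -
  define k where "k e = (if e \<in> E1 then k1 e else k2 e)" for e
  have k1: "k e = k1 e" if "e \<in> E1" for e using that by (simp add: k_def)
  have k2: "k e = k2 e" if "e \<in> E2" for e using that disjoint by (auto simp: k_def)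
  have cr: "e = {u, v}" "v \<in> f" if "e \<in> E1" "f \<in> E2" "e \<inter> f \<noteq> {} \<or> f \<inter> e \<noteq> {}" for e f
    using crossing[of e f] that by blast+
  have proper1: "k e \<noteq> k f" if "e \<in> E1" "f \<in> E1" "e \<noteq> f" "e \<inter> f \<noteq> {}" for e f
    using g1 that k1 unfolding good_coloring_def by auto
  have proper2: "k e \<noteq> k f" if "e \<in> E2" "f \<in> E2" "e \<noteq> f" "e \<inter> f \<noteq> {}" for e f
    using g2 that k2 unfolding good_coloring_def by auto
  have root_v: "k f \<noteq> k {u, v}" "k f \<noteq> 5" "k f \<noteq> 0 \<Longrightarrow> k f \<noteq> a \<and> k f \<noteq> b" if "f \<in> E2" "v \<in> f" for f
    using root that k2 k1[OF uv] unfolding rooted_coloring_def by auto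
  have root_far: "k g \<noteq> k {u, v}" if "k {u, v} \<noteq> 0" "e \<in> E2" "g \<in> E2" "v \<in> e" "e \<inter> g \<noteq> {}" for e g
    using root that k2 k1[OF uv] unfolding rooted_coloring_def by auto
  have pend: "pendant E1 {u, v}" unfolding pendant_def using leaf by blast
  have five1: "k e \<noteq> 5" if "e \<in> E1" "e \<inter> {u, v} \<noteq> {}" for e
    using g1 that k1 uv pend unfolding good_coloring_def by auto
  have uv5: "k {u, v} \<noteq> 5" using five1[OF uv] by simp
  have nbr': "k e = a \<or> k e = b" if "e \<in> E1" "u \<in> e" "e \<noteq> {u, v}" for e
    using nbr that k1 by auto
  \<comment> \<open>If \<open>e\<close> is in \<open>E1\<close>, then it is the bridge, and
    \<open>f\<close> has one of the colours \<open>a\<close>, \<open>b\<close> avoided at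
    \<open>v\<close>. If \<open>e\<close> is in \<open>E2\<close>, then \<open>f\<close> is the
    bridge, whose colour is avoided by all edges of \<open>E2\<close> at distance two from
    it.\<close>
  have cross2: "k f = 0" if f: "f \<in> E1" and g: "g \<in> E2" and e: "e \<in> E1 \<union> E2"
    and i: "f \<inter> e \<noteq> {}" "g \<inter> e \<noteq> {}" and eq: "k f = k g" for e f g
  proof (cases "e \<in> E1")
    case True
    then have e: "e = {u, v}" "v \<in> g" using cr[of e g] g i by auto
    then have "f \<noteq> {u, v}" using root_v(1)[OF g e(2)] eq by auto
    then have "u \<in> f" using i e f leaf by blast
    then show ?thesis using nbr'[OF f] \<open>f \<noteq> {u, v}\<close> root_v(3)[OF g e(2)] eq by auto
  next
    case False
    then have "e \<in> E2" using e by simp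
    then have "f = {u, v}" "v \<in> e" using cr[of f e] f i by auto
    then show ?thesis using root_far[of e g] \<open>e \<in> E2\<close> g i eq by (auto simp: Int_commute)
  qed
  have five_cross: False if f: "f \<in> E1" and g: "g \<in> E2" and eh: "e \<in> E1 \<union> E2" "h \<in> E1 \<union> E2"
    and i: "f \<inter> e \<noteq> {}" "e \<inter> h \<noteq> {}" "h \<inter> g \<noteq> {}" and 5: "k f = 5" "k g = 5" for e f g h
  proof -
    have f': "f \<inter> {u, v} = {}" using five1[OF f] 5 by blast
    have e: "e \<in> E1" using cr(1)[of f e] f i(1) f' eh(1) by auto
    have h: "h \<in> E1" using cr(1)[of e h] e i f' eh(2) by auto
    show False using cr[of h g] h g i(3) root_v(2)[OF g] 5 by auto
  qed
  have P1: "k e \<noteq> k f" if "e \<in> E1 \<union> E2" "f \<in> E1 \<union> E2" "e \<noteq> f" "e \<inter> f \<noteq> {}" for e f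
    using that(1)
  proof
    assume e: "e \<in> E1"
    from that(2) show ?thesis
    proof
      assume "f \<in> E2"
      then show ?thesis using cr[of e f] e that(4) root_v(1)[of f] by auto
    qed (use proper1 e that(3,4) in blast)
  next
    assume e: "e \<in> E2"
    from that(2) show ?thesis
    proof
      assume "f \<in> E1"
      then show ?thesis using cr[of f e] e that(4) root_v(1)[of e] by auto
    qed (use proper2 e that(3,4) in blast)
  qed
  have P2: "k f = 0" if ef: "e \<in> E1 \<union> E2" "f \<in> E1 \<union> E2" "g \<in> E1 \<union> E2" and n: "f \<noteq> g"
    and i: "f \<inter> e \<noteq> {}" "g \<inter> e \<noteq> {}" and eq: "k f = k g" for e f g
    using ef(2)
  proof
    assume f: "f \<in> E1"
    from ef(3) show ?thesis
    proof
      assume g: "g \<in> E1"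
      then have "e \<in> E1" using cr(1)[of f e] cr(1)[of g e] f i n ef(1) by auto
      then show ?thesis using good_coloring_strong[OF g1 _ f g n i] eq k1[OF f] k1[OF g] by simp
    qed (use cross2[OF f _ ef(1) i eq] in blast)
  next
    assume f: "f \<in> E2"
    from ef(3) show ?thesis
    proof
      assume g: "g \<in> E1"
      show ?thesis using cross2[OF g f ef(1) i(2,1) eq[symmetric]] eq by simp
    next
      assume g: "g \<in> E2"
      from ef(1) show ?thesis
      proof
        assume e: "e \<in> E1"
        then have "v \<in> f" "v \<in> g" using cr(2)[OF e f] cr(2)[OF e g] i by auto
        then show ?thesis using proper2[OF f g n] eq by blast
      next
        assume "e \<in> E2"
        then show ?thesis using good_coloring_strong[OF g2 _ f g n i] eq k2[OF f] k2[OF g] by simp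
      qed
    qed
  qed
  have P5: "k g \<noteq> 5" if fg: "f \<in> E1 \<union> E2" "g \<in> E1 \<union> E2" and eh: "e \<in> E1 \<union> E2" "h \<in> E1 \<union> E2"
    and n: "f \<noteq> g" and i: "f \<inter> e \<noteq> {}" "e \<inter> h \<noteq> {}" "h \<inter> g \<noteq> {}" and kf: "k f = 5" for e f g h
  proof
    assume kg: "k g = 5"
    have nuv: "f \<noteq> {u, v}" "g \<noteq> {u, v}" using kf kg uv5 by auto
    from fg(1) show False
    proof
      assume f: "f \<in> E1"
      from fg(2) show False
      proof
        assume g: "g \<in> E1"
        have "e \<in> E1" "h \<in> E1" using cr(1)[OF f, of e] cr(1)[OF g, of h] i nuv eh by blast+
        then show False using good_coloring_five[OF g1 f g _ _ n i] kf kg k1[OF f] k1[OF g] by simp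
      qed (use five_cross[OF f _ eh i kf kg] in blast)
    next
      assume f: "f \<in> E2"
      from fg(2) show False
      proof
        assume g: "g \<in> E1"
        show False using five_cross[OF g f eh(2,1) _ _ _ kg kf] i by (simp add: Int_commute)
      next
        assume g: "g \<in> E2"
        have "e \<in> E2" "h \<in> E2"
          using cr(2)[of e f] cr(2)[of h g] f g i eh kf kg root_v(2)[OF f] root_v(2)[OF g] by blast+
        then show False using good_coloring_five[OF g2 f g _ _ n i] kf kg k2[OF f] k2[OF g] by simp
      qed
    qed
  qed
  have Pp: "k e \<noteq> 5" if ef: "e \<in> E1 \<union> E2" "f \<in> E1 \<union> E2" and pf: "pendant (E1 \<union> E2) f" and i: "e \<inter> f \<noteq> {}" for e f
    using ef(1)
  proof
    assume e: "e \<in> E1"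
    from ef(2) show ?thesis
    proof
      assume f: "f \<in> E1"
      have "pendant E1 f" using pf unfolding pendant_def by blast
      then show ?thesis using good_coloring_pendant[OF g1 e f _ i] k1[OF e] by simp
    next
      assume "f \<in> E2"
      then show ?thesis using cr(1)[OF e] i uv5 by blast
    qed
  next
    assume e: "e \<in> E2"
    from ef(2) show ?thesis
    proof
      assume "f \<in> E1"
      then show ?thesis using cr(2)[of f e] e i root_v(2)[OF e] by blast
    next
      assume f: "f \<in> E2"
      have "pendant E2 f" using pf unfolding pendant_def by blast
      then show ?thesis using good_coloring_pendant[OF g2 e f _ i] k2[OF e] by simp
    qed
  qed
  have P0: "k e \<le> 5" if "e \<in> E1 \<union> E2" for e
    using that g1 g2 k1 k2 unfolding good_coloring_def by auto
  have "good_coloring (E1 \<union> E2) k"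
    unfolding good_coloring_def
    by (intro conjI ballI impI) (rule P0 P1 P2 P5 Pp; assumption)+
  then show ?thesis unfolding k_def .
qed

text \<open>The new conflict arises for \<open>r = u\<close>: the edges of \<open>E2\<close> at
  \<open>v\<close> are then at distance two from the third edge of \<open>r\<close>. Counting its
  colour \<open>c\<close> among the colours \<open>a\<close>, \<open>b\<close> met at
  \<open>u\<close> excludes it.\<close>

lemma rooted_coloring_glue:
  assumes 1: "rooted_coloring E1 k1 r c a' b'" and r: "r \<notin> \<Union>E2"
    and root: "rooted_coloring E2 k2 v (k1 {u, v}) a b"
    and nbr: "r = u \<Longrightarrow> c \<noteq> 0 \<Longrightarrow> c = a \<or> c = b"
  shows "rooted_coloring (E1 \<union> E2) (\<lambda>e. if e \<in> E1 then k1 e else k2 e) r c a' b'"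
proof -
  have far: "k2 g \<noteq> c" if "c \<noteq> 0" "e \<in> E1" "g \<in> E2" "r \<in> e" "e \<inter> g \<noteq> {}" for e g
  proof -
    have e: "e = {u, v}" "v \<in> g" using crossing that by blast+
    then have "r = u" using that r by blast
    then show ?thesis using root nbr e that unfolding rooted_coloring_def by auto
  qed
  have E1: "e \<in> E1" if "e \<in> E1 \<union> E2" "r \<in> e" for e using that r by blast
  show ?thesis
    unfolding rooted_coloring_def
  proof (intro conjI impI ballI)
    fix e assume "e \<in> E1 \<union> E2" "r \<in> e"
    then have "e \<in> E1" "r \<in> e" using E1 by blast+
    then show "(if e \<in> E1 then k1 e else k2 e) \<noteq> c" "(if e \<in> E1 then k1 e else k2 e) \<noteq> 5"
      "(if e \<in> E1 then k1 e else k2 e) \<noteq> 0 \<Longrightarrow> (if e \<in> E1 then k1 e else k2 e) \<noteq> a'"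
      "(if e \<in> E1 then k1 e else k2 e) \<noteq> 0 \<Longrightarrow> (if e \<in> E1 then k1 e else k2 e) \<noteq> b'"
      using 1 unfolding rooted_coloring_def by auto
  next
    fix e g assume *: "c \<noteq> 0" "e \<in> E1 \<union> E2" "g \<in> E1 \<union> E2" "r \<in> e" "e \<inter> g \<noteq> {}"
    then have e: "e \<in> E1" using E1 by blast
    show "(if g \<in> E1 then k1 g else k2 g) \<noteq> c"
    proof (cases "g \<in> E1")
      case True
      then show ?thesis using 1 e * unfolding rooted_coloring_def by auto
    next
      case False
      then show ?thesis using far[OF *(1) e _ *(4,5)] *(3) by auto
    qed
  qed
qed

end

section \<open>Cycles with chords\<close>

definition is_cycle :: "'a set set \<Rightarrow> 'a list \<Rightarrow> bool" where
  "is_cycle E zs \<longleftrightarrow> 3 \<le> length zs \<and> gpath E zs \<and> {last zs, hd zs} \<in> E"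

text \<open>The excluded subgraph is a subdivision of the complete graph on four vertices in which
  two disjoint edges, the chords, are not subdivided.\<close>

definition no_crossing :: "'a set set \<Rightarrow> bool" where
  "no_crossing E \<longleftrightarrow> (\<forall>a A b B c C d D. distinct (a # A @ b # B @ c # C @ d # D) \<longrightarrow>
     successively (\<lambda>x y. {x, y} \<in> E) (a # A @ b # B @ c # C @ d # D @ [a]) \<longrightarrow>
     {a, c} \<in> E \<longrightarrow> {b, d} \<notin> E)"

locale subcubic_graph =
  fixes E :: "'a set set"
  assumes finite_edges: "finite E"
    and card_edge: "e \<in> E \<Longrightarrow> card e = 2"
    and degree_le_3: "card {e \<in> E. v \<in> e} \<le> 3"
begin

lemma edge_other:
  assumes "e \<in> E" "x \<in> e" obtains y where "e = {x, y}" "x \<noteq> y"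
  using card_edge[OF assms(1)] assms(2) by (auto simp: card_2_iff)

lemma four_edges:
  assumes "distinct es" "set es \<subseteq> {e \<in> E. v \<in> e}" shows "length es \<le> 3"
  using card_mono[OF _ assms(2)] finite_edges degree_le_3[of v] distinct_card[OF assms(1)] by simp

end

locale cycle_in_graph = subcubic_graph E for E :: "'a set set" +
  fixes zs :: "'a list"
  assumes cycle: "is_cycle E zs"
begin

abbreviation n :: nat where "n \<equiv> length zs"

text \<open>Indexed by its first position: \<open>ring i\<close> leaves position \<open>i\<close>
  and \<open>ring (prev i)\<close> enters it.\<close>

definition ring :: "nat \<Rightarrow> 'a set" where "ring i = {zs ! i, zs ! (Suc i mod n)}"

definition prev :: "nat \<Rightarrow> nat" where "prev i = (if i = 0 then n - 1 else i - 1)"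

lemma n3: "3 \<le> n" using cycle by (simp add: is_cycle_def)

lemma distinct_zs: "distinct zs" using cycle by (simp add: is_cycle_def gpath_def)

lemma nth_eq: "i < n \<Longrightarrow> j < n \<Longrightarrow> zs ! i = zs ! j \<longleftrightarrow> i = j"
  using distinct_zs by (simp add: nth_eq_iff_index_eq)

lemma prev_less: "i < n \<Longrightarrow> prev i < n" by (auto simp: prev_def)

lemma Suc_prev: "i < n \<Longrightarrow> Suc (prev i) mod n = i" using n3 by (auto simp: prev_def)

lemma Suc_mod: "i < n \<Longrightarrow> Suc i mod n = (if Suc i = n then 0 else Suc i)" by (auto simp: mod_Suc)

lemma ring_in: "i < n \<Longrightarrow> ring i \<in> E"
proof -
  assume i: "i < n"
  have "{zs ! i, zs ! Suc i} \<in> E" if "Suc i < n"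
    using cycle that unfolding is_cycle_def gpath_def by (auto simp: successively_conv_nth)
  moreover have "zs \<noteq> []" using n3 by auto
  then have "last zs = zs ! (n - 1)" "hd zs = zs ! 0" by (auto simp: last_conv_nth hd_conv_nth)
  moreover have "zs ! (n - 1) = zs ! i" if "Suc i = n" using that by (metis diff_Suc_1)
  ultimately show ?thesis using i cycle unfolding ring_def is_cycle_def by (cases "Suc i = n") (auto simp: Suc_mod)
qed

lemma ring_at: "i < n \<Longrightarrow> zs ! i \<in> ring i" "i < n \<Longrightarrow> zs ! i \<in> ring (prev i)"
  by (auto simp: ring_def Suc_prev)

lemma ring_atD:
  assumes "i < n" "j < n" "zs ! i \<in> ring j" shows "j = i \<or> j = prev i"
proof -
  have "Suc j mod n < n" using n3 by (intro mod_less_divisor) linarith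
  then have "i = j \<or> i = Suc j mod n" using assms nth_eq unfolding ring_def by auto
  then show ?thesis using assms n3 unfolding prev_def by (auto simp: Suc_mod split: if_splits)
qed

lemma ring_inj: "i < n \<Longrightarrow> j < n \<Longrightarrow> ring i = ring j \<Longrightarrow> i = j"
proof -
  assume a: "i < n" "j < n" "ring i = ring j"
  have "i = j \<or> i = prev j" "j = i \<or> j = prev i"
    using ring_atD[of j i] ring_atD[of i j] ring_at(1)[of i] ring_at(1)[of j] a by auto
  then show "i = j" using a n3 unfolding prev_def by (auto split: if_splits)
qed

lemma prev_ring: "i < n \<Longrightarrow> ring (prev i) \<noteq> ring i"
  using ring_inj[of "prev i" i] prev_less[of i] n3 unfolding prev_def by (auto split: if_splits)

lemma third_unique:
  assumes "i < n" "e \<in> E" "f \<in> E" "zs ! i \<in> e" "zs ! i \<in> f" "e \<notin> ring ` {..<n}" "f \<notin> ring ` {..<n}"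
  shows "e = f"
proof (rule ccontr)
  assume "e \<noteq> f"
  then have "distinct [ring i, ring (prev i), e, f]"
    using assms prev_ring[OF assms(1)] prev_less[OF assms(1)] by auto
  then show False
    using four_edges[of "[ring i, ring (prev i), e, f]" "zs ! i"] assms ring_in prev_less[OF assms(1)] ring_at by auto
qed

lemma no_third:
  assumes "i < n" "card {e \<in> E. zs ! i \<in> e} \<le> 2" "e \<in> E" "zs ! i \<in> e"
  shows "e \<in> ring ` {..<n}"
proof (rule ccontr)
  assume "e \<notin> ring ` {..<n}"
  then have "distinct [ring i, ring (prev i), e]"
    using assms prev_ring[OF assms(1)] prev_less[OF assms(1)] by auto
  moreover have "set [ring i, ring (prev i), e] \<subseteq> {e \<in> E. zs ! i \<in> e}"
    using assms ring_in prev_less[OF assms(1)] ring_at by auto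
  ultimately show False
    using card_mono[of "{e \<in> E. zs ! i \<in> e}" "set [ring i, ring (prev i), e]"] finite_edges assms(2)
      distinct_card[of "[ring i, ring (prev i), e]"] by simp
qed

lemma not_ring:
  assumes "i < n" "j < n" "Suc i < j" "\<not> (i = 0 \<and> Suc j = n)"
  shows "{zs ! i, zs ! j} \<notin> ring ` {..<n}"
proof
  assume "{zs ! i, zs ! j} \<in> ring ` {..<n}"
  then obtain l where l: "l < n" "{zs ! i, zs ! j} = ring l" by auto
  then have "l = i \<or> l = prev i" "l = j \<or> l = prev j"
    using ring_atD[of i l] ring_atD[of j l] assms by auto
  then show False using assms unfolding prev_def by (auto split: if_splits)
qed

text \<open>Index version of \<open>no_crossing\<close>; the closed list is rotated to start at
  \<open>zs ! i\<close>, so that its initial segment \<open>P\<close> comes after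
  \<open>D\<close>.\<close>

lemma crossing_chords:
  assumes nc: "no_crossing E" and ord: "i < k" "k < j" "j < l" "l < n"
    and e: "{zs ! i, zs ! j} \<in> E" "{zs ! k, zs ! l} \<in> E"
  shows False
proof -
  define P A B C D where "P = take i zs" and "A = take (k - Suc i) (drop (Suc i) zs)"
    and "B = take (j - Suc k) (drop (Suc k) zs)" and "C = take (l - Suc j) (drop (Suc j) zs)"
    and "D = drop (Suc l) zs"
  have split: "drop x zs = take (y - x) (drop x zs) @ zs ! y # drop (Suc y) zs" if "x \<le> y" "y < n" for x y
    using append_take_drop_id[of "y - x" "drop x zs"] Cons_nth_drop_Suc[OF that(2)] that by simp
  have zs: "zs = P @ zs ! i # A @ zs ! k # B @ zs ! j # C @ zs ! l # D"
    using split[of 0 i] split[of "Suc i" k] split[of "Suc k" j] split[of "Suc j" l] ord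
    unfolding P_def A_def B_def C_def D_def by simp
  let ?P = "\<lambda>x y. {x, y} \<in> E"
  have s: "successively ?P zs" "?P (last zs) (hd zs)" using cycle by (auto simp: is_cycle_def gpath_def)
  have s2: "successively ?P (zs ! i # A @ zs ! k # B @ zs ! j # C @ zs ! l # D)"
    using s(1) zs successively_appendD(2) by metis
  have s1: "successively ?P (P @ [zs ! i])"
    using s(1) zs successively_appendD(1)[of ?P "P @ [zs ! i]"] by (metis append.assoc append_Cons append_Nil)
  have "hd (P @ [zs ! i]) = hd (P @ zs ! i # A @ zs ! k # B @ zs ! j # C @ zs ! l # D)"
    by (cases P) auto
  moreover have "last (zs ! l # D) = last (P @ zs ! i # A @ zs ! k # B @ zs ! j # C @ zs ! l # D)"
    by simp
  ultimately have ends: "hd (P @ [zs ! i]) = hd zs" "last (zs ! l # D) = last zs"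
    unfolding zs[symmetric] .
  have last: "last (zs ! i # A @ zs ! k # B @ zs ! j # C @ zs ! l # D) = last zs"
    using ends(2) by simp
  have "successively ?P ((zs ! i # A @ zs ! k # B @ zs ! j # C @ zs ! l # D) @ P @ [zs ! i])"
    unfolding successively_append_iff[of ?P "zs ! i # A @ zs ! k # B @ zs ! j # C @ zs ! l # D" "P @ [zs ! i]"]
    by (intro conjI disjI2 s1 s2) (simp only: last ends(1) s(2))
  then have "successively ?P (zs ! i # A @ zs ! k # B @ zs ! j # C @ zs ! l # (D @ P) @ [zs ! i])"
    by simp
  moreover have "distinct (P @ zs ! i # A @ zs ! k # B @ zs ! j # C @ zs ! l # D)"
    using distinct_zs zs by simp
  then have "distinct (zs ! i # A @ zs ! k # B @ zs ! j # C @ zs ! l # (D @ P))" by auto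
  ultimately show False
    using nc e unfolding no_crossing_def by blast
qed

end

locale cycle_core = cycle_in_graph +
  assumes chords: "no_crossing E"
    and meets: "e \<in> E \<Longrightarrow> e \<inter> set zs \<noteq> {}"
    and leaf: "x \<in> set zs \<Longrightarrow> y \<notin> set zs \<Longrightarrow> {x, y} \<in> E \<Longrightarrow> e \<in> E \<Longrightarrow> y \<in> e \<Longrightarrow> e = {x, y}"
    and degree_hd: "card {e \<in> E. hd zs \<in> e} \<le> 2"
begin

text \<open>Position \<open>0\<close> can be left out, because \<open>degree_hd\<close> leaves no
  third edge at the root.\<close>

definition M :: "nat \<Rightarrow> nat \<Rightarrow> bool" where
  "M i j \<longleftrightarrow> 0 < i \<and> Suc i < j \<and> j < n \<and> {zs ! i, zs ! j} \<in> E"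

lemma M_third: "M i j \<Longrightarrow> {zs ! i, zs ! j} \<in> E - ring ` {..<n}"
  using not_ring[of i j] by (auto simp: M_def)

lemma hd_nth: "hd zs = zs ! 0" using n3 by (intro hd_conv_nth) auto

lemma third_cases:
  assumes "e \<in> E" "e \<notin> ring ` {..<n}"
  obtains (chord) i j where "M i j" "e = {zs ! i, zs ! j}"
  | (leaf) i y where "0 < i" "i < n" "y \<notin> set zs" "e = {zs ! i, y}"
proof -
  have pos: "0 < i" if "i < n" "zs ! i \<in> e" for i
    using no_third[of i e] that assms degree_hd by (cases i) (auto simp: hd_nth)
  obtain x where x: "x \<in> e" "x \<in> set zs" using meets[OF assms(1)] by blast
  then obtain i where i: "i < n" "zs ! i = x" by (auto simp: in_set_conv_nth)
  obtain y where y: "e = {x, y}" "x \<noteq> y" using edge_other[OF assms(1) x(1)] .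
  show thesis
  proof (cases "y \<in> set zs")
    case False
    then show thesis using leaf[of i y] pos[of i] i y by auto
  next
    case True
    then obtain j where j: "j < n" "zs ! j = y" by (auto simp: in_set_conv_nth)
    have p: "0 < i" "0 < j" using pos i j y by auto
    have "ring i = e" if "j = Suc i" using that i j y by (simp add: ring_def)
    moreover have "ring j = e" if "i = Suc j" using that i j y by (simp add: ring_def insert_commute)
    ultimately have ns: "j \<noteq> Suc i" "i \<noteq> Suc j" using assms(2) i j by auto
    have "i \<noteq> j" using i j y by auto
    then consider "Suc i < j" | "Suc j < i" using ns by linarith
    then show thesis
      using chord[of i j] chord[of j i] i j y p assms(1) unfolding M_def
      by cases (auto simp: insert_commute)
  qed
qed

lemma matching: "noncrossing_matching M"
proof
  show "Suc i < j" if "M i j" for i j using that by (simp add: M_def)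
  show "i = k \<and> j = l" if m: "M i j" "M k l" "{i, j} \<inter> {k, l} \<noteq> {}" for i j k l
  proof -
    obtain a where a: "a \<in> {i, j}" "a \<in> {k, l}" using m(3) by blast
    then have "a < n" using m(1) by (auto simp: M_def)
    then have "{zs ! i, zs ! j} = {zs ! k, zs ! l}"
      using a third_unique[of a] M_third[OF m(1)] M_third[OF m(2)] by auto
    then show ?thesis using m nth_eq unfolding M_def doubleton_eq_iff by auto
  qed
  then have u: "i = k \<and> j = l" if "M i j" "M k l" "{i, j} \<inter> {k, l} \<noteq> {}" for i j k l using that by blast
  show "l < j" if m: "M i j" "M k l" "i < k" "k < j" for i j k l
  proof (rule ccontr)
    assume "\<not> l < j"
    moreover have "l \<noteq> j" using u[OF m(1,2)] m(3) by auto
    ultimately have "j < l" by linarith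
    then show False using crossing_chords[OF chords m(3,4)] m(1,2) by (auto simp: M_def)
  qed
qed

lemma M_bounds: "M i j \<Longrightarrow> 0 < i \<and> j < n" by (simp add: M_def)

text \<open>Each edge at a cycle vertex is one of the three entries of the star there. Paths of
  length two between edges pass over a cycle edge or a chord, and these are controlled by
  \<open>compat\<close> and \<open>chord_compat\<close>; edges leaving the cycle end in
  leaves.\<close>

lemma cycle_coloring:
  assumes cab: "c \<le> 4" "a \<le> 4" "b \<le> 4" "distinct [c, a, b]"
  shows "\<exists>k. good_coloring E k \<and> rooted_coloring E k (hd zs) c a b"
proof -
  interpret M: noncrossing_matching M by (rule matching)
  obtain A x y where fill: "fill A M 0 n (y, c, x) (y, c, x)" and xy: "x \<le> 4" "y \<le> 4"
      "x \<noteq> 0 \<longrightarrow> x \<noteq> a \<and> x \<noteq> b" "y \<noteq> 0 \<longrightarrow> y \<noteq> a \<and> y \<noteq> b"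
    and A: "A = {} \<or> (\<exists>\<alpha> \<beta>. M \<alpha> \<beta> \<and> A = {\<alpha>, \<beta>})"
    using M.cyclic_fill[OF M_bounds n3 cab] unfolding M.cyclic_fill_def by blast
  obtain \<sigma> where \<sigma>0: "\<sigma> 0 = (y, c, x)" and \<sigma>n: "\<sigma> n = (y, c, x)"
    and comp: "\<And>i. i < n \<Longrightarrow> compat (\<sigma> i) (\<sigma> (Suc i))"
    and cchord: "\<And>i j. M i j \<Longrightarrow> chord_compat (\<sigma> i) (\<sigma> j)"
    and al: "\<And>i. 0 < i \<Longrightarrow> i < n \<Longrightarrow> allowed A i (\<sigma> i)"
    using fill M_bounds unfolding fill_def by (metis le0 less_imp_le)
  define lf th rt where "lf i = fst (\<sigma> i)" and "th i = fst (snd (\<sigma> i))" and "rt i = snd (snd (\<sigma> i))" for i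
  have \<sigma>: "\<sigma> i = (lf i, th i, rt i)" for i by (simp add: lf_def th_def rt_def)
  have C: "rt i = lf (Suc i)" "lf i \<noteq> th i" "lf i \<noteq> rt i" "th i \<noteq> rt i" "th (Suc i) \<noteq> rt i" "rt (Suc i) \<noteq> rt i"
    "lf i = th (Suc i) \<Longrightarrow> lf i = 0" "lf i = rt (Suc i) \<Longrightarrow> lf i = 0"
    "th i = th (Suc i) \<Longrightarrow> th i = 0" "th i = rt (Suc i) \<Longrightarrow> th i = 0" if "i < n" for i
    using comp[OF that] unfolding \<sigma> by auto
  have CC: "th i = th j" "lf i = lf j \<Longrightarrow> lf i = 0" "lf i = rt j \<Longrightarrow> lf i = 0"
    "rt i = lf j \<Longrightarrow> rt i = 0" "rt i = rt j \<Longrightarrow> rt i = 0" if "M i j" for i j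
    using cchord[OF that] unfolding \<sigma> by auto
  have ends: "lf 0 = y" "th 0 = c" "rt 0 = x" "lf n = y" "th n = c" "rt n = x"
    using \<sigma>0 \<sigma>n by (simp_all add: lf_def th_def rt_def)
  have le4: "rt i \<le> 4" if "i < n" for i
    using al[of i] that xy(1) ends(3) unfolding \<sigma> by (cases "i = 0") auto
  have five: "th i \<noteq> 5 \<or> i \<in> A" "th i \<le> 5" if "0 < i" "i < n" for i
    using al[OF that] unfolding \<sigma> by auto
  let ?R = "ring ` {..<n}"
  \<comment> \<open>The choices do not matter: a cycle edge has one index as the cycle has at least
    three vertices, and the two ends of a chord agree in their third colour.\<close>
  define k where "k e = (if e \<in> ?R then rt (SOME i. i < n \<and> ring i = e)
    else th (SOME i. i < n \<and> zs ! i \<in> e))" for e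
  have k_ring: "k (ring i) = rt i" if "i < n" for i
  proof -
    have "(SOME j. j < n \<and> ring j = ring i) = i"
      using ring_inj that by (intro some_equality) auto
    then show ?thesis using that by (auto simp: k_def)
  qed
  have k_third: "k e = th i" if e: "e \<in> E" "e \<notin> ?R" and i: "i < n" "zs ! i \<in> e" for e i
  proof -
    define j where "j = (SOME i. i < n \<and> zs ! i \<in> e)"
    have j: "j < n" "zs ! j \<in> e" using someI[of "\<lambda>i. i < n \<and> zs ! i \<in> e" i] i unfolding j_def by auto
    have "th j = th i"
    proof (cases rule: third_cases[OF e])
      case (1 p q)
      then have "p < n" "q < n" by (auto simp: M_def)
      then have "i = p \<or> i = q" "j = p \<or> j = q" using 1(2) i j nth_eq by auto
      then show ?thesis using CC(1)[OF 1(1)] by auto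
    next
      case (2 p w)
      then have "i = p" "j = p" using i j nth_eq by auto
      then show ?thesis by simp
    qed
    then show ?thesis using e by (simp add: k_def j_def)
  qed
  have third_pos: "0 < i" if "e \<in> E" "e \<notin> ?R" "i < n" "zs ! i \<in> e" for e i
    using no_third[of i e] that degree_hd by (cases i) (auto simp: hd_nth)
  have lf_prev: "rt (prev i) = lf i" if "i < n" for i
    using C(1)[of "prev i"] prev_less[OF that] that ends n3 by (auto simp: prev_def)
  have star: "(e = ring i \<and> k e = rt i) \<or> (e = ring (prev i) \<and> k e = lf i) \<or> (e \<notin> ?R \<and> k e = th i)"
    if e: "e \<in> E" and i: "i < n" "zs ! i \<in> e" for e i
  proof (cases "e \<in> ?R")
    case True
    then obtain j where j: "j < n" "e = ring j" by auto
    then have "j = i \<or> j = prev i" using ring_atD i by auto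
    then show ?thesis using j k_ring lf_prev i by auto
  qed (use k_third e i in auto)
  have proper_at: "k e \<noteq> k f" if ef: "e \<in> E" "f \<in> E" "e \<noteq> f" and i: "i < n" "zs ! i \<in> e" "zs ! i \<in> f" for e f i
    using star[OF ef(1) i(1,2)] star[OF ef(2) i(1,3)] C(2-4)[OF i(1)] third_unique[OF i(1) ef(1,2) i(2,3)] ef(3)
    by metis
  have leaf_edge: "e = f" if ef: "e \<in> E" "f \<in> E" and q: "q \<in> e" "q \<in> f" "q \<notin> set zs" for e f q
  proof -
    obtain w where w: "e = {q, w}" using edge_other[OF ef(1) q(1)] .
    then have "w \<in> set zs" using meets[OF ef(1)] q(3) by auto
    then show ?thesis using leaf[of w q f] w ef q by (auto simp: insert_commute)
  qed
  have P1: "k e \<noteq> k f" if ef: "e \<in> E" "f \<in> E" "e \<noteq> f" "e \<inter> f \<noteq> {}" for e f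
  proof -
    obtain q where q: "q \<in> e" "q \<in> f" using ef(4) by blast
    have "q \<in> set zs" using leaf_edge[OF ef(1,2) q] ef(3) by blast
    then obtain i where "i < n" "zs ! i = q" by (auto simp: in_set_conv_nth)
    then show ?thesis using proper_at[OF ef(1-3), of i] q by simp
  qed
  \<comment> \<open>Positions \<open>0\<close> and \<open>n\<close> carry the same star, so the
    conditions between neighbours survive the passage around the end of the list.\<close>
  have \<sigma>_mod: "lf (Suc i mod n) = lf (Suc i)" "th (Suc i mod n) = th (Suc i)" "rt (Suc i mod n) = rt (Suc i)"
    if "i < n" for i
    using that ends by (auto simp: Suc_mod)
  have Suc_lt: "Suc i mod n < n" for i using n3 by (intro mod_less_divisor) linarith
  have prev_Suc: "prev (Suc i mod n) = i" if "i < n" for i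
    using that by (auto simp: Suc_mod prev_def)
  have across_ring: "k f = 0" if i: "i < n" and f: "f \<in> E" "zs ! i \<in> f" "f \<noteq> ring i"
    and g: "g \<in> E" "zs ! (Suc i mod n) \<in> g" "g \<noteq> ring i" and eq: "k f = k g" for i f g
    using star[OF f(1) i f(2)] star[OF g(1) Suc_lt g(2)] f(3) g(3) eq C(7-10)[OF i]
    unfolding prev_Suc[OF i] \<sigma>_mod[OF i] by metis
  have across_chord: "k f = 0" if m: "M i j" and f: "f \<in> E" "zs ! i \<in> f" "f \<noteq> {zs ! i, zs ! j}"
    and g: "g \<in> E" "zs ! j \<in> g" "g \<noteq> {zs ! i, zs ! j}" and eq: "k f = k g" for i j f g
  proof -
    have ij: "i < n" "j < n" using m by (auto simp: M_def)
    have "f \<in> ?R" "g \<in> ?R"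
      using third_unique[OF ij(1) f(1) _ f(2), of "{zs ! i, zs ! j}"]
        third_unique[OF ij(2) g(1) _ g(2), of "{zs ! i, zs ! j}"] M_third[OF m] f g by auto
    then show ?thesis using star[OF f(1) ij(1) f(2)] star[OF g(1) ij(2) g(2)] eq CC(2-5)[OF m] by metis
  qed
  have P2: "k f = 0" if e: "e \<in> E" and f: "f \<in> E" and g: "g \<in> E" and n: "f \<noteq> g"
    and i: "f \<inter> e \<noteq> {}" "g \<inter> e \<noteq> {}" and eq: "k f = k g" for e f g
  proof -
    have dis: "f \<inter> g = {}" using P1[OF f g n] eq by blast
    then have ne: "f \<noteq> e" "g \<noteq> e" using i by auto
    obtain p where p: "p \<in> f" "p \<in> e" using i(1) by blast
    obtain q where q: "q \<in> g" "q \<in> e" using i(2) by blast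
    have pq: "p \<in> set zs" "q \<in> set zs" using leaf_edge[OF f e p] leaf_edge[OF g e q] ne by blast+
    have "p \<noteq> q" using dis p q by blast
    then have epq: "e = {p, q}" using edge_other[OF e p(2)] q(2) by blast
    show ?thesis
    proof (cases "e \<in> ?R")
      case True
      then obtain j where j: "j < length zs" "e = ring j" by auto
      then have "{p, q} = {zs ! j, zs ! (Suc j mod length zs)}" using epq by (simp add: ring_def)
      then consider "p = zs ! j" "q = zs ! (Suc j mod length zs)" | "q = zs ! j" "p = zs ! (Suc j mod length zs)"
        unfolding doubleton_eq_iff by blast
      then show ?thesis
      proof cases
        case 1
        show ?thesis by (rule across_ring[OF j(1) f _ _ g _ _ eq]) (use 1 p q ne j(2) in simp_all)
      next
        case 2
        have "k g = 0" by (rule across_ring[OF j(1) g _ _ f _ _ eq[symmetric]]) (use 2 p q ne j(2) in simp_all)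
        then show ?thesis using eq by simp
      qed
    next
      case False
      show ?thesis
      proof (cases rule: third_cases[OF e False])
        case (1 s t)
        then have "{p, q} = {zs ! s, zs ! t}" using epq by simp
        then consider "p = zs ! s" "q = zs ! t" | "q = zs ! s" "p = zs ! t"
          unfolding doubleton_eq_iff by blast
        then show ?thesis
        proof cases
          case a: 1
          show ?thesis by (rule across_chord[OF 1(1) f _ _ g _ _ eq]) (use a p q ne 1(2) in simp_all)
        next
          case a: 2
          have "k g = 0" by (rule across_chord[OF 1(1) g _ _ f _ _ eq[symmetric]]) (use a p q ne 1(2) in simp_all)
          then show ?thesis using eq by simp
        qed
      next
        case (2 s w)
        then have "w \<in> {p, q}" using epq by blast
        then show ?thesis using 2(3) pq by blast
      qed
    qed
  qed
  \<comment> \<open>Cycle edges have colours at most \<open>4\<close>, and \<open>A\<close> holds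
    the ends of at most one chord; so at most one edge has colour \<open>5\<close>, and no distance
    has to be checked.\<close>
  have k5: "\<exists>i j. M i j \<and> A = {i, j} \<and> e = {zs ! i, zs ! j}" if e: "e \<in> E" "k e = 5" for e
  proof -
    have nR: "e \<notin> ?R"
    proof
      assume "e \<in> ?R"
      then obtain i where i: "i < length zs" "e = ring i" by auto
      then show False using k_ring[OF i(1)] le4[OF i(1)] e(2) by simp
    qed
    obtain i where i: "i < n" "zs ! i \<in> e" using meets[OF e(1)] by (auto simp: in_set_conv_nth)
    have "th i = 5" "0 < i" using k_third[OF e(1) nR i] e(2) third_pos[OF e(1) nR i] by auto
    then have "i \<in> A" using five(1) i by blast
    then obtain \<alpha> \<beta> where ab: "M \<alpha> \<beta>" "A = {\<alpha>, \<beta>}" "i = \<alpha> \<or> i = \<beta>" using A by blast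
    then have "e = {zs ! \<alpha>, zs ! \<beta>}"
      using third_unique[OF i(1) e(1) _ i(2)] M_third[OF ab(1)] nR by auto
    then show ?thesis using ab by blast
  qed
  have k5u: "e = f" if "e \<in> E" "k e = 5" "f \<in> E" "k f = 5" for e f
    using k5[OF that(1,2)] k5[OF that(3,4)] by (auto simp: doubleton_eq_iff)
  have P5: "k g \<noteq> 5" if "f \<in> E" "g \<in> E" "f \<noteq> g" "k f = 5" for f g
    using k5u[of f g] that by blast
  \<comment> \<open>The chord is the third edge at both its ends, so it meets only cycle edges, and
    these are not pendant.\<close>
  have Pp: "k e \<noteq> 5" if e: "e \<in> E" and f: "f \<in> E" and p: "pendant E f" and i: "e \<inter> f \<noteq> {}" for e f
  proof
    assume "k e = 5"
    then obtain s t where st: "M s t" "e = {zs ! s, zs ! t}" using k5 e by blast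
    obtain v where v: "v \<in> f" "\<And>g. g \<in> E \<Longrightarrow> v \<in> g \<Longrightarrow> g = f" using p unfolding pendant_def by blast
    have "v \<notin> set zs"
    proof
      assume "v \<in> set zs"
      then obtain j where j: "j < n" "v = zs ! j" by (auto simp: in_set_conv_nth)
      have "ring j = f" "ring (prev j) = f"
        using v(2)[OF ring_in[OF j(1)]] v(2)[OF ring_in[OF prev_less[OF j(1)]]] ring_at[OF j(1)] j(2) by auto
      then show False using prev_ring[OF j(1)] by simp
    qed
    then have fR: "f \<notin> ?R" using v(1) Suc_lt by (auto simp: ring_def)
    obtain q where q: "q \<in> e" "q \<in> f" using i by blast
    have "s < n" "t < n" using st(1) by (auto simp: M_def)
    moreover have "q = zs ! s \<or> q = zs ! t" using q(1) st(2) by blast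
    ultimately obtain j where j: "j < n" "q = zs ! j" by blast
    have "e = f" using third_unique[OF j(1) e f] q j M_third[OF st(1)] st(2) fR by auto
    then show False using \<open>v \<notin> set zs\<close> v(1) st by (auto simp: M_def)
  qed
  have P0: "k e \<le> 5" if e: "e \<in> E" for e
  proof -
    obtain i where i: "i < n" "zs ! i \<in> e" using meets[OF e(1)] by (auto simp: in_set_conv_nth)
    show ?thesis
    proof (cases "e \<in> ?R")
      case True
      then show ?thesis using k_ring le4 by fastforce
    next
      case False
      then show ?thesis using k_third[OF e False i] five(2) third_pos[OF e False i] i by simp
    qed
  qed
  have good: "good_coloring E k"
    unfolding good_coloring_def
    by (intro conjI ballI impI) (rule P0 P1 P2 P5 Pp; assumption)+
  have n0: "0 < n" using n3 by linarith
  have root_edges: "e = ring 0 \<and> k e = x \<or> e = ring (n - 1) \<and> k e = y" if "e \<in> E" "hd zs \<in> e" for e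
    using star[OF that(1) n0] that third_pos[OF that(1) _ n0] ends hd_nth by (auto simp: prev_def)
  have xyc: "x \<noteq> c" "y \<noteq> c" using C[OF n0] ends by auto
  \<comment> \<open>This is the compatibility of the star at the root with those before and after
    it, where \<open>c\<close> is the third colour.\<close>
  have far: "k g \<noteq> c" if c0: "c \<noteq> 0" and e: "e \<in> E" "hd zs \<in> e" and g: "g \<in> E" "e \<inter> g \<noteq> {}" for e g
  proof (cases "hd zs \<in> g")
    case True
    then show ?thesis using root_edges[OF g(1)] xyc by auto
  next
    case False
    from root_edges[OF e] show ?thesis
    proof
      assume "e = ring 0 \<and> k e = x"
      then have *: "zs ! (Suc 0 mod n) \<in> g" "g \<noteq> ring 0" using g(2) False hd_nth by (auto simp: ring_def)
      then show ?thesis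
        using star[OF g(1) Suc_lt *(1)] C(9,10)[OF n0] c0 ends unfolding prev_Suc[OF n0] \<sigma>_mod[OF n0] by metis
    next
      assume "e = ring (n - 1) \<and> k e = y"
      moreover have "n - 1 < n" "Suc (n - 1) = n" using n3 by auto
      ultimately have *: "zs ! (n - 1) \<in> g" "g \<noteq> ring (n - 1)" using g(2) False hd_nth by (auto simp: ring_def)
      have "k g = lf (n - 1) \<or> k g = th (n - 1)" using star[OF g(1) \<open>n - 1 < n\<close> *(1)] *(2) by auto
      then show ?thesis using C(7,9)[OF \<open>n - 1 < n\<close>] c0 ends(5) \<open>Suc (n - 1) = n\<close> by metis
    qed
  qed
  have "rooted_coloring E k (hd zs) c a b"
    unfolding rooted_coloring_def
  proof (intro conjI impI ballI)
    fix e assume "e \<in> E" "hd zs \<in> e"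
    then have "k e = x \<or> k e = y" using root_edges by blast
    then show "k e \<noteq> c" "k e \<noteq> 5" "k e \<noteq> 0 \<Longrightarrow> k e \<noteq> a" "k e \<noteq> 0 \<Longrightarrow> k e \<noteq> b"
      using xyc xy by auto
  qed (use far in blast)
  then show ?thesis using good by blast
qed

end

section \<open>Splitting at bridges\<close>

text \<open>The excluded subgraph is a subdivision of the complete bipartite graph with parts of
  sizes two and three.\<close>

definition no_theta :: "'a set set \<Rightarrow> bool" where
  "no_theta E \<longleftrightarrow> (\<forall>x y A B C. gpath E (x # A @ [y]) \<longrightarrow> gpath E (x # B @ [y]) \<longrightarrow> gpath E (x # C @ [y]) \<longrightarrow>
     A \<noteq> [] \<longrightarrow> B \<noteq> [] \<longrightarrow> C \<noteq> [] \<longrightarrow>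
     \<not> (set A \<inter> set B = {} \<and> set A \<inter> set C = {} \<and> set B \<inter> set C = {}))"

text \<open>Only the vertices that are entered have to avoid \<open>X\<close>; the start is not
  tested. For empty \<open>X\<close> this is the connected component of \<open>a\<close>.\<close>

definition reach :: "'a set set \<Rightarrow> 'a set \<Rightarrow> 'a \<Rightarrow> 'a set" where
  "reach E X a = {y. (a, y) \<in> {(s, t). {s, t} \<in> E \<and> t \<notin> X}\<^sup>*}"

lemma reach_refl: "a \<in> reach E X a"
  by (simp add: reach_def)

lemma reach_step: "y \<in> reach E X a \<Longrightarrow> {y, z} \<in> E \<Longrightarrow> z \<notin> X \<Longrightarrow> z \<in> reach E X a"
  unfolding reach_def by (auto intro: rtrancl_into_rtrancl)

lemma reach_induct [consumes 1, case_names refl step]: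
  assumes "y \<in> reach E X a" "P a"
    and "\<And>y z. y \<in> reach E X a \<Longrightarrow> P y \<Longrightarrow> {y, z} \<in> E \<Longrightarrow> z \<notin> X \<Longrightarrow> P z"
  shows "P y"
proof -
  have "(a, y) \<in> {(s, t). {s, t} \<in> E \<and> t \<notin> X}\<^sup>*" using assms(1) by (simp add: reach_def)
  then show ?thesis
    by (induction rule: rtrancl_induct) (use assms(2,3) in \<open>auto simp: reach_def\<close>)
qed

lemma reach_notin: "y \<in> reach E X a \<Longrightarrow> a \<notin> X \<Longrightarrow> y \<notin> X"
  by (induction rule: reach_induct) auto

lemma reach_gpath:
  assumes "y \<in> reach E X a" "a \<notin> X"
  obtains xs where "gpath E xs" "xs \<noteq> []" "hd xs = a" "last xs = y" "set xs \<inter> X = {}"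
proof -
  have "\<exists>xs. gpath E xs \<and> xs \<noteq> [] \<and> hd xs = a \<and> last xs = y \<and> set xs \<inter> X = {}"
    using assms(1)
  proof (induction rule: reach_induct)
    case refl
    then show ?case using assms(2) by (intro exI[of _ "[a]"]) (auto simp: gpath_def)
  next
    case (step y z)
    then obtain xs where xs: "gpath E xs" "xs \<noteq> []" "hd xs = a" "last xs = y" "set xs \<inter> X = {}" by blast
    show ?case
    proof (cases "z \<in> set xs")
      case True
      \<comment> \<open>A return to a vertex of the path is answered by stopping at its first
        visit.\<close>
      then obtain ps qs where p: "xs = ps @ z # qs" by (meson split_list)
      then have "successively (\<lambda>x y. {x, y} \<in> E) ((ps @ [z]) @ qs)" using xs by (simp add: gpath_def)
      then have "successively (\<lambda>x y. {x, y} \<in> E) (ps @ [z])" by (rule successively_appendD(1))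
      moreover have "hd (ps @ [z]) = a" using xs(3) p by (cases ps) auto
      ultimately show ?thesis
        using xs p by (intro exI[of _ "ps @ [z]"]) (auto simp: gpath_def)
    next
      case False
      then show ?thesis
        using xs step by (intro exI[of _ "xs @ [z]"]) (auto simp: gpath_def successively_append_iff)
    qed
  qed
  then show thesis using that by blast
qed

text \<open>The bridge \<open>{u, v}\<close> belongs to the side of the root, where \<open>v\<close> is a leaf.\<close>

definition splittable :: "'a set set \<Rightarrow> 'a \<Rightarrow> bool" where
  "splittable E r \<longleftrightarrow> (\<exists>E1 E2 u v. E = E1 \<union> E2 \<and> E1 \<inter> E2 = {} \<and> {u, v} \<in> E1 \<and>
     (\<forall>e\<in>E1. v \<in> e \<longrightarrow> e = {u, v}) \<and> \<Union>E1 \<inter> \<Union>E2 \<subseteq> {v} \<and> E2 \<noteq> {} \<and> r \<notin> \<Union>E2)"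

context subcubic_graph begin

text \<open>By \<open>once\<close>, \<open>{x, a}\<close> is the only edge between \<open>X\<close>
  and what is reachable from \<open>a\<close> outside \<open>X\<close>. A second edge at
  \<open>a\<close> would make that far part nonempty and give a splitting at
  \<open>{x, a}\<close>.\<close>

lemma leaf_if_not_splittable:
  assumes ns: "\<not> splittable E r" and "r \<in> X" and xa: "x \<in> X" "a \<notin> X" "{x, a} \<in> E"
    and once: "\<And>y w. y \<in> reach E X a \<Longrightarrow> w \<in> X \<Longrightarrow> {y, w} \<in> E \<Longrightarrow> y = a \<and> w = x"
    and e: "e \<in> E" "a \<in> e"
  shows "e = {x, a}"
proof (rule ccontr)
  assume ne: "e \<noteq> {x, a}"
  let ?R = "reach E X a"
  define E2 where "E2 = {e \<in> E. e \<inter> X = {} \<and> e \<inter> ?R \<noteq> {}}"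
  have leaf: "f = {x, a}" if "f \<in> E - E2" "a \<in> f" for f
  proof -
    obtain z where z: "f = {a, z}" using edge_other[of f a] \<open>f \<in> E - E2\<close> \<open>a \<in> f\<close> by blast
    have "z \<in> X" using that z xa(2) reach_refl[of a E X] unfolding E2_def by auto
    then show ?thesis using once[OF reach_refl, of z] that z by auto
  qed
  have shared: "y = a" if e1: "y \<in> e1" "e1 \<in> E - E2" and e2: "y \<in> e2" "e2 \<in> E2" for y e1 e2
  proof -
    obtain z where z: "e2 = {y, z}" using edge_other[of e2 y] e2 unfolding E2_def by blast
    have yX: "y \<notin> X" using e2 unfolding E2_def by auto
    have yR: "y \<in> ?R"
    proof (cases "z \<in> ?R")
      case True
      then show ?thesis using reach_step[of z E X a y] e2 z yX unfolding E2_def by (auto simp: insert_commute)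
    qed (use e2 z in \<open>auto simp: E2_def\<close>)
    obtain w where w: "e1 = {y, w}" using edge_other[of e1 y] e1 by blast
    have "w \<in> X" using e1 yX yR w unfolding E2_def by auto
    then show ?thesis using once[OF yR] e1 w by auto
  qed
  have l: "\<forall>f\<in>E - E2. a \<in> f \<longrightarrow> f = {x, a}" using leaf by blast
  have sh: "\<Union>(E - E2) \<inter> \<Union>E2 \<subseteq> {a}" using shared by blast
  have "e \<in> E2" using leaf[of e] e ne by blast
  have "splittable E r"
    unfolding splittable_def
  proof (intro exI conjI)
    show "E = (E - E2) \<union> E2" "(E - E2) \<inter> E2 = {}" unfolding E2_def by auto
    show "{x, a} \<in> E - E2" using xa unfolding E2_def by auto
    show "E2 \<noteq> {}" using \<open>e \<in> E2\<close> by blast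
    show "r \<notin> \<Union>E2" using assms(2) unfolding E2_def by auto
  qed (fact l sh)+
  then show False using ns by blast
qed

text \<open>Between \<open>x\<close> and \<open>w\<close> run the ear and the two arcs of the cycle.
  Without a theta one of these arcs has no inner vertex; replacing this edge by the ear lengthens
  the cycle and keeps its first vertex.\<close>

lemma longer_cycle:
  assumes nt: "no_theta E" and zs: "is_cycle E (P @ x # A @ w # B)"
    and ear: "gpath E (x # xs @ [w])" "xs \<noteq> []" "set xs \<inter> set (P @ x # A @ w # B) = {}"
  obtains zs' where "is_cycle E zs'" "hd zs' = hd (P @ x # A @ w # B)" "length (P @ x # A @ w # B) < length zs'"
proof -
  let ?zs = "P @ x # A @ w # B" and ?P = "\<lambda>x y. {x, y} \<in> E"
  have d: "distinct ?zs" and s: "successively ?P ?zs" and cl: "{last ?zs, hd ?zs} \<in> E"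
    using zs unfolding is_cycle_def gpath_def by blast+
  have sx: "successively ?P (x # xs @ [w])" and dx: "distinct (x # xs @ [w])" using ear(1) by (auto simp: gpath_def)
  have sPx: "successively ?P (P @ [x])" using successively_appendD(1)[of ?P "P @ [x]" "A @ w # B"] s by simp
  have swB: "successively ?P (w # B)" using successively_appendD(2)[of ?P "P @ x # A" "w # B"] s by simp
  have sxAw: "successively ?P (x # A @ [w])"
    using successively_appendD(2)[of ?P P "x # A @ w # B"] successively_appendD(1)[of ?P "x # A @ [w]" B] s by simp
  consider "A = []" | "P = []" "B = []" | "A \<noteq> []" "P \<noteq> [] \<or> B \<noteq> []" by blast
  then show thesis
  proof cases
    case 1
    have "successively ?P ((x # xs) @ w # B)" using successively_join[of ?P "x # xs" w B] sx swB by simp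
    then have "successively ?P (P @ x # xs @ w # B)" using successively_join[OF sPx] by simp
    moreover have "distinct (P @ x # xs @ w # B)" using d dx ear(3) by auto
    moreover have "hd (P @ x # xs @ w # B) = hd ?zs" by (cases P) auto
    moreover have "last (P @ x # xs @ w # B) = last ?zs" by simp
    moreover have "length ?zs < length (P @ x # xs @ w # B)" using 1 ear(2) by simp
    ultimately show thesis
      using that[of "P @ x # xs @ w # B"] zs cl unfolding is_cycle_def gpath_def by simp
  next
    case 2
    have "successively ?P (rev (x # xs @ [w]))" using sx by (simp only: successively_rev insert_commute)
    then have r: "successively ?P (w # rev xs @ [x])" by simp
    have "successively ?P ((x # A) @ w # rev xs)"
      using successively_join[of ?P "x # A" w "rev xs"] sxAw successively_appendD(1)[of ?P "w # rev xs" "[x]"] r by simp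
    moreover have "{last (w # rev xs), x} \<in> E"
      using r ear(2) by (simp add: successively_append_iff successively_Cons)
    moreover have "distinct (x # A @ w # rev xs)" using d dx ear(3) 2 by auto
    moreover have "length ?zs < length (x # A @ w # rev xs)" using 2 ear(2) by simp
    ultimately show thesis
      using that[of "x # A @ w # rev xs"] zs 2 unfolding is_cycle_def gpath_def by simp
  next
    case 3
    have "successively ?P (rev (P @ [x]))" using sPx by (simp only: successively_rev insert_commute)
    then have 1: "successively ?P (x # rev P)" by simp
    have "successively ?P (rev (w # B))" using swB by (simp only: successively_rev insert_commute)
    then have 2: "successively ?P (rev B @ [w])" by simp
    have l: "last (x # rev P) = hd ?zs" by (cases P) auto
    have h: "hd (rev B @ [w]) = last ?zs" by (cases B rule: rev_cases) auto
    have "{last (x # rev P), hd (rev B @ [w])} \<in> E" using cl unfolding l h by (simp only: insert_commute)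
    then have "successively ?P ((x # rev P) @ rev B @ [w])"
      using 1 2 by (subst successively_append_iff) blast
    then have "gpath E (x # (rev P @ rev B) @ [w])" using d by (auto simp: gpath_def)
    moreover have "gpath E (x # A @ [w])" using sxAw d by (auto simp: gpath_def)
    moreover have "set A \<inter> set (rev P @ rev B) = {}" "set A \<inter> set xs = {}" "set (rev P @ rev B) \<inter> set xs = {}"
      using d ear(3) by auto
    ultimately have False
      using nt ear(1,2) 3 unfolding no_theta_def
      by (metis rev_is_Nil_conv append_is_Nil_conv)
    then show thesis ..
  qed
qed

lemma cycle_length: "is_cycle E zs \<Longrightarrow> length zs \<le> card (\<Union>E)"
proof -
  assume zs: "is_cycle E zs"
  have "finite (\<Union>E)" using finite_edges card_edge by (metis card_ge_0_finite finite_Union zero_less_numeral)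
  moreover have "set zs \<subseteq> \<Union>E"
    using Union_path_edges[of zs] path_edges_subset[of E zs] zs unfolding is_cycle_def gpath_def by auto
  ultimately show ?thesis
    using card_mono[of "\<Union>E" "set zs"] distinct_card[of zs] zs unfolding is_cycle_def gpath_def by simp
qed

text \<open>If no cycle passes through \<open>r\<close>, every edge at \<open>r\<close> is a bridge.
  Otherwise a longest cycle through \<open>r\<close> has no ear, so every edge leaving it is a
  bridge. As nothing can be split off, the far ends of these bridges are leaves, and connectedness
  leaves no further edges.\<close>

lemma core_cases:
  assumes nt: "no_theta E" and ns: "\<not> splittable E r"
    and conn: "\<forall>e\<in>E. e \<inter> reach E {} r \<noteq> {}"
  obtains (star) "\<forall>e\<in>E. r \<in> e"
  | (cycle) zs where "is_cycle E zs" "hd zs = r" "\<forall>e\<in>E. e \<inter> set zs \<noteq> {}"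
      "\<forall>x y e. x \<in> set zs \<longrightarrow> y \<notin> set zs \<longrightarrow> {x, y} \<in> E \<longrightarrow> e \<in> E \<longrightarrow> y \<in> e \<longrightarrow> e = {x, y}"
proof -
  have meets: "e \<inter> X \<noteq> {}"
    if leaf: "\<And>x y e. x \<in> X \<Longrightarrow> y \<notin> X \<Longrightarrow> {x, y} \<in> E \<Longrightarrow> e \<in> E \<Longrightarrow> y \<in> e \<Longrightarrow> e = {x, y}"
      and r: "r \<in> X" and e: "e \<in> E" for X e
  proof -
    \<comment> \<open>A walk from \<open>r\<close> cannot get further than one step away from
      \<open>X\<close>, since the neighbours outside \<open>X\<close> are leaves.\<close>
    have near: "y \<in> X \<or> (\<exists>x\<in>X. {x, y} \<in> E)" if "y \<in> reach E {} r" for y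
      using that
    proof (induction rule: reach_induct)
      case (step y z)
      show ?case
      proof (cases "y \<in> X")
        case False
        then obtain x where x: "x \<in> X" "{x, y} \<in> E" using step by blast
        then have "{y, z} = {x, y}" using leaf[OF x(1) False x(2) step.hyps(2)] by blast
        then show ?thesis using x False by (auto simp: doubleton_eq_iff)
      qed (use step in blast)
    qed (use r in blast)
    obtain y where y: "y \<in> e" "y \<in> reach E {} r" using conn e by blast
    show ?thesis
    proof (cases "y \<in> X")
      case False
      then obtain x where x: "x \<in> X" "{x, y} \<in> E" using near[OF y(2)] by blast
      then show ?thesis using leaf[OF x(1) False x(2) e y(1)] by blast
    qed (use y in blast)
  qed
  show thesis
  proof (cases "\<exists>zs. is_cycle E zs \<and> hd zs = r")
    case False
    have leaf: "e = {x, y}" if xy: "x \<in> {r}" "y \<notin> {r}" "{x, y} \<in> E" "e \<in> E" "y \<in> e" for x y e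
    proof (rule leaf_if_not_splittable[OF ns _ xy(1-3) _ xy(4,5)])
      fix z w assume z: "z \<in> reach E {r} y" and w: "w \<in> {r}" "{z, w} \<in> E"
      obtain xs where xs: "gpath E xs" "xs \<noteq> []" "hd xs = y" "last xs = z" "set xs \<inter> {r} = {}"
        using reach_gpath[OF z xy(2)] .
      have "z = y"
      proof (rule ccontr)
        assume "z \<noteq> y"
        then have "2 \<le> length xs" using xs by (cases xs rule: list.exhaust) (auto simp: Suc_le_eq)
        moreover have "gpath E (r # xs)" using xs xy(1,3) by (cases xs) (auto simp: gpath_def)
        ultimately have "is_cycle E (r # xs)" using xs w unfolding is_cycle_def by simp
        then show False using False by auto
      qed
      then show "z = y \<and> w = x" using w xy(1) by simp
    qed simp
    have "r \<in> e" if "e \<in> E" for e using meets[OF leaf _ that, of "{r}"] by simp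
    then show thesis using star by blast
  next
    case True
    define P where "P zs \<longleftrightarrow> is_cycle E zs \<and> hd zs = r" for zs
    obtain zs0 where "P zs0" using True unfolding P_def by blast
    then have "\<exists>zs. P zs \<and> (\<forall>zs'. P zs' \<longrightarrow> length zs' \<le> length zs)"
      by (rule ex_has_greatest_nat[of P zs0 length "Suc (card (\<Union>E))"])
        (auto simp: P_def less_Suc_eq_le dest: cycle_length)
    then obtain zs where zs: "is_cycle E zs" "hd zs = r"
      and longest: "\<And>zs'. is_cycle E zs' \<Longrightarrow> hd zs' = r \<Longrightarrow> length zs' \<le> length zs"
      unfolding P_def by blast
    note found = cycle
    interpret cycle_in_graph E zs by unfold_locales (rule zs(1))
    have no_ear: False if "gpath E (zs ! i # xs @ [zs ! j])" "xs \<noteq> []" "set xs \<inter> set zs = {}" "i < j" "j < length zs" for i j xs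
    proof -
      have "zs = take i zs @ zs ! i # take (j - Suc i) (drop (Suc i) zs) @ zs ! j # drop (Suc j) zs"
        using that(4,5) id_take_nth_drop[of i zs] id_take_nth_drop[of "j - Suc i" "drop (Suc i) zs"] by simp
      then show False
        using longer_cycle[OF nt, of "take i zs" "zs ! i" "take (j - Suc i) (drop (Suc i) zs)" "zs ! j" "drop (Suc j) zs" xs]
          that(1-3) zs longest by (metis leD)
    qed
    have leaf: "e = {x, y}" if xy: "x \<in> set zs" "y \<notin> set zs" "{x, y} \<in> E" "e \<in> E" "y \<in> e" for x y e
    proof (rule leaf_if_not_splittable[OF ns _ xy(1-3) _ xy(4,5)])
      show "r \<in> set zs" using zs n3 by (metis hd_in_set list.size(3) not_numeral_le_zero)
      fix z w assume z: "z \<in> reach E (set zs) y" and w: "w \<in> set zs" "{z, w} \<in> E"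
      obtain xs where xs: "gpath E xs" "xs \<noteq> []" "hd xs = y" "last xs = z" "set xs \<inter> set zs = {}"
        using reach_gpath[OF z xy(2)] .
      obtain i where i: "i < n" "x = zs ! i" using xy(1) by (auto simp: in_set_conv_nth)
      obtain j where j: "j < n" "w = zs ! j" using w(1) by (auto simp: in_set_conv_nth)
      have zzs: "z \<notin> set zs" using reach_notin[OF z xy(2)] .
      have nr: "e \<notin> ring ` {..<n}" if "v \<in> e" "v \<notin> set zs" for v e
      proof -
        have "Suc l mod length zs < length zs" for l using n3 by (intro mod_less_divisor) linarith
        then show ?thesis using that by (auto simp: ring_def)
      qed
      have "i = j"
      proof (rule ccontr)
        assume "i \<noteq> j"
        then have "x \<noteq> w" using i j nth_eq by auto
        have "successively (\<lambda>x y. {x, y} \<in> E) (xs @ [w])"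
          using xs w by (simp add: gpath_def successively_append_iff)
        then have "successively (\<lambda>x y. {x, y} \<in> E) (x # xs @ [w])"
          using xs xy(3) by (simp add: successively_Cons hd_append)
        then have gp: "gpath E (x # xs @ [w])"
          using xs xy(1) w(1) \<open>x \<noteq> w\<close> unfolding gpath_def by auto
        then have "gpath E (w # rev xs @ [x])" using gpath_rev[of E "x # xs @ [w]"] by simp
        then show False
          using no_ear[of i xs j] no_ear[of j "rev xs" i] gp xs i j \<open>i \<noteq> j\<close> by (cases "i < j") auto
      qed
      \<comment> \<open>Both edges leave the cycle at the same vertex, which has at most one edge
        off the cycle.\<close>
      then have "{x, y} = {z, w}"
        using third_unique[of i "{x, y}" "{z, w}"] i j xy(3) w(2) nr[of y "{x, y}"] nr[of z "{z, w}"] xy(2) zzs by auto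
      then show "z = y \<and> w = x" using w xy zzs by (auto simp: doubleton_eq_iff)
    qed
    have r: "r \<in> set zs" using zs n3 by (metis hd_in_set list.size(3) not_numeral_le_zero)
    have m: "e \<inter> set zs \<noteq> {}" if "e \<in> E" for e by (rule meets[OF leaf r that])
    show thesis by (rule found[OF zs]) (use m leaf in blast)+
  qed
qed

end

lemma subcubic_graph_subset:
  assumes "subcubic_graph E" "F \<subseteq> E" shows "subcubic_graph F"
proof -
  interpret subcubic_graph E by fact
  show ?thesis
  proof
    show "finite F" using finite_edges assms(2) by (rule finite_subset[rotated])
    show "card e = 2" if "e \<in> F" for e using that assms(2) card_edge by blast
    show "card {e \<in> F. v \<in> e} \<le> 3" for v
      using card_mono[of "{e \<in> E. v \<in> e}" "{e \<in> F. v \<in> e}"] finite_edges assms(2) degree_le_3[of v]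
      by (auto intro: order_trans)
  qed
qed

lemma gpath_mono: "F \<subseteq> E \<Longrightarrow> gpath F xs \<Longrightarrow> gpath E xs"
  unfolding gpath_def by (auto elim: successively_mono)

lemma no_theta_subset: "no_theta E \<Longrightarrow> F \<subseteq> E \<Longrightarrow> no_theta F"
  unfolding no_theta_def using gpath_mono by blast

lemma no_crossing_subset:
  assumes nc: "no_crossing E" and sub: "F \<subseteq> E" shows "no_crossing F"
  unfolding no_crossing_def
proof (intro allI impI notI)
  fix a A b B c C d D
  assume *: "distinct (a # A @ b # B @ c # C @ d # D)"
    "successively (\<lambda>x y. {x, y} \<in> F) (a # A @ b # B @ c # C @ d # D @ [a])" "{a, c} \<in> F" "{b, d} \<in> F"
  have "successively (\<lambda>x y. {x, y} \<in> E) (a # A @ b # B @ c # C @ d # D @ [a])"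
    by (rule successively_mono[OF *(2)]) (use sub in auto)
  then show False using nc * sub unfolding no_crossing_def by blast
qed

section \<open>Existence of colourings\<close>

lemma splittableE:
  assumes "splittable E r"
  obtains E1 E2 u v where "E = E1 \<union> E2" "E1 \<inter> E2 = {}" "{u, v} \<in> E1" "\<Union>E1 \<inter> \<Union>E2 \<subseteq> {v}"
    "E2 \<noteq> {}" "r \<notin> \<Union>E2" "\<forall>e\<in>E1. v \<in> e \<longrightarrow> e = {u, v}"
  using assms unfolding splittable_def by (elim exE conjE) (rule that)

section \<open>Connected components\<close>

definition component :: "'a set set \<Rightarrow> 'a \<Rightarrow> 'a set set" where
  "component E r = {e \<in> E. e \<inter> reach E {} r \<noteq> {}}"

context subcubic_graph begin

lemma component_vertex:
  assumes "e \<in> component E r" "x \<in> e" shows "x \<in> reach E {} r"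
proof -
  have e: "e \<in> E" using assms by (simp add: component_def)
  obtain y where y: "e = {x, y}" using edge_other[OF e assms(2)] .
  show ?thesis
  proof (cases "x \<in> reach E {} r")
    case False
    then have "y \<in> reach E {} r" using assms y by (auto simp: component_def)
    then show ?thesis using reach_step[of y E "{}" r x] e y by (auto simp: insert_commute)
  qed
qed

lemma component_edge: "e \<in> E \<Longrightarrow> x \<in> e \<Longrightarrow> x \<in> \<Union>(component E r) \<Longrightarrow> e \<in> component E r"
proof -
  assume e: "e \<in> E" "x \<in> e" and "x \<in> \<Union>(component E r)"
  then have "x \<in> reach E {} r" using component_vertex by (elim UnionE)
  then show ?thesis using e unfolding component_def by blast
qed

lemma component_subset: "component E r \<subseteq> E"
  unfolding component_def by blast

lemma component_disjoint: "\<Union>(component E r) \<inter> \<Union>(E - component E r) = {}"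
proof -
  have False if "x \<in> \<Union>(component E r)" "x \<in> e" "e \<in> E - component E r" for x e
    using component_edge[of e x r] that by blast
  then show ?thesis by blast
qed

lemma component_degree:
  assumes "v \<in> \<Union>(component E r)"
  shows "{e \<in> E. v \<in> e} = {e \<in> component E r. v \<in> e}"
proof (rule Collect_cong)
  show "e \<in> E \<and> v \<in> e \<longleftrightarrow> e \<in> component E r \<and> v \<in> e" for e
    using component_edge[of e v r] assms component_subset[of r] by blast
qed

end

section \<open>Vertices of degree at most two\<close>

context cycle_in_graph begin

text \<open>Otherwise every position except the first is the end of a chord, as an edge leaving the
  cycle would end in a leaf. For a shortest chord from \<open>i\<close> to \<open>j\<close>, the
  chord at \<open>Suc i\<close> cannot stay below it by minimality, cannot end at \<open>i\<close>
  or \<open>j\<close>, and would cross it elsewhere.\<close>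

lemma low_degree_on_cycle:
  assumes nc: "no_crossing E"
    and leaf: "\<And>x y e. x \<in> set zs \<Longrightarrow> y \<notin> set zs \<Longrightarrow> {x, y} \<in> E \<Longrightarrow> e \<in> E \<Longrightarrow> y \<in> e \<Longrightarrow> e = {x, y}"
  shows "\<exists>v\<in>\<Union>E. v \<noteq> hd zs \<and> card {e \<in> E. v \<in> e} \<le> 2"
proof (rule ccontr)
  assume "\<not> ?thesis"
  then have deg: "2 < card {e \<in> E. v \<in> e}" if "v \<in> \<Union>E" "v \<noteq> hd zs" for v using that by force
  let ?R = "ring ` {..<length zs}"
  have hd: "hd zs = zs ! 0" using n3 by (intro hd_conv_nth) auto
  have third: "\<exists>l<n. {zs ! p, zs ! l} \<in> E \<and> {zs ! p, zs ! l} \<notin> ?R" if p: "0 < p" "p < n" for p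
  proof -
    have "0 < n" using n3 by linarith
    then have "zs ! p \<noteq> hd zs" using p(1) nth_eq[OF p(2), of 0] unfolding hd by blast
    moreover have "zs ! p \<in> \<Union>E" using ring_in[OF p(2)] ring_at(1)[OF p(2)] by blast
    ultimately have "2 < card {e \<in> E. zs ! p \<in> e}" using deg by blast
    moreover have "card {ring p, ring (prev p)} \<le> 2" by (simp add: card_insert_if)
    ultimately have "\<not> {e \<in> E. zs ! p \<in> e} \<subseteq> {ring p, ring (prev p)}"
      using card_mono[of "{ring p, ring (prev p)}" "{e \<in> E. zs ! p \<in> e}"] by auto
    then obtain e where e: "e \<in> E" "zs ! p \<in> e" "e \<noteq> ring p" "e \<noteq> ring (prev p)" by blast
    have eR: "e \<notin> ?R" using ring_atD[OF p(2)] e by auto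
    obtain q where q: "e = {zs ! p, q}" using edge_other[OF e(1,2)] .
    have "q \<in> set zs"
    proof (rule ccontr)
      assume nq: "q \<notin> set zs"
      have "f = e" if "f \<in> E" "q \<in> f" for f using leaf[OF _ nq _ that, of "zs ! p"] p(2) q e(1) by simp
      then have "{f \<in> E. q \<in> f} \<subseteq> {e}" by blast
      then have "card {f \<in> E. q \<in> f} \<le> 1" using card_mono[of "{e}"] by fastforce
      moreover have "q \<noteq> hd zs" using nq n3 hd by (metis hd_in_set list.size(3) not_numeral_le_zero)
      ultimately show False using deg[of q] q e(1) by auto
    qed
    then obtain l where "l < n" "zs ! l = q" by (auto simp: in_set_conv_nth)
    then show ?thesis using e(1) eR q by auto
  qed
  define P where "P c \<longleftrightarrow> (case c of (i, j) \<Rightarrow> i < j \<and> j < n \<and> {zs ! i, zs ! j} \<in> E \<and> {zs ! i, zs ! j} \<notin> ?R)"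
    for c
  have mk: "P (i, j) \<or> P (j, i)" if "i < n" "j < n" "{zs ! i, zs ! j} \<in> E" "{zs ! i, zs ! j} \<notin> ?R" for i j
  proof -
    have "i \<noteq> j" using card_edge[OF that(3)] by auto
    then show ?thesis using that unfolding P_def by (cases "i < j") (auto simp: insert_commute)
  qed
  have "0 < Suc 0" "Suc 0 < n" using n3 by auto
  then obtain l where "l < n" "{zs ! Suc 0, zs ! l} \<in> E" "{zs ! Suc 0, zs ! l} \<notin> ?R" using third by blast
  then have "\<exists>c. P c" using mk[OF \<open>Suc 0 < n\<close>] by blast
  then obtain c0 where c0: "P c0" by blast
  obtain c where c: "P c" "\<And>d. P d \<Longrightarrow> snd c - fst c \<le> snd d - fst d"
    using ex_has_least_nat[of P c0 "\<lambda>c. snd c - fst c"] c0 by blast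
  obtain i j where ij: "c = (i, j)" by (cases c)
  have e: "i < j" "j < n" "{zs ! i, zs ! j} \<in> E" "{zs ! i, zs ! j} \<notin> ?R" using c(1) ij by (auto simp: P_def)
  have nS: "j \<noteq> Suc i"
  proof
    assume "j = Suc i"
    then have "ring i = {zs ! i, zs ! j}" using e by (simp add: ring_def)
    then show False using e by auto
  qed
  define p where "p = Suc i"
  have p: "i < p" "p < j" "0 < p" "p < n" using e nS by (auto simp: p_def)
  obtain l where l: "l < n" "{zs ! p, zs ! l} \<in> E" "{zs ! p, zs ! l} \<notin> ?R" using third[OF p(3,4)] by blast
  have "l \<noteq> p" using card_edge[OF l(2)] by auto
  moreover have "l \<noteq> i"
  proof
    assume "l = i"
    then have "ring i = {zs ! p, zs ! l}" using p unfolding ring_def p_def by (simp add: insert_commute)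
    then show False using l e by auto
  qed
  moreover have "l \<noteq> j"
  proof
    assume "l = j"
    then have "{zs ! i, zs ! j} = {zs ! p, zs ! j}"
      using third_unique[OF e(2,3), of "{zs ! p, zs ! j}"] l e by auto
    then show False using nth_eq p e by (auto simp: doubleton_eq_iff)
  qed
  moreover have "\<not> (p < l \<and> l < j)"
  proof
    assume a: "p < l \<and> l < j"
    then have "P (p, l)" using l unfolding P_def by auto
    then have "j - i \<le> l - p" using c(2)[of "(p, l)"] ij by simp
    then show False using a p by linarith
  qed
  moreover have "\<not> l < i"
  proof
    assume "l < i"
    moreover have "{zs ! l, zs ! p} \<in> E" using l(2) by (simp add: insert_commute)
    ultimately show False using crossing_chords[OF nc _ p(1,2) e(2) _ e(3)] by blast
  qed
  moreover have "\<not> j < l" using crossing_chords[OF nc p(1,2) _ l(1) e(3) l(2)] by blast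
  ultimately show False using p unfolding p_def by linarith
qed

end

text \<open>Avoiding a prescribed vertex makes the induction work: when a bridge is split off, the
  vertex found in \<open>E2\<close> must differ from \<open>v\<close>, the only vertex of
  \<open>E2\<close> with an edge in \<open>E1\<close>.\<close>

lemma low_degree_vertex:
  assumes "subcubic_graph E" "no_theta E" "no_crossing E" "E \<noteq> {}"
  shows "\<exists>v\<in>\<Union>E. v \<noteq> r \<and> card {e \<in> E. v \<in> e} \<le> 2"
  using assms
proof (induction "card E" arbitrary: E r rule: less_induct)
  case less
  interpret subcubic_graph E by (rule less.prems(1))
  have IH: "\<exists>v\<in>\<Union>F. v \<noteq> s \<and> card {e \<in> F. v \<in> e} \<le> 2" if "F \<subseteq> E" "F \<noteq> E" "F \<noteq> {}" for F s
    using less.hyps[of F s] that psubset_card_mono[OF finite_edges, of F]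
      subcubic_graph_subset[OF less.prems(1) that(1)] no_theta_subset[OF less.prems(2) that(1)]
      no_crossing_subset[OF less.prems(3) that(1)] by blast
  have main: "\<exists>v\<in>\<Union>E. v \<noteq> r \<and> card {e \<in> E. v \<in> e} \<le> 2" if r: "r \<in> \<Union>E" for r
  proof (cases "component E r = E")
    case False
    obtain e where "e \<in> E" "r \<in> e" using r by blast
    then have "component E r \<noteq> {}" using reach_refl[of r E "{}"] unfolding component_def by blast
    then obtain v where v: "v \<in> \<Union>(component E r)" "v \<noteq> r" "card {e \<in> component E r. v \<in> e} \<le> 2"
      using IH[of "component E r" r] False unfolding component_def by blast
    have "v \<in> \<Union>E" using v(1) unfolding component_def by blast
    then show ?thesis using v(2,3) unfolding component_degree[OF v(1), symmetric] by blast
  next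
    case True
    then have conn: "\<forall>e\<in>E. e \<inter> reach E {} r \<noteq> {}" unfolding component_def by blast
    show ?thesis
    proof (cases "splittable E r")
      case True
      then obtain E1 E2 u v where s: "E = E1 \<union> E2" "E1 \<inter> E2 = {}" "{u, v} \<in> E1" "\<Union>E1 \<inter> \<Union>E2 \<subseteq> {v}"
        "E2 \<noteq> {}" "r \<notin> \<Union>E2" by (rule splittableE)
      have "E2 \<subseteq> E" "E2 \<noteq> E" using s by blast+
      then obtain w where w: "w \<in> \<Union>E2" "w \<noteq> v" "card {e \<in> E2. w \<in> e} \<le> 2" using IH[of E2 v] s(5) by blast
      have "{e \<in> E. w \<in> e} = {e \<in> E2. w \<in> e}" using s w by blast
      then show ?thesis using s(1,6) w by (intro bexI[of _ w]) auto
    next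
      case False
      show ?thesis
      proof (cases rule: core_cases[OF less.prems(2) False conn])
        case 1
        obtain e where e: "e \<in> E" using less.prems(4) by blast
        then have "r \<in> e" using 1 by blast
        then obtain a where a: "e = {r, a}" "r \<noteq> a" using edge_other[OF e] by blast
        have "f = e" if f: "f \<in> E" "a \<in> f" for f
        proof -
          have "r \<in> f" using 1 f(1) by blast
          then obtain b where "f = {r, b}" using edge_other[OF f(1)] by blast
          then show ?thesis using f(2) a by blast
        qed
        then have "{f \<in> E. a \<in> f} \<subseteq> {e}" by blast
        then have "card {f \<in> E. a \<in> f} \<le> 1" using card_mono[of "{e}"] by fastforce
        then show ?thesis using a e by (intro bexI[of _ a]) auto
      next
        case (2 zs)
        interpret cycle_in_graph E zs by unfold_locales (rule 2(1))
        show ?thesis unfolding 2(2)[symmetric]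
          by (rule low_degree_on_cycle[OF less.prems(3)]) (use 2(4) in blast)
      qed
    qed
  qed
  show ?case
  proof (cases "r \<in> \<Union>E")
    case False
    obtain e x where ex: "e \<in> E" "x \<in> e" using less.prems(4) card_edge by fastforce
    then have "x \<in> \<Union>E" by blast
    then show ?thesis using main[of x] False by metis
  qed (rule main)
qed

section \<open>Colourings of components and stars\<close>

lemma rooted_coloring_near:
  "rooted_coloring E k r c a b \<Longrightarrow> e \<in> E \<Longrightarrow> r \<in> e \<Longrightarrow>
    k e \<noteq> c \<and> k e \<noteq> 5 \<and> (k e \<noteq> 0 \<longrightarrow> k e \<noteq> a \<and> k e \<noteq> b)"
  unfolding rooted_coloring_def by blast

lemma rooted_coloring_far:
  "rooted_coloring E k r c a b \<Longrightarrow> c \<noteq> 0 \<Longrightarrow> e \<in> E \<Longrightarrow> g \<in> E \<Longrightarrow> r \<in> e \<Longrightarrow> e \<inter> g \<noteq> {} \<Longrightarrow> k g \<noteq> c"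
  unfolding rooted_coloring_def by blast

lemma good_coloring_disjoint_Un:
  assumes d: "\<Union>E1 \<inter> \<Union>E2 = {}" and ne: "{} \<notin> E1"
    and g1: "good_coloring E1 k1" and g2: "good_coloring E2 k2"
  shows "good_coloring (E1 \<union> E2) (\<lambda>e. if e \<in> E1 then k1 e else k2 e)"
proof -
  define k where "k e = (if e \<in> E1 then k1 e else k2 e)" for e
  have k1: "k e = k1 e" if "e \<in> E1" for e using that by (simp add: k_def)
  have nE: "e \<notin> E1" if "e \<in> E2" for e
  proof
    assume "e \<in> E1"
    then have "e = {}" using that d by auto
    then show False using ne \<open>e \<in> E1\<close> by blast
  qed
  have k2: "k e = k2 e" if "e \<in> E2" for e using that nE by (simp add: k_def)
  have s1: "f \<in> E1" if "e \<in> E1" "f \<in> E1 \<union> E2" "e \<inter> f \<noteq> {} \<or> f \<inter> e \<noteq> {}" for e f using that d by blast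
  have s2: "f \<in> E2" if "e \<in> E2" "f \<in> E1 \<union> E2" "e \<inter> f \<noteq> {} \<or> f \<inter> e \<noteq> {}" for e f using that d by blast
  have P0: "k e \<le> 5" if "e \<in> E1 \<union> E2" for e
    using that k1 k2 good_coloring_le[OF g1] good_coloring_le[OF g2] by auto
  have P1: "k e \<noteq> k f" if e: "e \<in> E1 \<union> E2" and f: "f \<in> E1 \<union> E2" and n: "e \<noteq> f" "e \<inter> f \<noteq> {}" for e f
    using e
  proof
    assume e: "e \<in> E1"
    have "f \<in> E1" using s1[OF e f] n by blast
    then show ?thesis using good_coloring_proper[OF g1 e _ n] k1 e by simp
  next
    assume e: "e \<in> E2"
    have "f \<in> E2" using s2[OF e f] n by blast
    then show ?thesis using good_coloring_proper[OF g2 e _ n] k2 e by simp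
  qed
  have P2: "k f = 0" if e: "e \<in> E1 \<union> E2" and f: "f \<in> E1 \<union> E2" and g: "g \<in> E1 \<union> E2"
    and n: "f \<noteq> g" "f \<inter> e \<noteq> {}" "g \<inter> e \<noteq> {}" and eq: "k f = k g" for e f g
    using e
  proof
    assume e: "e \<in> E1"
    have "f \<in> E1" "g \<in> E1" using s1[OF e f] s1[OF e g] n by blast+
    then show ?thesis using good_coloring_strong[OF g1 e _ _ n] k1 eq by simp
  next
    assume e: "e \<in> E2"
    have "f \<in> E2" "g \<in> E2" using s2[OF e f] s2[OF e g] n by blast+
    then show ?thesis using good_coloring_strong[OF g2 e _ _ n] k2 eq by simp
  qed
  have P5: "k g \<noteq> 5" if f: "f \<in> E1 \<union> E2" and g: "g \<in> E1 \<union> E2" and e: "e \<in> E1 \<union> E2" and h: "h \<in> E1 \<union> E2"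
    and n: "f \<noteq> g" "f \<inter> e \<noteq> {}" "e \<inter> h \<noteq> {}" "h \<inter> g \<noteq> {}" and kf: "k f = 5" for e f g h
    using e
  proof
    assume e: "e \<in> E1"
    have "f \<in> E1" "h \<in> E1" using s1[OF e f] s1[OF e h] n by blast+
    moreover have "g \<in> E1" using s1[OF \<open>h \<in> E1\<close> g] n by blast
    ultimately show ?thesis using good_coloring_five[OF g1 _ _ e _ n] k1 kf by simp
  next
    assume e: "e \<in> E2"
    have "f \<in> E2" "h \<in> E2" using s2[OF e f] s2[OF e h] n by blast+
    moreover have "g \<in> E2" using s2[OF \<open>h \<in> E2\<close> g] n by blast
    ultimately show ?thesis using good_coloring_five[OF g2 _ _ e _ n] k2 kf by simp
  qed
  have Pp: "k e \<noteq> 5" if e: "e \<in> E1 \<union> E2" and f: "f \<in> E1 \<union> E2" and p: "pendant (E1 \<union> E2) f" and i: "e \<inter> f \<noteq> {}" for e f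
    using e
  proof
    assume e: "e \<in> E1"
    have "f \<in> E1" using s1[OF e f] i by blast
    moreover have "pendant E1 f" using p unfolding pendant_def by blast
    ultimately show ?thesis using good_coloring_pendant[OF g1 e _ _ i] k1 e by simp
  next
    assume e: "e \<in> E2"
    have "f \<in> E2" using s2[OF e f] i by blast
    moreover have "pendant E2 f" using p unfolding pendant_def by blast
    ultimately show ?thesis using good_coloring_pendant[OF g2 e _ _ i] k2 e by simp
  qed
  have "good_coloring (E1 \<union> E2) k"
    unfolding good_coloring_def
    by (intro conjI ballI impI) (rule P0 P1 P2 P5 Pp; assumption)+
  then show ?thesis unfolding k_def .
qed

lemma rooted_coloring_disjoint_Un:
  assumes d: "\<Union>E1 \<inter> \<Union>E2 = {}" and ne: "{} \<notin> E1"
    and "rooted_coloring E1 k1 r c a b" "rooted_coloring E2 k2 r c a b"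
  shows "rooted_coloring (E1 \<union> E2) (\<lambda>e. if e \<in> E1 then k1 e else k2 e) r c a b"
proof -
  have nE: "e \<notin> E1" if "e \<in> E2" for e
  proof
    assume "e \<in> E1"
    then have "e = {}" using that d by auto
    then show False using ne \<open>e \<in> E1\<close> by blast
  qed
  have side: "e \<in> E1 \<and> g \<in> E1 \<or> e \<in> E2 \<and> g \<in> E2" if "e \<in> E1 \<union> E2" "g \<in> E1 \<union> E2" "e \<inter> g \<noteq> {}" for e g
    using that d by blast
  show ?thesis
    unfolding rooted_coloring_def
  proof (intro conjI ballI impI)
    fix e assume e: "e \<in> E1 \<union> E2" "r \<in> e"
    then show "(if e \<in> E1 then k1 e else k2 e) \<noteq> c" "(if e \<in> E1 then k1 e else k2 e) \<noteq> 5"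
      "(if e \<in> E1 then k1 e else k2 e) \<noteq> 0 \<Longrightarrow> (if e \<in> E1 then k1 e else k2 e) \<noteq> a"
      "(if e \<in> E1 then k1 e else k2 e) \<noteq> 0 \<Longrightarrow> (if e \<in> E1 then k1 e else k2 e) \<noteq> b"
      using rooted_coloring_near[OF assms(3), of e] rooted_coloring_near[OF assms(4), of e] nE[of e]
      by (cases "e \<in> E1"; simp)+
  next
    fix e g assume *: "c \<noteq> 0" "e \<in> E1 \<union> E2" "g \<in> E1 \<union> E2" "r \<in> e" "e \<inter> g \<noteq> {}"
    show "(if g \<in> E1 then k1 g else k2 g) \<noteq> c"
      using side[OF *(2,3,5)] rooted_coloring_far[OF assms(3) *(1) _ _ *(4,5)]
        rooted_coloring_far[OF assms(4) *(1) _ _ *(4,5)] nE[of g] by auto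
  qed
qed

text \<open>Pads the colours found at one end of a bridge to exactly two, as the induction
  hypothesis expects three different colours.\<close>

lemma exists_two_colors:
  assumes "finite S" "card S \<le> 2" "S \<subseteq> {0..4} - {x::nat}"
  obtains a b where "a \<le> 4" "b \<le> 4" "distinct [x, a, b]" "S \<subseteq> {a, b}"
proof -
  have "card {0..4::nat} - card {x} \<le> card ({0..4} - {x})" by (rule diff_card_le_card_Diff) simp
  then have "2 \<le> card ({0..4} - {x})" by simp
  then obtain T where T: "S \<subseteq> T" "T \<subseteq> {0..4} - {x}" "card T = 2"
    using exists_subset_between[of S 2 "{0..4} - {x}"] assms by auto
  then obtain a b where ab: "T = {a, b}" "a \<noteq> b" by (auto simp: card_2_iff)
  then have "a \<in> {0..4} - {x}" "b \<in> {0..4} - {x}" using T(2) by blast+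
  then show thesis using that[of a b] T(1) ab by auto
qed

context subcubic_graph begin

text \<open>Without \<open>c\<close>, \<open>a\<close>, \<open>b\<close> two of the colours
  \<open>0\<close> to \<open>4\<close> remain, one for each edge.\<close>

lemma star_coloring:
  assumes star: "\<forall>e\<in>E. r \<in> e" and deg: "card {e \<in> E. r \<in> e} \<le> 2"
    and cab: "c \<le> 4" "a \<le> 4" "b \<le> 4" "distinct [c, a, b]"
  shows "\<exists>k. good_coloring E k \<and> rooted_coloring E k r c a b"
proof -
  have "{e \<in> E. r \<in> e} = E" using star by blast
  then have cE: "card E \<le> 2" using deg by simp
  have "\<exists>x y. x \<noteq> y \<and> {x, y} \<subseteq> {0..4} - {c} \<and> (x \<noteq> 0 \<longrightarrow> x \<noteq> a \<and> x \<noteq> b) \<and> (y \<noteq> 0 \<longrightarrow> y \<noteq> a \<and> y \<noteq> b)"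
  proof -
    have "card {0..4::nat} - card {c, a, b} \<le> card ({0..4} - {c, a, b})" by (rule diff_card_le_card_Diff) simp
    moreover have "card {c, a, b} = 3" using cab(4) by auto
    ultimately have "2 \<le> card ({0..4} - {c, a, b})" by simp
    then obtain T where "T \<subseteq> {0..4} - {c, a, b}" "card T = 2"
      by (meson obtain_subset_with_card_n)
    then obtain x y where "{x, y} \<subseteq> {0..4} - {c, a, b}" "x \<noteq> y" by (auto simp: card_2_iff)
    then show ?thesis by blast
  qed
  then obtain x y where xy: "x \<noteq> y" "{x, y} \<subseteq> {0..4} - {c}" "x \<noteq> 0 \<longrightarrow> x \<noteq> a \<and> x \<noteq> b" "y \<noteq> 0 \<longrightarrow> y \<noteq> a \<and> y \<noteq> b"
    by blast
  have "card E \<le> card {x, y}" using cE xy(1) by simp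
  then obtain k where k: "k ` E \<subseteq> {x, y}" "inj_on k E"
    using card_le_inj[of E "{x, y}"] finite_edges by auto
  have le: "k e \<le> 4" "k e \<noteq> c" "k e \<noteq> 0 \<longrightarrow> k e \<noteq> a \<and> k e \<noteq> b" if "e \<in> E" for e
  proof -
    have "k e = x \<or> k e = y" using k(1) that by blast
    then show "k e \<le> 4" "k e \<noteq> c" "k e \<noteq> 0 \<longrightarrow> k e \<noteq> a \<and> k e \<noteq> b" using xy by auto
  qed
  have ne5: "k e \<noteq> 5" if "e \<in> E" for e using le(1)[OF that] by simp
  have inj: "e = f" if "e \<in> E" "f \<in> E" "k e = k f" for e f using k(2) that by (auto dest: inj_onD)
  have P0: "k e \<le> 5" if "e \<in> E" for e using le(1)[OF that] by simp
  have "good_coloring E k"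
    unfolding good_coloring_def using P0 inj ne5 by (intro conjI ballI impI) blast+
  moreover have "rooted_coloring E k r c a b"
    unfolding rooted_coloring_def using le ne5 by blast
  ultimately show ?thesis by blast
qed

end

theorem rooted_coloring_exists:
  assumes "subcubic_graph E" "no_theta E" "no_crossing E" "card {e \<in> E. r \<in> e} \<le> 2"
    and "c \<le> 4" "a \<le> 4" "b \<le> 4" "distinct [c, a, b]"
  shows "\<exists>k. good_coloring E k \<and> rooted_coloring E k r c a b"
  using assms
proof (induction "card E" arbitrary: E r c a b rule: less_induct)
  case less
  interpret subcubic_graph E by (rule less.prems(1))
  have IH: "\<exists>k. good_coloring F k \<and> rooted_coloring F k s c' a' b'"
    if F: "F \<subseteq> E" "F \<noteq> E" and deg: "card {e \<in> F. s \<in> e} \<le> 2"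
      and cab: "c' \<le> 4" "a' \<le> 4" "b' \<le> 4" "distinct [c', a', b']" for F s c' a' b'
  proof (rule less.hyps)
    show "card F < card E" using F finite_edges by (intro psubset_card_mono) auto
    show "subcubic_graph F" "no_theta F" "no_crossing F"
      using subcubic_graph_subset[OF less.prems(1) F(1)] no_theta_subset[OF less.prems(2) F(1)]
        no_crossing_subset[OF less.prems(3) F(1)] by blast+
  qed (fact deg cab)+
  have deg_sub: "card {e \<in> F. s \<in> e} \<le> card {e \<in> E. s \<in> e}" if "F \<subseteq> E" for F s
    using that finite_edges by (intro card_mono) auto
  have main: "\<exists>k. good_coloring E k \<and> rooted_coloring E k r c a b"
    if r: "r \<in> \<Union>E" and deg: "card {e \<in> E. r \<in> e} \<le> 2"
      and cab: "c \<le> 4" "a \<le> 4" "b \<le> 4" "distinct [c, a, b]" for r c a b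
  proof (cases "component E r = E")
    case False
    let ?F = "component E r"
    have EF: "?F \<union> (E - ?F) = E" using component_subset[of r] by blast
    obtain e where "e \<in> E" "r \<in> e" using r by blast
    then have "?F \<noteq> {}" using reach_refl[of r E "{}"] unfolding component_def by blast
    then have "E - ?F \<noteq> E" using component_subset[of r] by blast
    \<comment> \<open>The root lies on no edge of the rest, so there the root condition is empty;
      both pieces can be given the same parameters.\<close>
    then obtain k2 where k2: "good_coloring (E - ?F) k2" "rooted_coloring (E - ?F) k2 r c a b"
      using IH[of "E - ?F" r c a b] deg_sub[of "E - ?F" r] deg cab by auto
    obtain k1 where k1: "good_coloring ?F k1" "rooted_coloring ?F k1 r c a b"
      using IH[OF component_subset False _ cab, of r] deg_sub[OF component_subset, of r r] deg by auto
    have ne: "{} \<notin> ?F" using card_edge component_subset[of r] by fastforce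
    show ?thesis
      using good_coloring_disjoint_Un[OF component_disjoint ne k1(1) k2(1)]
        rooted_coloring_disjoint_Un[OF component_disjoint ne k1(2) k2(2)] unfolding EF by blast
  next
    case True
    then have conn: "\<forall>e\<in>E. e \<inter> reach E {} r \<noteq> {}" unfolding component_def by blast
    show ?thesis
    proof (cases "splittable E r")
      case True
      then obtain E1 E2 u v where s: "E = E1 \<union> E2" "E1 \<inter> E2 = {}" "{u, v} \<in> E1" "\<Union>E1 \<inter> \<Union>E2 \<subseteq> {v}"
        "E2 \<noteq> {}" "r \<notin> \<Union>E2" "\<forall>e\<in>E1. v \<in> e \<longrightarrow> e = {u, v}" by (rule splittableE)
      interpret pendant_gluing E1 E2 u v
      proof
        show "card e = 2" if "e \<in> E1 \<union> E2" for e using card_edge that unfolding s(1) by blast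
        show "e = {u, v}" if "e \<in> E1" "v \<in> e" for e using s(7) that by blast
      qed (fact s(3,4))+
      have sub: "E1 \<subseteq> E" "E1 \<noteq> E" "E2 \<subseteq> E" "E2 \<noteq> E" using s(1-3,5) by blast+
      obtain k1 where k1: "good_coloring E1 k1" "rooted_coloring E1 k1 r c a b"
        using IH[OF sub(1,2) _ cab, of r] deg_sub[OF sub(1), of r] deg by auto
      let ?x = "k1 {u, v}"
      define N where "N = {e \<in> E1. u \<in> e} - {{u, v}}"
      \<comment> \<open>The colours that are at distance one from the bridge on the side of
        \<open>u\<close>. If \<open>u\<close> is the root, its third edge outside \<open>E\<close>
        contributes \<open>c\<close>; then \<open>u\<close> has at most two edges in
        \<open>E\<close>, so \<open>S\<close> never has more than two elements.\<close>
      define S where "S = k1 ` N \<union> (if r = u then {c} else {})"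
      have finN: "finite N" "finite {e \<in> E1. u \<in> e}" using finite_edges sub(1) by (auto simp: N_def intro: finite_subset)
      have cN: "card N = card {e \<in> E1. u \<in> e} - 1" unfolding N_def using s(3) by (simp add: card_Diff_singleton)
      have "card S \<le> card N + (if r = u then 1 else 0)"
        unfolding S_def using card_Un_le[of "k1 ` N" "if r = u then {c} else {}"] card_image_le[OF finN(1), of k1]
        by (auto split: if_splits)
      then have cS: "card S \<le> 2"
        using cN deg_sub[OF sub(1), of u] deg degree_le_3[of u] by (auto split: if_splits)
      have pend: "pendant E1 {u, v}" unfolding pendant_def using s(7) by blast
      have near5: "k1 e \<noteq> 5" if "e \<in> E1" "u \<in> e" for e
        using good_coloring_pendant[OF k1(1) that(1) s(3) pend] that(2) by blast
      have le4: "k1 e \<le> 4" if "e \<in> E1" "u \<in> e" for e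
        using good_coloring_le[OF k1(1) that(1)] near5[OF that] by simp
      have "S \<subseteq> {0..4} - {?x}"
      proof
        fix z assume "z \<in> S"
        then consider e where "e \<in> N" "z = k1 e" | "r = u" "z = c" unfolding S_def by (auto split: if_splits)
        then show "z \<in> {0..4} - {?x}"
        proof cases
          case 1
          then have e: "e \<in> E1" "u \<in> e" "e \<noteq> {u, v}" by (auto simp: N_def)
          then have "k1 e \<noteq> ?x" using good_coloring_proper[OF k1(1) e(1) s(3) e(3)] by blast
          then show ?thesis using le4[OF e(1,2)] 1 by simp
        next
          case 2
          then have "?x \<noteq> c" using rooted_coloring_near[OF k1(2) s(3)] by simp
          then show ?thesis using 2 cab(1) by auto
        qed
      qed
      moreover have "finite S" unfolding S_def using finN(1) by auto
      ultimately obtain a' b' where ab: "a' \<le> 4" "b' \<le> 4" "distinct [?x, a', b']" "S \<subseteq> {a', b'}"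
        using exists_two_colors[OF _ cS, of ?x] by blast
      \<comment> \<open>The bridge belongs to \<open>E1\<close>, so \<open>v\<close> has at most two
        edges in \<open>E2\<close> and can be the root there.\<close>
      have "{e \<in> E2. v \<in> e} \<subseteq> {e \<in> E. v \<in> e} - {{u, v}}" using s(1-3) by blast
      then have "card {e \<in> E2. v \<in> e} \<le> card ({e \<in> E. v \<in> e} - {{u, v}})"
        using finite_edges by (intro card_mono) auto
      also have "\<dots> \<le> 2" using degree_le_3[of v] s(1,3) by (simp add: card_Diff_singleton)
      finally obtain k2 where k2: "good_coloring E2 k2" "rooted_coloring E2 k2 v ?x a' b'"
        using IH[OF sub(3,4) _ le4[OF s(3)] ab(1-3), of v] by auto
      have "k1 e = a' \<or> k1 e = b'" if "e \<in> E1" "u \<in> e" "e \<noteq> {u, v}" for e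
      proof -
        have "e \<in> N" using that unfolding N_def by blast
        then show ?thesis using ab(4) unfolding S_def by blast
      qed
      then have "good_coloring E (\<lambda>e. if e \<in> E1 then k1 e else k2 e)"
        using good_coloring_glue[OF k1(1) k2] s(1) by simp
      moreover have "c = a' \<or> c = b'" if "r = u" using ab(4) that unfolding S_def by auto
      then have "rooted_coloring E (\<lambda>e. if e \<in> E1 then k1 e else k2 e) r c a b"
        using rooted_coloring_glue[OF k1(2) s(6) k2(2)] s(1) by simp
      ultimately show ?thesis by blast
    next
      case False
      show ?thesis
      proof (cases rule: core_cases[OF less.prems(2) False conn])
        case 1
        then show ?thesis using star_coloring deg cab by blast
      next
        case (2 zs)
        interpret cycle_core E zs
          by unfold_locales (use 2 less.prems(3) deg in auto)
        show ?thesis using cycle_coloring[OF cab] 2(2) by simp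
      qed
    qed
  qed
  show ?case
  proof (cases "r \<in> \<Union>E")
    case True
    then show ?thesis using main less.prems(4-8) by blast
  next
    case r: False
    show ?thesis
    proof (cases "E = {}")
      case True
      then show ?thesis by (auto simp: good_coloring_def rooted_coloring_def)
    next
      case False
      \<comment> \<open>For a root on no edge only a good colouring is asked for; it is obtained
        with another root.\<close>
      then obtain v where v: "v \<in> \<Union>E" "card {e \<in> E. v \<in> e} \<le> 2"
        using low_degree_vertex[OF less.prems(1-3)] by blast
      obtain k where "good_coloring E k" using main[OF v less.prems(5-8)] by blast
      then show ?thesis using r unfolding rooted_coloring_def by blast
    qed
  qed
qed

section \<open>Packing colourings\<close>

lemma outerplanar_no_theta_no_crossing:
  assumes "outerplanar V E" "\<Union>E \<subseteq> V"
  shows "no_theta E" "no_crossing E"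
proof -
  obtain p \<gamma> where "outerplanar_drawing V E p \<gamma>"
    using assms unfolding outerplanar_def outerplanar_drawing_def by blast
  then interpret outerplanar_drawing V E p \<gamma> .
  show "no_theta E" unfolding no_theta_def using trace_inside(1) by blast
  show "no_crossing E" unfolding no_crossing_def using no_crossing_chords by blast
qed

lemma line_graph_edgeD:
  assumes "{e, f} \<in> line_graph E" shows "e \<in> E" "f \<in> E" "e \<inter> f \<noteq> {}"
  using assms unfolding line_graph_def by (auto simp: doubleton_eq_iff Int_commute)

text \<open>A walk of length \<open>n\<close> in the line graph passes \<open>n - 1\<close> edges in
  between; the clauses on proper colouring, on nonzero colours and on the colour \<open>5\<close>
  exclude the lengths one, two and three.\<close>

lemma good_coloring_edge_dist:
  assumes g: "good_coloring E k" and e: "e \<in> E" "f \<in> E" "e \<noteq> f" "k e = k f"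
    and s: "s \<le> 1 \<or> (s \<le> 2 \<and> k e \<noteq> 0) \<or> (s \<le> 3 \<and> k e = 5)"
  shows "enat (s + 1) \<le> edge_dist E e f"
  unfolding edge_dist_def graph_dist_def
proof (rule INF_greatest)
  fix n assume "n \<in> {n. (e, f) \<in> {(x, y). {x, y} \<in> line_graph E} ^^ n}"
  then have n: "(e, f) \<in> {(x, y). {x, y} \<in> line_graph E} ^^ n" by simp
  have n0: "n \<noteq> 0" using n e(3) by (cases n) auto
  have n1: "n \<noteq> 1"
    using n good_coloring_proper[OF g e(1-3)] e(4) line_graph_edgeD[of e f E] by (cases "n = 1") auto
  have n2: "k e = 0" if two: "n = 2"
  proof -
    obtain h where h: "{e, h} \<in> line_graph E" "{h, f} \<in> line_graph E"
      using n unfolding two by (auto simp: numeral_2_eq_2)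
    show ?thesis
      using good_coloring_strong[OF g, of h e f] e line_graph_edgeD[OF h(1)] line_graph_edgeD[OF h(2)]
      by (simp add: Int_commute)
  qed
  have n3: "k e \<noteq> 5" if three: "n = 3"
  proof -
    obtain h1 h2 where h: "{e, h1} \<in> line_graph E" "{h1, h2} \<in> line_graph E" "{h2, f} \<in> line_graph E"
      using n unfolding three by (auto simp: numeral_3_eq_3)
    show ?thesis
      using good_coloring_five[OF g e(1,2), of h1 h2] e(3,4)
        line_graph_edgeD[OF h(1)] line_graph_edgeD[OF h(2)] line_graph_edgeD[OF h(3)] by auto
  qed
  have "s + 1 \<le> n"
  proof (rule ccontr)
    assume "\<not> s + 1 \<le> n"
    then have "n = 1 \<or> (n = 2 \<and> 2 \<le> s) \<or> (n = 3 \<and> 3 \<le> s)" using n0 s by linarith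
    then show False using n1 n2 n3 s by auto
  qed
  then show "enat (s + 1) \<le> enat n" by simp
qed

theorem theorem2p2:
  fixes V :: "'a set" and E :: "'a set set"
  assumes "simple_graph V E"
    and "subcubic V E"
    and "outerplanar V E"
  shows "packing_edge_colorable E [1, 2, 2, 2, 2, 3]"
proof -
  have EV: "\<Union>E \<subseteq> V" using assms(1) unfolding simple_graph_def by blast
  have sc: "subcubic_graph E"
  proof
    have "E \<subseteq> Pow V" "finite V" using assms(1) unfolding simple_graph_def by blast+
    then show "finite E" by (meson finite_Pow_iff finite_subset)
    show "card e = 2" if "e \<in> E" for e using assms(1) that unfolding simple_graph_def by blast
    show "card {e \<in> E. v \<in> e} \<le> 3" for v
    proof (cases "v \<in> V")
      case True
      then show ?thesis using assms(2) unfolding subcubic_def vdegree_def by blast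
    next
      case False
      then have "{e \<in> E. v \<in> e} = {}" using EV by blast
      then show ?thesis by (simp only: card.empty)
    qed
  qed
  note op = outerplanar_no_theta_no_crossing[OF assms(3) EV]
  have "\<exists>v. card {e \<in> E. v \<in> e} \<le> 2"
  proof (cases "E = {}")
    case False
    then show ?thesis using low_degree_vertex[OF sc op] by blast
  qed auto
  then obtain v where "card {e \<in> E. v \<in> e} \<le> 2" by blast
  \<comment> \<open>Any three different colours up to \<open>4\<close> serve for the imaginary third
    edge and the edges behind it.\<close>
  then obtain k where k: "good_coloring E k"
    using rooted_coloring_exists[OF sc op, of v 0 1 2] by auto
  define C where "C i = {e \<in> E. k e = i}" for i
  have "packing_edge_coloring E [1, 2, 2, 2, 2, 3] C"
    unfolding packing_edge_coloring_def
  proof (intro conjI allI impI ballI)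
    show "(\<Union>i<length [1, 2, 2, 2, 2, 3 :: nat]. C i) = E"
      using good_coloring_le[OF k] by (fastforce simp: C_def)
    show "disjoint_family_on C {..<length [1, 2, 2, 2, 2, 3 :: nat]}"
      by (auto simp: disjoint_family_on_def C_def)
    fix i e f
    assume i: "i < length [1, 2, 2, 2, 2, 3 :: nat]" and ef: "e \<in> C i" "f \<in> C i" "e \<noteq> f"
    have "i \<in> {0, 1, 2, 3, 4, 5}" using i by auto
    then have "let s = [1, 2, 2, 2, 2, 3] ! i in s \<le> 1 \<or> (s \<le> 2 \<and> i \<noteq> 0) \<or> (s \<le> (3 :: nat) \<and> i = 5)"
      by auto
    then show "enat ([1, 2, 2, 2, 2, 3] ! i + 1) \<le> edge_dist E e f"
      using ef by (intro good_coloring_edge_dist[OF k]) (auto simp: C_def Let_def)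
  qed
  moreover have "packing_sequence [1, 2, 2, 2, 2, 3]" by (simp add: packing_sequence_def)
  ultimately show ?thesis unfolding packing_edge_colorable_def by blast
qed

end
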